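(* Let $\Phi$ be a root system of type $A_n$ ($n\ge1$) or $D_n$ ($n\ge4$), with positive roots $\Phi_{>0}$. Let $E(\Phi)$ be the exchange graph of $\Phi$ and let $E(\Phi_{>0})$ be the subgraph of $E(\Phi)$ whose vertices are the positive clusters. Then the number of edges in $E(\Phi_{>0})$ is $$\binom{2n-1}{n+1}\ \text{ if } \Phi \text{ is of type } A_n,\qquad (3n-4)\binom{2(n-2)}{n-3}\ \text{ if }\Phi\text{ is of type } D_n.$$
   Context: (Fomin–Zelevinsky's notions.) Let $\Phi$ be an irreducible simply-laced root system of rank $n$ with simple roots $\alpha_i$ ($i\in I$), simple reflections $s_i$, and $\Phi_{\ge-1}=\Phi_{>0}\cup\{-\alpha_i: i\in I\}$ (almost positive roots). Write $I=I_+\sqcup I_-$ for a bipartition of the Dynkin diagram (no edges inside $I_+$ or inside $I_-$). For $\varepsilon\in\{+,-\}$ define the involution $\tau_\varepsilon$ of $\Phi_{\ge -1}$ by $\tau_\varepsilon(\alpha)=\alpha$ if $\alpha=-\alpha_i$ with $i\in I_{-\varepsilon}$, and $\tau_\varepsilon(\alpha)=\left(\prod_{i\in I_\varepsilon}s_i\right)(\alpha)$ otherwise. The compatibility degree $(\cdot\|\cdot):\Phi_{\ge-1}\times\Phi_{\ge-1}\to\mathbb Z_{\ge0}$ is the unique function with $(-\alpha_i\|\beta)=\max([\beta:\alpha_i],0)$, where $[\beta:\alpha_i]$ is the coefficient of $\alpha_i$ in $\beta$, and $(\tau_\varepsilon\alpha\|\tau_\varepsilon\beta)=(\alpha\|\beta)$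 for all $\alpha,\beta\in\Phi_{\ge-1}$ and $\varepsilon=\pm$. Roots $\alpha,\beta\in\Phi_{\ge -1}$ are compatible if $(\alpha\|\beta)=0$. A cluster is a maximal (by inclusion) subset of $\Phi_{\ge-1}$ consisting of pairwise compatible roots; every cluster has $n$ elements. A positive cluster is a cluster contained in $\Phi_{>0}$. The exchange graph $E(\Phi)$ is the unoriented graph whose vertices are the clusters, two clusters being joined by an edge iff their intersection has cardinality $n-1$. The subgraph $E(\Phi_{>0})$ contains all edges of $E(\Phi)$ between positive clusters. *)

theory Defs
  imports "HOL-Analysis.Analysis"
begin

section \<open>Root systems and simple roots\<close>

text \<open>The ambient space may be larger than the span of the roots: a set satisfying
  \<open>root_system\<close> is a (reduced, crystallographic) root system of the Euclidean space
  \<open>span \<Phi>\<close>, e.g. type \<open>A\<close> realised in a hyperplane.\<close>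

definition cartan :: "'a::real_inner \<Rightarrow> 'a \<Rightarrow> real" where
  "cartan a b = 2 * (a \<bullet> b) / (b \<bullet> b)"

definition reflection :: "'a::real_inner \<Rightarrow> 'a \<Rightarrow> 'a" where
  "reflection a x = x - cartan x a *\<^sub>R a"

definition root_system :: "'a::real_inner set \<Rightarrow> bool" where
  "root_system \<Phi> \<longleftrightarrow>
     finite \<Phi> \<and> 0 \<notin> \<Phi> \<and>
     (\<forall>a\<in>\<Phi>. \<forall>b\<in>\<Phi>. reflection a b \<in> \<Phi>) \<and>
     (\<forall>a\<in>\<Phi>. \<forall>b\<in>\<Phi>. cartan a b \<in> \<int>) \<and>
     (\<forall>a\<in>\<Phi>. \<forall>r. r *\<^sub>R a \<in> \<Phi> \<longrightarrow> r = 1 \<or> r = -1)"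

text \<open>The index set \<open>I\<close> is identified with the set \<open>\<Delta>\<close> of simple roots itself.\<close>

definition simple_roots :: "'a::real_inner set \<Rightarrow> 'a set \<Rightarrow> bool" where
  "simple_roots \<Phi> \<Delta> \<longleftrightarrow>
     \<Delta> \<subseteq> \<Phi> \<and> independent \<Delta> \<and>
     (\<forall>b\<in>\<Phi>. \<exists>k :: 'a \<Rightarrow> int. b = (\<Sum>a\<in>\<Delta>. of_int (k a) *\<^sub>R a) \<and>
        ((\<forall>a\<in>\<Delta>. 0 \<le> k a) \<or> (\<forall>a\<in>\<Delta>. k a \<le> 0)))"

text \<open>\<open>root_coeff \<Delta> b a\<close> is \<open>[b : a]\<close>, the coefficient of the simple root \<open>a\<close> in \<open>b\<close>.\<close>

definition root_coeff :: "'a::real_inner set \<Rightarrow> 'a \<Rightarrow> 'a \<Rightarrow> real" where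
  "root_coeff \<Delta> b a = representation \<Delta> b a"

definition positive_roots :: "'a::real_inner set \<Rightarrow> 'a set \<Rightarrow> 'a set" where
  "positive_roots \<Phi> \<Delta> = {b \<in> \<Phi>. \<forall>a\<in>\<Delta>. 0 \<le> root_coeff \<Delta> b a}"

definition almost_positive_roots :: "'a::real_inner set \<Rightarrow> 'a set \<Rightarrow> 'a set" where
  "almost_positive_roots \<Phi> \<Delta> = positive_roots \<Phi> \<Delta> \<union> uminus ` \<Delta>"


section \<open>Types A and D\<close>

text \<open>The Cartan matrix of \<open>\<Delta>\<close>, for some numbering of \<open>\<Delta>\<close> by \<open>1, \<dots>, n\<close>, is the
  simply-laced one of the graph with (symmetric) adjacency relation \<open>adj\<close>. For the connected
  graphs below this makes the root system irreducible and simply-laced of rank \<open>n\<close>.\<close>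

definition simply_laced_diagram ::
    "nat \<Rightarrow> (nat \<Rightarrow> nat \<Rightarrow> bool) \<Rightarrow> 'a::real_inner set \<Rightarrow> bool" where
  "simply_laced_diagram n adj \<Delta> \<longleftrightarrow>
     (\<exists>f. bij_betw f {1..n} \<Delta> \<and>
        (\<forall>i\<in>{1..n}. \<forall>j\<in>{1..n}.
           cartan (f i) (f j) = (if i = j then 2 else if adj i j then -1 else 0)))"

definition adj_A :: "nat \<Rightarrow> nat \<Rightarrow> bool" where
  "adj_A i j \<longleftrightarrow> j = i + 1 \<or> i = j + 1"

text \<open>The path \<open>1 - 2 - \<dots> - (n - 1)\<close> with the node \<open>n\<close> attached to \<open>n - 2\<close>.\<close>

definition adj_D :: "nat \<Rightarrow> nat \<Rightarrow> nat \<Rightarrow> bool" where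
  "adj_D n i j \<longleftrightarrow>
     (adj_A i j \<and> i \<le> n - 1 \<and> j \<le> n - 1) \<or> (i = n \<and> j = n - 2) \<or> (i = n - 2 \<and> j = n)"

definition type_A :: "nat \<Rightarrow> 'a::real_inner set \<Rightarrow> bool" where
  "type_A n \<Delta> \<longleftrightarrow> 1 \<le> n \<and> simply_laced_diagram n adj_A \<Delta>"

definition type_D :: "nat \<Rightarrow> 'a::real_inner set \<Rightarrow> bool" where
  "type_D n \<Delta> \<longleftrightarrow> 4 \<le> n \<and> simply_laced_diagram n (adj_D n) \<Delta>"

definition diagram_bipartition :: "'a::real_inner set \<Rightarrow> 'a set \<Rightarrow> 'a set \<Rightarrow> bool" where
  "diagram_bipartition \<Delta> P M \<longleftrightarrow>
     P \<union> M = \<Delta> \<and> P \<inter> M = {} \<and>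
     (\<forall>a\<in>P. \<forall>b\<in>P. a \<noteq> b \<longrightarrow> a \<bullet> b = 0) \<and>
     (\<forall>a\<in>M. \<forall>b\<in>M. a \<noteq> b \<longrightarrow> a \<bullet> b = 0)"


section \<open>Compatibility degree, clusters, exchange graph\<close>

text \<open>With \<open>(P, M) = (I\<^sub>+, I\<^sub>-)\<close>, the involutions \<open>\<tau>\<^sub>+\<close> and \<open>\<tau>\<^sub>-\<close> are \<open>tau P M\<close> and \<open>tau M P\<close>.
  The \<open>fold\<close> applies the reflections in the elements of \<open>J\<close> one after the other; they
  commute when \<open>J\<close> is one side of a bipartition, so the order is irrelevant.\<close>

definition tau :: "'a::real_inner set \<Rightarrow> 'a set \<Rightarrow> 'a \<Rightarrow> 'a" where
  "tau J K b = (if b \<in> uminus ` K then b else Finite_Set.fold reflection b J)"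

definition is_compat_degree ::
    "'a::real_inner set \<Rightarrow> 'a set \<Rightarrow> 'a set \<Rightarrow> 'a set \<Rightarrow> ('a \<Rightarrow> 'a \<Rightarrow> nat) \<Rightarrow> bool" where
  "is_compat_degree \<Phi> \<Delta> P M c \<longleftrightarrow>
     (\<forall>a\<in>\<Delta>. \<forall>b\<in>almost_positive_roots \<Phi> \<Delta>. real (c (- a) b) = max (root_coeff \<Delta> b a) 0) \<and>
     (\<forall>a\<in>almost_positive_roots \<Phi> \<Delta>. \<forall>b\<in>almost_positive_roots \<Phi> \<Delta>.
        c (tau P M a) (tau P M b) = c a b \<and> c (tau M P a) (tau M P b) = c a b)"

text \<open>The degree is a function on pairs of almost positive roots; for it to be unique as a
  total function, it is set to \<open>0\<close> on all other pairs.\<close>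

definition compat_degree ::
    "'a::real_inner set \<Rightarrow> 'a set \<Rightarrow> 'a set \<Rightarrow> 'a set \<Rightarrow> 'a \<Rightarrow> 'a \<Rightarrow> nat" where
  "compat_degree \<Phi> \<Delta> P M =
     (THE c. is_compat_degree \<Phi> \<Delta> P M c \<and>
        (\<forall>a b. a \<notin> almost_positive_roots \<Phi> \<Delta> \<or> b \<notin> almost_positive_roots \<Phi> \<Delta> \<longrightarrow> c a b = 0))"

definition compatible ::
    "'a::real_inner set \<Rightarrow> 'a set \<Rightarrow> 'a set \<Rightarrow> 'a set \<Rightarrow> 'a \<Rightarrow> 'a \<Rightarrow> bool" where
  "compatible \<Phi> \<Delta> P M a b \<longleftrightarrow> compat_degree \<Phi> \<Delta> P M a b = 0"

definition compatible_set ::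
    "'a::real_inner set \<Rightarrow> 'a set \<Rightarrow> 'a set \<Rightarrow> 'a set \<Rightarrow> 'a set \<Rightarrow> bool" where
  "compatible_set \<Phi> \<Delta> P M C \<longleftrightarrow>
     C \<subseteq> almost_positive_roots \<Phi> \<Delta> \<and> pairwise (compatible \<Phi> \<Delta> P M) C"

definition clusters ::
    "'a::real_inner set \<Rightarrow> 'a set \<Rightarrow> 'a set \<Rightarrow> 'a set \<Rightarrow> 'a set set" where
  "clusters \<Phi> \<Delta> P M =
     {C. compatible_set \<Phi> \<Delta> P M C \<and> (\<forall>D. compatible_set \<Phi> \<Delta> P M D \<and> C \<subseteq> D \<longrightarrow> D = C)}"

definition positive_clusters ::
    "'a::real_inner set \<Rightarrow> 'a set \<Rightarrow> 'a set \<Rightarrow> 'a set \<Rightarrow> 'a set set" where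
  "positive_clusters \<Phi> \<Delta> P M = {C \<in> clusters \<Phi> \<Delta> P M. C \<subseteq> positive_roots \<Phi> \<Delta>}"

text \<open>Unoriented edges are the two-element sets of their endpoints; the rank is \<open>card \<Delta>\<close>.\<close>

definition exchange_edges ::
    "'a::real_inner set \<Rightarrow> 'a set \<Rightarrow> 'a set \<Rightarrow> 'a set \<Rightarrow> 'a set set set" where
  "exchange_edges \<Phi> \<Delta> P M =
     {{C, D} | C D. C \<in> clusters \<Phi> \<Delta> P M \<and> D \<in> clusters \<Phi> \<Delta> P M \<and> C \<noteq> D \<and>
        card (C \<inter> D) = card \<Delta> - 1}"

definition positive_exchange_edges ::
    "'a::real_inner set \<Rightarrow> 'a set \<Rightarrow> 'a set \<Rightarrow> 'a set \<Rightarrow> 'a set set set" where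
  "positive_exchange_edges \<Phi> \<Delta> P M =
     {e \<in> exchange_edges \<Phi> \<Delta> P M. e \<subseteq> positive_clusters \<Phi> \<Delta> P M}"

end

theory Submission
  imports Defs
begin

text \<open>Write roots in coordinates with respect to \<open>\<Delta>\<close> and let \<open>\<langle>x, y\<rangle> = (\<Sum>i. x\<^sub>i y\<^sub>i) - (\<Sum>i \<in> P. \<Sum>j \<sim> i. x\<^sub>i y\<^sub>j)\<close> be
  the Euler form of the bipartite quiver. On positive roots the compatibility degree is
  \<open>max 0 (- \<langle>x, y\<rangle>) + max 0 (- \<langle>y, x\<rangle>)\<close>, because each of the two products of reflections swaps the
  arguments of the form. Rotating any root of a compatible set to a negative simple root, whose
  link is the cluster complex of a parabolic subsystem, shows by induction on the rank that
  clusters have \<open>n\<close> elements and that every compatible set with \<open>n - 1\<close> elements lies in exactly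
  two of them. Hence, with \<open>N\<^sup>+\<close> the number of positive clusters and \<open>E\<close> the number of edges,
  \<open>n N\<^sup>+(\<Phi>) = 2 E + (\<Sum>i. N\<^sup>+(\<Phi>\<^bsub>I - i\<^esub>))\<close>, the sum counting the neighbours that are not positive.

  Following the alternating orbit of a positive root until it meets a negative simple root gives
  \<open>2 n N(\<Phi>) = (h + 2) (\<Sum>i. N(\<Phi>\<^bsub>I - i\<^esub>))\<close> for the number \<open>N\<close> of all clusters, where \<open>h\<close> is the Coxeter
  number. Together with the decomposition of clusters by their negative part this yields, with
  Catalan numbers \<open>C\<close>, the values \<open>N(A\<^sub>n) = C\<^bsub>n+1\<^esub>\<close>, \<open>N\<^sup>+(A\<^sub>n) = C\<^sub>n\<close>, \<open>N(D\<^sub>n) = (3 n - 2) C\<^bsub>n-1\<^esub>\<close> and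
  \<open>2 N\<^sup>+(D\<^sub>n) = (3 n - 4) C\<^bsub>n-1\<^esub>\<close>.\<close>

section \<open>Catalan numbers and reflections along a path\<close>

text \<open>The factor \<open>h + 2\<close> comes from counting pairs of a cluster and one of its
  \<open>n\<close> roots. The negative simple roots contribute the sum over the maximal parabolics
  once. The positive roots contribute it \<open>h / 2\<close> times, because the two starting sides
  together use each of the \<open>h * n\<close> possible first meetings exactly once. This exactness
  is pure counting: the meetings record the orbits injectively, so exhibiting
  \<open>h * n / 2\<close> positive roots forces a bijection, and type by type only a family of
  roots and the sign behaviour of the longest element remain to be checked. Two obstacles shape the
  set-up. The compatibility degree is a definite description, so the Euler form has to prove that it
  exists, and the orbits that it is unique. Deleting a node disconnects the diagram and may leave
  two isolated nodes or the coincidence of D_3 with A_3. Hence every statement is about an arbitrary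
  set \<open>J\<close> of nodes, counts multiply over parts without edges between them, and the
  induction in type D starts at rank 2.\<close>

definition catalan :: "nat \<Rightarrow> real" where
  "catalan n = real ((2 * n) choose n) / (real n + 1)"

lemma catalan_0 [simp]: "catalan 0 = 1"
  by (simp add: catalan_def)

lemma central_binomial_Suc:
  "(n + 1) * ((2 * Suc n) choose Suc n) = 2 * (2 * n + 1) * ((2 * n) choose n)"
proof -
  have a: "(2 * Suc n choose Suc n) * Suc n = (2 * n + 2) * ((2 * n + 1) choose n)"
    using Suc_times_binomial_eq[of "2 * n + 1" n] by simp
  have b: "((2 * n + 1) choose Suc n) * Suc n = (2 * n + 1) * ((2 * n) choose n)"
    using Suc_times_binomial_eq[of "2 * n" n] by simp
  have c: "(2 * n + 1) choose n = (2 * n + 1) choose Suc n"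
    using binomial_symmetric[of n "2 * n + 1"] by simp
  have "(2 * Suc n choose Suc n) * Suc n = 2 * (((2 * n + 1) choose Suc n) * Suc n)"
    unfolding a c by (simp only: distrib_right mult_2 mult_Suc_right add_Suc_right) 
      (simp add: algebra_simps)
  then show ?thesis unfolding b by (simp only: mult_ac Suc_eq_plus1)
qed

lemma catalan_Suc: "(real n + 2) * catalan (Suc n) = (4 * real n + 2) * catalan n"
proof -
  have "real (n + 1) * real ((2 * Suc n) choose Suc n) = real (2 * (2 * n + 1)) * real ((2 * n) choose n)"
    by (metis central_binomial_Suc of_nat_mult)
  then have *: "real ((2 * Suc n) choose Suc n) = (4 * real n + 2) * (real ((2 * n) choose n) / (real n + 1))"
    by (simp add: field_simps del: binomial_Suc_Suc)
  have "real (Suc n) + 1 = real n + 2"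
    by simp
  then show ?thesis unfolding catalan_def * by (simp add: divide_simps)
qed

text \<open>The weight \<open>i\<close> averages to \<open>n / 2\<close> by the symmetry \<open>i \<mapsto> n - i\<close>.\<close>

lemma sum_weighted_convolution:
  fixes f :: "nat \<Rightarrow> real"
  shows "(\<Sum>i\<le>n. real i * f i * f (n - i)) = real n / 2 * (\<Sum>i\<le>n. f i * f (n - i))"
proof -
  have "(\<Sum>i\<le>n. real i * f i * f (n - i)) = (\<Sum>i\<le>n. real (n - i) * f (n - i) * f i)"
    by (rule sum.reindex_bij_witness[of _ "\<lambda>i. n - i" "\<lambda>i. n - i"]) auto
  also have "\<dots> = (\<Sum>i\<le>n. real n * (f i * f (n - i)) - real i * f i * f (n - i))"
    by (rule sum.cong) (auto simp: of_nat_diff algebra_simps)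
  also have "\<dots> = real n * (\<Sum>i\<le>n. f i * f (n - i)) - (\<Sum>i\<le>n. real i * f i * f (n - i))"
    by (simp add: sum_subtractf sum_distrib_left)
  finally show ?thesis by simp
qed

text \<open>Weighting the convolution by \<open>i + 1\<close> only multiplies it by a constant, by
  symmetry. After an index shift the two-term recurrence lowers the factor carrying the weight, so
  the convolution satisfies the same first-order recurrence as the Catalan numbers
  themselves.\<close>

lemma catalan_convolution: "(\<Sum>i\<le>n. catalan i * catalan (n - i)) = catalan (Suc n)"
proof (induction n)
  case 0
  show ?case using catalan_Suc[of 0] by simp
next
  case (Suc n)
  let ?T = "\<lambda>n. \<Sum>i\<le>n. catalan i * catalan (n - i)"
  have "(real (Suc n) / 2 + 1) * ?T (Suc n) = (\<Sum>i\<le>Suc n. (real i + 1) * catalan i * catalan (Suc n - i))"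
    unfolding distrib_right sum_weighted_convolution[of catalan "Suc n", symmetric]
    by (simp add: sum.distrib distrib_right)
  also have "\<dots> = catalan (Suc n) + (\<Sum>i\<le>n. (real i + 2) * catalan (Suc i) * catalan (n - i))"
    by (subst sum.atMost_Suc_shift) (simp add: algebra_simps)
  also have "(\<Sum>i\<le>n. (real i + 2) * catalan (Suc i) * catalan (n - i))
      = (\<Sum>i\<le>n. 4 * (real i * catalan i * catalan (n - i)) + 2 * (catalan i * catalan (n - i)))"
    by (simp only: catalan_Suc) (simp add: algebra_simps)
  also have "\<dots> = 4 * (real n / 2 * ?T n) + 2 * ?T n"
    by (simp only: sum.distrib sum_distrib_left[symmetric] sum_weighted_convolution)
  finally have "(real n + 3) * ?T (Suc n) = (4 * real n + 6) * catalan (Suc n)"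
    unfolding Suc.IH by (simp add: field_simps)
  also have "\<dots> = (real n + 3) * catalan (Suc (Suc n))"
    using catalan_Suc[of "Suc n"] by (simp add: algebra_simps)
  finally show ?case by simp
qed

text \<open>Subtracting neighbouring coefficients turns an alternating product of reflections into
  transpositions of adjacent entries, so every entry travels at unit speed and is reflected at
  the two ends; \<open>U\<close> is the initial data unfolded along this motion.\<close>

lemma alternating_path_reflections:
  fixes X :: "nat \<Rightarrow> int \<Rightarrow> int" and p :: int
  assumes step: "\<And>t z. 0 \<le> z \<Longrightarrow> z < int n \<Longrightarrow>
      X (Suc t) z = (if even (z + int t + p) then X t (z - 1) + X t (z + 1) - X t z else X t z)"
    and left: "\<And>t. X t (-1) = 0" and right: "\<And>t. X t (int n) = 0"
    and z: "0 \<le> z" "z < int n"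
  shows "X (Suc n) z = - X 0 (int n - 1 - z)"
proof -
  define u where "u t z = X t z - X t (z - 1)" for t z
  \<comment> \<open>There are \<open>n + 1\<close> differences, at the places 0 to \<open>n\<close>;
    reflecting at both ends unfolds them to a sequence of period \<open>2 * (n + 1)\<close>.\<close>
  define m where "m = 2 * (int n + 1)"
  define U where "U z = (if z mod m \<le> int n then u 0 (z mod m) else u 0 (m - 1 - z mod m))" for z
  have m: "m > 0" by (simp add: m_def)
  have per: "U (z + m) = U z" for z by (simp add: U_def)
  have per': "U (z - m) = U z" for z using per[of "z - m"] by simp
  have refl: "U (- 1 - z) = U z" for z
  proof -
    have "(- 1 - z) mod m = m - 1 - z mod m"
    proof -
      have "- 1 - z = (m - 1 - z mod m) + (- 1 - z div m) * m"
        using div_mult_mod_eq[of z m] by (simp add: algebra_simps)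
      then have "(- 1 - z) mod m = (m - 1 - z mod m) mod m"
        by (metis mod_mult_self1)
      also have "\<dots> = m - 1 - z mod m" using m pos_mod_bound[OF m, of z] pos_mod_sign[OF m, of z]
        by (intro mod_pos_pos_trivial) linarith+
      finally show ?thesis .
    qed
    then show ?thesis using pos_mod_bound[OF m, of z] pos_mod_sign[OF m, of z]
      unfolding U_def m_def by auto
  qed
  have U0: "U z = u 0 z" if "0 \<le> z" "z \<le> int n" for z
    using that by (simp add: U_def m_def)
  \<comment> \<open>The parity of \<open>z + t + p\<close> is the direction of travel: an entry at
    an even place has come from the left, one at an odd place from the right. At the two ends
    \<open>refl\<close> and \<open>per\<close> make it turn.\<close>
  have main: "u t z = (if even (z + int t + p) then U (z - int t) else U (z + int t))"
    if "0 \<le> z" "z \<le> int n" for t z using that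
  proof (induction t arbitrary: z)
    case 0
    then show ?case by (simp add: U0)
  next
    case (Suc t)
    show ?case
    proof (cases "even (z + int t + p)")
      case True
      have "u (Suc t) z = (if z < int n then u t (z + 1) else u t z)"
      proof -
        have "X (Suc t) (z - 1) = X t (z - 1)"
          using step[of "z - 1" t] True left Suc.prems by (cases "z = 0") auto
        moreover have "z < int n \<Longrightarrow> X (Suc t) z = X t (z - 1) + X t (z + 1) - X t z"
          using step[of z t] True Suc.prems by simp
        moreover have "\<not> z < int n \<Longrightarrow> X (Suc t) z = X t z"
          using Suc.prems right by (metis antisym_conv2)
        ultimately show ?thesis by (simp add: u_def)
      qed
      also have "\<dots> = U (z + int t + 1)"
      proof (cases "z < int n")
        case True
        moreover have "odd (z + 1 + int t + p)" using \<open>even (z + int t + p)\<close> by presburger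
        ultimately show ?thesis using Suc.IH[of "z + 1"] Suc.prems
          by (simp only: if_True if_False) (simp add: ac_simps)
      next
        case False
        then have zn: "z = int n" using Suc.prems by simp
        have "u t z = U (z - int t)" using Suc.IH[of z] Suc.prems True by simp
        also have "\<dots> = U (- 1 - (z - int t))" by (rule refl[symmetric])
        also have "\<dots> = U (- 1 - (z - int t) + m)" by (rule per[symmetric])
        also have "- 1 - (z - int t) + m = z + int t + 1" using zn by (simp add: m_def)
        finally show ?thesis using False by simp
      qed
      finally show ?thesis using True by (simp add: ac_simps)
    next
      case False
      have "u (Suc t) z = (if 0 < z then u t (z - 1) else u t z)"
      proof -
        have "X (Suc t) z = X t z"
          using step[of z t] False right[of t] right[of "Suc t"] Suc.prems by (cases "z = int n") auto
        moreover have "0 < z \<Longrightarrow> X (Suc t) (z - 1) = X t (z - 2) + X t z - X t (z - 1)"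
          using step[of "z - 1" t] False Suc.prems by (simp add: algebra_simps)
        moreover have "\<not> 0 < z \<Longrightarrow> X (Suc t) (z - 1) = X t (z - 1)"
          using Suc.prems left by (metis antisym_conv2 diff_0)
        ultimately show ?thesis by (simp add: u_def)
      qed
      also have "\<dots> = U (z - int t - 1)"
      proof (cases "0 < z")
        case True
        moreover have "even (z - 1 + int t + p)" using False by presburger
        ultimately show ?thesis using Suc.IH[of "z - 1"] Suc.prems
          by (simp only: if_True if_False) (simp add: algebra_simps)
      next
        case neg: False
        then have z0: "z = 0" using Suc.prems by simp
        have "u t z = U (z + int t)" using Suc.IH[of z] Suc.prems False by simp
        also have "\<dots> = U (- 1 - (z + int t))" by (rule refl[symmetric])
        also have "- 1 - (z + int t) = z - int t - 1" using z0 by simp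
        finally show ?thesis using neg by simp
      qed
      finally show ?thesis using False by (simp add: algebra_simps)
    qed
  qed
  \<comment> \<open>After \<open>n + 1\<close> steps, half a period, both directions give the same
    value and the sequence of differences is reversed. Summing from the left end then recovers
    \<open>X\<close> with the opposite sign.\<close>
  have fin: "u (Suc n) z = u 0 (int n - z)" if "0 \<le> z" "z \<le> int n" for z
  proof -
    have "U (z + int (Suc n)) = U (- 1 - (z + int (Suc n)) + m)" by (metis per refl)
    also have "- 1 - (z + int (Suc n)) + m = int n - z" by (simp add: m_def)
    also have "U \<dots> = u 0 (int n - z)" using that by (intro U0) auto
    finally have 1: "U (z + int (Suc n)) = u 0 (int n - z)" .
    have "z - int (Suc n) = z + int (Suc n) - m" by (simp add: m_def)
    then have 2: "U (z - int (Suc n)) = u 0 (int n - z)" by (simp only: per' 1)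
    show ?thesis using main[OF that, of "Suc n"] by (auto simp only: 1 2 split: if_splits)
  qed
  have "X (Suc n) (int k) = - X 0 (int n - 1 - int k)" if "k < n" for k
    using that
  proof (induction k)
    case 0
    then show ?case using fin[of 0] left[of "Suc n"] right[of 0] by (simp add: u_def)
  next
    case (Suc k)
    then show ?case using fin[of "int (Suc k)"] by (simp add: u_def algebra_simps)
  qed
  from this[of "nat z"] show ?thesis using z by simp
qed

section \<open>Simply-laced root systems in coordinates\<close>

definition delta :: "'i \<Rightarrow> 'i \<Rightarrow> int" where
  "delta i = (\<lambda>j. if j = i then 1 else 0)"

definition ndelta :: "'i \<Rightarrow> 'i \<Rightarrow> int" where
  "ndelta i = (\<lambda>j. if j = i then - 1 else 0)"

definition supp_in :: "'i set \<Rightarrow> ('i \<Rightarrow> int) \<Rightarrow> bool" where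
  "supp_in J x \<longleftrightarrow> (\<forall>i. i \<notin> J \<longrightarrow> x i = 0)"

definition nonneg :: "('i \<Rightarrow> int) \<Rightarrow> bool" where
  "nonneg x \<longleftrightarrow> (\<forall>i. 0 \<le> x i)"

lemma delta_eq_iff [simp]: "delta i = delta j \<longleftrightarrow> i = j"
  by (metis delta_def one_neq_zero)

lemma ndelta_eq_iff [simp]: "ndelta i = ndelta j \<longleftrightarrow> i = j"
  by (metis ndelta_def neg_equal_0_iff_equal one_neq_zero)

lemma nonneg_delta [simp]: "nonneg (delta i)"
  by (simp add: nonneg_def delta_def)

lemma not_nonneg_ndelta [simp]: "\<not> nonneg (ndelta i)"
  by (auto simp: nonneg_def ndelta_def intro!: exI[of _ i])

lemma delta_neq_ndelta [simp]: "delta i \<noteq> ndelta j" "ndelta j \<noteq> delta i"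
  by (metis nonneg_delta not_nonneg_ndelta)+

lemma supp_in_delta [simp]: "supp_in J (delta i) \<longleftrightarrow> i \<in> J"
  by (auto simp: supp_in_def delta_def)

lemma supp_in_ndelta [simp]: "supp_in J (ndelta i) \<longleftrightarrow> i \<in> J"
  by (auto simp: supp_in_def ndelta_def)

lemma supp_in_mono: "supp_in J x \<Longrightarrow> J \<subseteq> K \<Longrightarrow> supp_in K x"
  by (auto simp: supp_in_def)

lemma inj_ndelta: "inj_on ndelta A"
  by (auto simp: inj_on_def)

text \<open>Roots are coefficient vectors with respect to the simple roots \<open>delta i\<close>. Everything is
  relative to a parabolic subset \<open>J\<close> of \<open>I\<close>, since the links of the cluster complex are the
  cluster complexes of parabolic subsystems. The condition \<open>kernel\<close> says that the
  Cartan matrix of each parabolic subsystem is nonsingular.\<close>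

locale simply_laced =
  fixes I :: "'i set" and nb :: "'i \<Rightarrow> 'i set" and P :: "'i set" and R :: "('i \<Rightarrow> int) set"
  assumes finite_I: "finite I"
    and finite_R: "finite R"
    and nb_subset: "nb i \<subseteq> I"
    and nb_sym: "j \<in> nb i \<Longrightarrow> i \<in> nb j"
    and bipartite: "j \<in> nb i \<Longrightarrow> i \<in> P \<longleftrightarrow> j \<notin> P"
    and supp_R: "x \<in> R \<Longrightarrow> supp_in I x"
    and zero_R: "(\<lambda>_. 0) \<notin> R"
    and simple_R: "i \<in> I \<Longrightarrow> delta i \<in> R"
    and refl_R1: "i \<in> I \<Longrightarrow> x \<in> R \<Longrightarrow> x(i := (\<Sum>j\<in>nb i. x j) - x i) \<in> R"
    and sign_R: "x \<in> R \<Longrightarrow> nonneg x \<or> nonneg (- x)"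
    and mult_R: "x \<in> R \<Longrightarrow> supp_in {i} x \<Longrightarrow> x = delta i \<or> x = ndelta i"
    and kernel: "J \<subseteq> I \<Longrightarrow> supp_in J v \<Longrightarrow> (\<And>i. i \<in> J \<Longrightarrow> 2 * v i = (\<Sum>j\<in>nb i. v j)) \<Longrightarrow> v = (\<lambda>_. 0)"
begin

text \<open>All nodes of \<open>K\<close> are reflected simultaneously. For \<open>K\<close> inside
  one side of the bipartition this is the product of the simple reflections, since no node of
  \<open>K\<close> sees another one.\<close>

definition srefl :: "'i set \<Rightarrow> ('i \<Rightarrow> int) \<Rightarrow> 'i \<Rightarrow> int" where
  "srefl K x = (\<lambda>i. if i \<in> K then (\<Sum>j\<in>nb i. x j) - x i else x i)"

text \<open>The complement is taken in the whole type, so exchanging the sides is plain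
  complementation and the same side serves every \<open>J\<close>; the relevant nodes are picked out
  by \<open>Q \<inter> J\<close>.\<close>

definition side :: "'i set \<Rightarrow> bool" where
  "side Q \<longleftrightarrow> Q = P \<or> Q = - P"

definition PR :: "'i set \<Rightarrow> ('i \<Rightarrow> int) set" where
  "PR J = {x \<in> R. supp_in J x \<and> nonneg x}"

definition AP :: "'i set \<Rightarrow> ('i \<Rightarrow> int) set" where
  "AP J = PR J \<union> ndelta ` J"

definition tau :: "'i set \<Rightarrow> 'i set \<Rightarrow> ('i \<Rightarrow> int) \<Rightarrow> 'i \<Rightarrow> int" where
  "tau Q J x = (if x \<in> ndelta ` (J - Q) then x else srefl (Q \<inter> J) x)"

text \<open>The Euler form of the bipartite quiver in which all arrows start in \<open>Q\<close>.\<close>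

definition euler :: "'i set \<Rightarrow> ('i \<Rightarrow> int) \<Rightarrow> ('i \<Rightarrow> int) \<Rightarrow> int" where
  "euler Q x y = (\<Sum>i\<in>I. x i * y i) - (\<Sum>i\<in>I \<inter> Q. x i * (\<Sum>j\<in>nb i. y j))"

text \<open>On two positive roots this is the dimension of the first extension groups, in both
  directions, of the corresponding indecomposable representations.\<close>

definition cdeg :: "('i \<Rightarrow> int) \<Rightarrow> ('i \<Rightarrow> int) \<Rightarrow> nat" where
  "cdeg x y =
     (if nonneg x \<and> nonneg y then nat (max 0 (- euler P x y) + max 0 (- euler P y x))
      else nat (\<Sum>i\<in>I. max 0 (- x i) * max 0 (y i) + max 0 (x i) * max 0 (- y i)))"

lemma side_nb: "side Q \<Longrightarrow> j \<in> nb i \<Longrightarrow> i \<in> Q \<longleftrightarrow> j \<notin> Q"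
  using bipartite by (auto simp: side_def)

lemma side_compl: "side Q \<Longrightarrow> side (- Q)"
  by (auto simp: side_def)

lemma side_P: "side P" "side (- P)"
  by (auto simp: side_def)

lemma finite_nb: "finite (nb i)"
  using finite_I nb_subset finite_subset by blast

lemma nb_refl: "i \<notin> nb i"
  using bipartite by blast

lemma refl_empty [simp]: "srefl {} x = x"
  by (simp add: srefl_def)

section \<open>Products of commuting simple reflections on coefficient vectors\<close>

lemma refl_insert:
  assumes "side Q" "insert k K \<subseteq> Q" "k \<notin> K"
  shows "srefl (insert k K) x = (srefl K x)(k := (\<Sum>j\<in>nb k. srefl K x j) - srefl K x k)"
proof -
  have "(\<Sum>j\<in>nb k. srefl K x j) = (\<Sum>j\<in>nb k. x j)"
    by (rule sum.cong) (use assms side_nb in \<open>auto simp: srefl_def\<close>)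
  then show ?thesis using assms by (auto simp: srefl_def fun_eq_iff)
qed

lemma refl_in_R:
  assumes "side Q" "K \<subseteq> Q" "K \<subseteq> I" "x \<in> R"
  shows "srefl K x \<in> R"
proof -
  have "finite K" using assms finite_I finite_subset by blast
  then show ?thesis using assms(2,3)
  proof (induction K rule: finite_induct)
    case empty
    then show ?case using assms by simp
  next
    case (insert k K)
    then show ?case
      by (subst refl_insert[OF assms(1)]) (auto intro: refl_R1)
  qed
qed

lemma refl_involution:
  assumes "side Q" "K \<subseteq> Q"
  shows "srefl K (srefl K x) = x"
proof
  fix i
  have "i \<in> K \<Longrightarrow> (\<Sum>j\<in>nb i. srefl K x j) = (\<Sum>j\<in>nb i. x j)"
    by (rule sum.cong) (use assms side_nb[OF assms(1)] in \<open>auto simp: srefl_def\<close>)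
  then show "srefl K (srefl K x) i = x i" by (auto simp: srefl_def)
qed

lemma refl_delta:
  assumes "side Q" "K \<subseteq> Q" "i \<in> K"
  shows "srefl K (delta i) = ndelta i" "srefl K (ndelta i) = delta i"
proof -
  have nz: "k \<in> K \<Longrightarrow> j \<in> nb k \<Longrightarrow> j \<noteq> i" for k j using assms side_nb by blast
  have "k \<in> K \<Longrightarrow> (\<Sum>j\<in>nb k. delta i j) = 0" "k \<in> K \<Longrightarrow> (\<Sum>j\<in>nb k. ndelta i j) = 0" for k
    using nz by (auto simp: delta_def ndelta_def intro!: sum.neutral)
  then show "srefl K (delta i) = ndelta i" "srefl K (ndelta i) = delta i"
    using assms(3) by (auto simp: srefl_def delta_def ndelta_def fun_eq_iff)
qed

lemma supp_in_refl: "supp_in J x \<Longrightarrow> K \<subseteq> J \<Longrightarrow> supp_in J (srefl K x)"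
  by (auto simp: supp_in_def srefl_def)

lemma refl_sum: "srefl K (\<lambda>i. \<Sum>y\<in>A. y i) = (\<lambda>i. \<Sum>y\<in>A. srefl K y i)"
proof
  fix i
  show "srefl K (\<lambda>i. \<Sum>y\<in>A. y i) i = (\<Sum>y\<in>A. srefl K y i)"
    by (cases "i \<in> K") (simp_all add: srefl_def sum_subtractf sum.swap[of _ "nb i" A])
qed

section \<open>Positive and almost positive roots of a parabolic subset\<close>

lemma PR_D: "x \<in> PR J \<Longrightarrow> x \<in> R" "x \<in> PR J \<Longrightarrow> supp_in J x" "x \<in> PR J \<Longrightarrow> nonneg x"
  "x \<in> PR J \<Longrightarrow> 0 \<le> x i"
  by (auto simp: PR_def nonneg_def)

lemma PR_mono: "J \<subseteq> K \<Longrightarrow> PR J \<subseteq> PR K"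
  using supp_in_mono by (auto simp: PR_def)

lemma AP_mono: "J \<subseteq> K \<Longrightarrow> AP J \<subseteq> AP K"
  using PR_mono by (auto simp: AP_def)

lemma AP_cases:
  assumes "x \<in> AP J"
  obtains "x \<in> PR J" | i where "i \<in> J" "x = ndelta i"
  using assms by (auto simp: AP_def)

lemma ndelta_notin_PR [simp]: "ndelta i \<notin> PR J"
  by (auto simp: PR_def)

lemma PR_subset_AP: "PR J \<subseteq> AP J"
  by (auto simp: AP_def)

lemma ndelta_AP [simp]: "ndelta i \<in> AP J \<longleftrightarrow> i \<in> J"
  by (auto simp: AP_def)

lemma delta_PR: "J \<subseteq> I \<Longrightarrow> i \<in> J \<Longrightarrow> delta i \<in> PR J"
  using simple_R by (auto simp: PR_def)

lemma delta_AP: "J \<subseteq> I \<Longrightarrow> i \<in> J \<Longrightarrow> delta i \<in> AP J"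
  using delta_PR PR_subset_AP by blast

lemma finite_PR: "finite (PR J)"
  using finite_R by (simp add: PR_def)

lemma finite_AP: "J \<subseteq> I \<Longrightarrow> finite (AP J)"
  using finite_PR finite_I by (auto simp: AP_def intro: finite_subset)

lemma supp_in_AP: "x \<in> AP J \<Longrightarrow> supp_in J x"
  by (auto simp: AP_def PR_def)

lemma PR_neq_zero: "x \<in> PR J \<Longrightarrow> \<exists>i\<in>J. x i > 0"
proof -
  assume x: "x \<in> PR J"
  then have "x \<noteq> (\<lambda>_. 0)" using zero_R PR_D by metis
  then obtain i where "x i \<noteq> 0" by auto
  then show ?thesis using PR_D[OF x] by (auto simp: supp_in_def order_less_le)
qed

text \<open>At a node \<open>i\<close> of the support all neighbouring coefficients vanish, so the
  reflection at \<open>i\<close> merely changes the sign of \<open>x i\<close>. The new root has a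
  negative coefficient, hence no positive one, and \<open>x\<close> is a multiple of
  \<open>delta i\<close>.\<close>

lemma PR_independent_support:
  assumes "side Q" "J \<subseteq> I" "x \<in> PR J" "supp_in Q x"
  shows "\<exists>i\<in>J \<inter> Q. x = delta i"
proof -
  obtain i where i: "i \<in> J" "x i > 0" using PR_neq_zero[OF assms(3)] by blast
  then have iQ: "i \<in> Q" using assms(4) by (auto simp: supp_in_def)
  have "(\<Sum>j\<in>nb i. x j) = 0"
    by (rule sum.neutral) (use iQ side_nb[OF assms(1)] assms(4) in \<open>auto simp: supp_in_def\<close>)
  then have "x(i := - x i) \<in> R" using refl_R1[of i x] PR_D[OF assms(3)] i assms(2) by auto
  moreover have "\<not> nonneg (x(i := - x i))"
    using i by (auto simp: nonneg_def intro!: exI[of _ i])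
  ultimately have "nonneg (- (x(i := - x i)))" using sign_R by blast
  then have "x j = 0" if "j \<noteq> i" for j
    using that PR_D(4)[OF assms(3), of j] by (auto simp: nonneg_def dest!: spec[of _ j])
  then have "supp_in {i} x" by (simp add: supp_in_def)
  then have "x = delta i" using mult_R[of x i] PR_D[OF assms(3)] by auto
  then show ?thesis using i iQ by blast
qed

text \<open>A nonzero coefficient outside \<open>Q\<close> is unchanged by the reflections in
  \<open>Q\<close>, and a single positive coefficient decides the sign of a root. Only roots
  supported in \<open>Q\<close>, that is simple ones, can become negative.\<close>

lemma refl_PR_cases:
  assumes "side Q" "J \<subseteq> I" "x \<in> PR J"
  obtains (simple) i where "i \<in> J \<inter> Q" "x = delta i"
  | (pos) "srefl (Q \<inter> J) x \<in> PR J" "\<And>i. i \<in> J \<inter> Q \<Longrightarrow> x \<noteq> delta i"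
proof (cases "supp_in Q x")
  case True
  then show ?thesis using PR_independent_support[OF assms] simple by blast
next
  case False
  then obtain j where j: "j \<notin> Q" "x j \<noteq> 0" by (auto simp: supp_in_def)
  let ?y = "srefl (Q \<inter> J) x"
  have yj: "?y j = x j" using j by (simp add: srefl_def)
  have y: "?y \<in> R" using refl_in_R[OF assms(1), of "Q \<inter> J" x] assms PR_D by auto
  have "nonneg ?y"
  proof (rule ccontr)
    assume "\<not> nonneg ?y"
    then have "nonneg (- ?y)" using sign_R[OF y] by simp
    then have "0 \<le> - ?y j" unfolding nonneg_def by (metis uminus_apply)
    then show False using yj j PR_D(4)[OF assms(3), of j] by simp
  qed
  then have "?y \<in> PR J" using y supp_in_refl[of J x "Q \<inter> J"] PR_D(2)[OF assms(3)] by (auto simp: PR_def)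
  moreover have "x \<noteq> delta i" if "i \<in> J \<inter> Q" for i using that j by (auto simp: delta_def split: if_splits)
  ultimately show ?thesis using pos by blast
qed

section \<open>The involutions on almost positive roots\<close>

lemma tau_PR: "x \<in> PR J \<Longrightarrow> tau Q J x = srefl (Q \<inter> J) x"
  using ndelta_notin_PR by (auto simp: tau_def)

lemma tau_ndelta_fixed: "i \<in> J \<Longrightarrow> i \<notin> Q \<Longrightarrow> tau Q J (ndelta i) = ndelta i"
  by (auto simp: tau_def)

lemma tau_ndelta: "side Q \<Longrightarrow> i \<in> J \<Longrightarrow> i \<in> Q \<Longrightarrow> tau Q J (ndelta i) = delta i"
  using refl_delta[of Q "Q \<inter> J" i] by (auto simp: tau_def)

lemma tau_delta: "side Q \<Longrightarrow> i \<in> J \<Longrightarrow> i \<in> Q \<Longrightarrow> tau Q J (delta i) = ndelta i"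
  using refl_delta[of Q "Q \<inter> J" i] by (auto simp: tau_def)

lemma tau_cases:
  assumes "side Q" "J \<subseteq> I" "x \<in> AP J"
  obtains (fixed) i where "i \<in> J - Q" "x = ndelta i" "tau Q J x = x"
  | (neg) i where "i \<in> J \<inter> Q" "x = ndelta i" "tau Q J x = delta i"
  | (simple) i where "i \<in> J \<inter> Q" "x = delta i" "tau Q J x = ndelta i"
  | (pos) "x \<in> PR J" "tau Q J x \<in> PR J" "tau Q J x = srefl (Q \<inter> J) x"
  using assms(3)
proof (cases x rule: AP_cases)
  case 1
  then show ?thesis using refl_PR_cases[OF assms(1,2) 1]
    by (metis IntD1 IntD2 assms(1) simple pos tau_PR tau_delta)
next
  case (2 i)
  then show ?thesis using fixed neg tau_ndelta tau_ndelta_fixed assms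
    by (metis Diff_iff Int_iff)
qed

lemma tau_AP:
  assumes "side Q" "J \<subseteq> I" "x \<in> AP J"
  shows "tau Q J x \<in> AP J"
  using assms
proof (cases rule: tau_cases)
  case (neg i)
  then show ?thesis using delta_AP[OF assms(2)] by simp
qed (auto intro: subsetD[OF PR_subset_AP])

lemma tau_involution:
  assumes "side Q" "J \<subseteq> I" "x \<in> AP J"
  shows "tau Q J (tau Q J x) = x"
  using assms
proof (cases rule: tau_cases)
  case pos
  then show ?thesis using refl_involution[OF assms(1), of "Q \<inter> J" x] tau_PR by simp
qed (use assms in \<open>auto simp: tau_delta tau_ndelta\<close>)

lemma tau_bij_betw: "side Q \<Longrightarrow> J \<subseteq> I \<Longrightarrow> bij_betw (tau Q J) (AP J) (AP J)"
  by (rule bij_betw_byWitness[where f' = "tau Q J"]) (auto simp: tau_involution tau_AP)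

text \<open>The orbits under the involutions all meet the negative simple roots: the roots outside a
  closed set containing the latter are permuted by the two products of reflections, so their
  sum lies in the kernel of the Cartan matrix.\<close>

lemma AP_induct [consumes 2, case_names ndelta tau]:
  assumes J: "J \<subseteq> I" and x: "x \<in> AP J"
    and neg: "\<And>i. i \<in> J \<Longrightarrow> S (ndelta i)"
    and step: "\<And>Q x. side Q \<Longrightarrow> x \<in> AP J \<Longrightarrow> S x \<Longrightarrow> S (tau Q J x)"
  shows "S x"
proof -
  define B where "B = {x \<in> AP J. \<not> S x}"
  have BPR: "B \<subseteq> PR J" using neg by (auto simp: B_def AP_def)
  have finB: "finite B" using finite_AP[OF J] by (simp add: B_def)
  define v where "v = (\<lambda>i. \<Sum>y\<in>B. y i)"
  have closed_B: "tau Q J y \<in> B" if "side Q" "y \<in> B" for Q y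
    using that step[OF that(1), of "tau Q J y"] tau_AP[OF that(1) J] tau_involution[OF that(1) J]
    by (auto simp: B_def)
  have fixed_v: "srefl (Q \<inter> J) v = v" if Q: "side Q" for Q
  proof -
    have "srefl (Q \<inter> J) v = (\<lambda>i. \<Sum>y\<in>B. srefl (Q \<inter> J) y i)" unfolding v_def by (rule refl_sum)
    also have "\<dots> = (\<lambda>i. \<Sum>y\<in>B. tau Q J y i)"
      using BPR tau_PR by (auto intro!: ext sum.cong)
    also have "\<dots> = v" unfolding v_def
    proof
      fix i
      show "(\<Sum>y\<in>B. tau Q J y i) = (\<Sum>y\<in>B. y i)"
        by (rule sum.reindex_bij_witness[of _ "tau Q J" "tau Q J"])
          (use closed_B[OF Q] tau_involution[OF Q J] B_def in auto)
    qed
    finally show ?thesis .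
  qed
  have v0: "v = (\<lambda>_. 0)"
  proof (rule kernel[OF J])
    show "supp_in J v" using BPR PR_D(2) unfolding v_def supp_in_def
      by (auto intro!: sum.neutral)
    fix i assume i: "i \<in> J"
    obtain Q where Q: "side Q" "i \<in> Q" using side_P by (metis ComplI)
    show "2 * v i = (\<Sum>j\<in>nb i. v j)"
      using fun_cong[OF fixed_v[OF Q(1)], of i] i Q by (simp add: srefl_def)
  qed
  have "B = {}"
  proof (rule ccontr)
    assume "B \<noteq> {}"
    then obtain y where y: "y \<in> B" by blast
    then obtain i where i: "y i > 0" using PR_neq_zero BPR by blast
    have "v i > 0" unfolding v_def
      by (rule sum_pos2[OF finB y, where f = "\<lambda>y. y i"]) (use i BPR PR_D(4) in auto)
    then show False using v0 by simp
  qed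
  then show ?thesis using x by (auto simp: B_def)
qed

end

section \<open>Compatibility and clusters\<close>

context simply_laced begin

text \<open>Reversing all arrows transposes the form: both edge sums run over the same edges, each
  seen from its other endpoint.\<close>

lemma euler_swap:
  assumes "side Q"
  shows "euler (- Q) x y = euler Q y x"
proof -
  have "(\<Sum>i\<in>I \<inter> - Q. x i * (\<Sum>j\<in>nb i. y j)) = (\<Sum>i\<in>I \<inter> - Q. \<Sum>j\<in>I \<inter> Q. if j \<in> nb i then x i * y j else 0)"
  proof (rule sum.cong)
    fix i assume i: "i \<in> I \<inter> - Q"
    have S: "{j \<in> I \<inter> Q. j \<in> nb i} = nb i" using nb_subset side_nb[OF assms] i by blast
    have "(\<Sum>j | j \<in> I \<inter> Q \<and> j \<in> nb i. y j) = (\<Sum>j\<in>I \<inter> Q. if j \<in> nb i then y j else 0)"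
      by (rule sum.inter_filter) (simp add: finite_I)
    then have "(\<Sum>j\<in>nb i. y j) = (\<Sum>j\<in>I \<inter> Q. if j \<in> nb i then y j else 0)"
      unfolding S .
    then show "x i * (\<Sum>j\<in>nb i. y j) = (\<Sum>j\<in>I \<inter> Q. if j \<in> nb i then x i * y j else 0)"
      by (auto simp: sum_distrib_left intro!: sum.cong)
  qed simp
  also have "\<dots> = (\<Sum>j\<in>I \<inter> Q. \<Sum>i\<in>I \<inter> - Q. if j \<in> nb i then x i * y j else 0)"
    by (rule sum.swap)
  also have "\<dots> = (\<Sum>j\<in>I \<inter> Q. y j * (\<Sum>i\<in>nb j. x i))"
  proof (rule sum.cong)
    fix j assume j: "j \<in> I \<inter> Q"
    have S: "{i \<in> I \<inter> - Q. j \<in> nb i} = nb j" using nb_subset nb_sym side_nb[OF assms] j by blast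
    have "(\<Sum>i | i \<in> I \<inter> - Q \<and> j \<in> nb i. x i) = (\<Sum>i\<in>I \<inter> - Q. if j \<in> nb i then x i else 0)"
      by (rule sum.inter_filter) (simp add: finite_I)
    then have "(\<Sum>i\<in>nb j. x i) = (\<Sum>i\<in>I \<inter> - Q. if j \<in> nb i then x i else 0)"
      unfolding S .
    then show "(\<Sum>i\<in>I \<inter> - Q. if j \<in> nb i then x i * y j else 0) = y j * (\<Sum>i\<in>nb j. x i)"
      by (auto simp: sum_distrib_left intro!: sum.cong)
  qed simp
  finally show ?thesis by (simp add: euler_def mult.commute)
qed

text \<open>Reflecting at all sources reverses all arrows, as for reflection functors. Concretely,
  with \<open>S\<close> the neighbour sum, the summand \<open>x i * (y i - S y)\<close> becomes
  \<open>(S x - x i) * (- y i)\<close>, which is the summand with exchanged arguments. Outside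
  \<open>Q\<close> nothing moves, and outside \<open>J\<close> both vectors vanish.\<close>

lemma euler_srefl:
  assumes Q: "side Q" and J: "J \<subseteq> I" and x: "supp_in J x" and y: "supp_in J y"
  shows "euler Q (srefl (Q \<inter> J) x) (srefl (Q \<inter> J) y) = euler Q y x"
proof -
  let ?s = "srefl (Q \<inter> J)"
  have nbs: "(\<Sum>j\<in>nb i. ?s z j) = (\<Sum>j\<in>nb i. z j)" if "i \<in> Q" for i z
    by (rule sum.cong) (use that side_nb[OF Q] in \<open>auto simp: srefl_def\<close>)
  have split: "(\<Sum>i\<in>I. f i) = (\<Sum>i\<in>I \<inter> Q. f i) + (\<Sum>i\<in>I - Q. f i)" for f :: "'i \<Rightarrow> int"
    by (rule sum.Int_Diff[OF finite_I])
  have e: "euler Q a b = (\<Sum>i\<in>I \<inter> Q. a i * b i - a i * (\<Sum>j\<in>nb i. b j)) + (\<Sum>i\<in>I - Q. a i * b i)" for a b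
    unfolding euler_def split[of "\<lambda>i. a i * b i"] by (simp add: sum_subtractf)
  have "(\<Sum>i\<in>I \<inter> Q. ?s x i * ?s y i - ?s x i * (\<Sum>j\<in>nb i. ?s y j))
      = (\<Sum>i\<in>I \<inter> Q. y i * x i - y i * (\<Sum>j\<in>nb i. x j))"
  proof (rule sum.cong)
    fix i assume i: "i \<in> I \<inter> Q"
    show "?s x i * ?s y i - ?s x i * (\<Sum>j\<in>nb i. ?s y j) = y i * x i - y i * (\<Sum>j\<in>nb i. x j)"
    proof (cases "i \<in> J")
      case True
      then show ?thesis using i by (simp add: nbs) (simp add: srefl_def algebra_simps)
    next
      case False
      then have "x i = 0" "y i = 0" using x y by (auto simp: supp_in_def)
      then show ?thesis using False i by (simp add: nbs) (simp add: srefl_def)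
    qed
  qed simp
  moreover have "(\<Sum>i\<in>I - Q. ?s x i * ?s y i) = (\<Sum>i\<in>I - Q. y i * x i)"
    by (rule sum.cong) (auto simp: srefl_def)
  ultimately show ?thesis unfolding e by simp
qed

lemma cdeg_pos:
  assumes "side Q" "nonneg x" "nonneg y"
  shows "cdeg x y = nat (max 0 (- euler Q x y) + max 0 (- euler Q y x))"
  using assms euler_swap[OF side_P(1)] by (auto simp: side_def cdeg_def add.commute)

lemma cdeg_sym: "cdeg x y = cdeg y x"
  unfolding cdeg_def by (simp add: ac_simps)

lemma cdeg_ndelta:
  assumes "i \<in> I"
  shows "cdeg (ndelta i) y = nat (y i)"
proof -
  have "(\<Sum>k\<in>I. max 0 (- ndelta i k) * max 0 (y k) + max 0 (ndelta i k) * max 0 (- y k))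
      = (\<Sum>k\<in>I. if i = k then max 0 (y k) else 0)"
    by (rule sum.cong) (auto simp: ndelta_def)
  also have "\<dots> = max 0 (y i)" using assms finite_I by simp
  finally show ?thesis by (simp add: cdeg_def)
qed

text \<open>This is the case in which the involution moves \<open>ndelta i\<close> to
  \<open>delta i\<close> while \<open>y\<close> stays positive. One Euler product with
  \<open>delta i\<close> is \<open>- y i\<close>, the other is the nonnegative coefficient of the
  reflected root at \<open>i\<close>, so exactly the prescribed value \<open>y i\<close>
  survives.\<close>

lemma cdeg_delta_PR:
  assumes Q: "side Q" and J: "J \<subseteq> I" and i: "i \<in> J \<inter> Q" and y: "y \<in> PR J"
    and fy: "srefl (Q \<inter> J) y \<in> PR J"
  shows "cdeg (delta i) (srefl (Q \<inter> J) y) = nat (y i)"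
proof -
  let ?z = "srefl (Q \<inter> J) y"
  have iI: "i \<in> I" using i J by blast
  have d1: "(\<Sum>k\<in>I. delta i k * g k) = g i" for g :: "'i \<Rightarrow> int"
    using iI finite_I by (simp add: delta_def if_distrib[of "\<lambda>u. u * _"] cong: if_cong)
  have d2: "(\<Sum>k\<in>I \<inter> Q. delta i k * g k) = g i" for g :: "'i \<Rightarrow> int"
    using iI i finite_I by (simp add: delta_def if_distrib[of "\<lambda>u. u * _"] cong: if_cong)
  have d3: "(\<Sum>j\<in>nb k. delta i j) = 0" if "k \<in> Q" for k
    using that side_nb[OF Q, of i k] i by (auto simp: delta_def intro!: sum.neutral)
  have "euler Q (delta i) ?z = ?z i - (\<Sum>j\<in>nb i. ?z j)"
    unfolding euler_def by (simp add: d1 d2)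
  also have "(\<Sum>j\<in>nb i. ?z j) = (\<Sum>j\<in>nb i. y j)"
    by (rule sum.cong) (use i side_nb[OF Q] in \<open>auto simp: srefl_def\<close>)
  also have "?z i - \<dots> = - y i" using i by (simp add: srefl_def)
  finally have 1: "euler Q (delta i) ?z = - y i" .
  have "euler Q ?z (delta i) = ?z i"
    unfolding euler_def using d1[of ?z] by (simp add: d3 mult.commute)
  then show ?thesis using 1 PR_D(4)[OF y, of i] PR_D(4)[OF fy, of i] PR_D(3)[OF fy]
    by (simp add: cdeg_pos[OF Q])
qed

lemma cdeg_delta_delta:
  assumes Q: "side Q" and i: "i \<in> Q" "j \<in> Q"
  shows "cdeg (delta i) (delta j) = 0"
proof -
  have nn: "0 \<le> (\<Sum>k\<in>I. delta i k * delta j k)" for i j :: 'i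
    by (intro sum_nonneg) (simp add: delta_def)
  have d3: "(\<Sum>j\<in>nb k. delta i j) = 0" if "k \<in> Q" "i \<in> Q" for i k
    using that side_nb[OF Q, of i k] by (auto simp: delta_def intro!: sum.neutral)
  have "0 \<le> euler Q (delta i) (delta j)" "0 \<le> euler Q (delta j) (delta i)"
    unfolding euler_def using nn i by (simp_all add: d3)
  then show ?thesis by (simp add: cdeg_pos[OF Q])
qed

lemma cdeg_tau_neg:
  assumes Q: "side Q" and J: "J \<subseteq> I" and i: "i \<in> J" and y: "y \<in> AP J"
  shows "cdeg (tau Q J (ndelta i)) (tau Q J y) = cdeg (ndelta i) y"
proof (cases "i \<in> Q")
  case False
  have "tau Q J y i = y i" using False by (auto simp: tau_def srefl_def)
  then show ?thesis using False i J by (auto simp: tau_ndelta_fixed cdeg_ndelta)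
next
  case True
  have t: "tau Q J (ndelta i) = delta i" using Q True i tau_ndelta by blast
  have iI: "i \<in> I" using i J by blast
  have c: "cdeg x (ndelta j) = nat (x j)" if "j \<in> J" for x j
    using cdeg_ndelta[of j x] cdeg_sym[of x] that J by auto
  show ?thesis using Q J y
  proof (cases rule: tau_cases)
    case (fixed j)
    then have j: "j \<in> J" "i \<noteq> j" using True by auto
    show ?thesis unfolding fixed(3) unfolding fixed(2) t c[OF j(1)]
      using j(2) by (simp add: delta_def ndelta_def)
  next
    case (neg j)
    then have j: "j \<in> J" "j \<in> Q" by auto
    show ?thesis unfolding neg(3) unfolding neg(2) t c[OF j(1)]
      using cdeg_delta_delta[OF Q True j(2)] by (simp add: ndelta_def)
  next
    case (simple j)
    then have j: "j \<in> J" by auto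
    show ?thesis unfolding simple(3) unfolding simple(2) t c[OF j] cdeg_ndelta[OF iI]
      by (simp add: delta_def)
  next
    case pos
    then show ?thesis using True i iI cdeg_delta_PR[OF Q J, of i y] by (simp add: t cdeg_ndelta)
  qed
qed

text \<open>If one of the two roots is negative simple, before or after applying the involution,
  \<open>cdeg_tau_neg\<close> applies to it or to its image. For the remaining pairs both roots and
  both images are positive, and the involution just exchanges the two Euler products that are
  added.\<close>

lemma cdeg_tau:
  assumes Q: "side Q" and J: "J \<subseteq> I" and x: "x \<in> AP J" and y: "y \<in> AP J"
  shows "cdeg (tau Q J x) (tau Q J y) = cdeg x y"
proof -
  have A: "cdeg (tau Q J x) (tau Q J y) = cdeg x y"
    if x: "x \<in> AP J" "x \<notin> PR J \<or> tau Q J x \<notin> PR J" and y: "y \<in> AP J" for x y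
  proof (cases "x \<in> PR J")
    case False
    then show ?thesis using x cdeg_tau_neg[OF Q J _ y] by (auto simp: AP_def)
  next
    case True
    then have "tau Q J x \<in> AP J - PR J" using x tau_AP[OF Q J] by blast
    then obtain i where i: "i \<in> J" "tau Q J x = ndelta i" by (auto simp: AP_def)
    have "x = tau Q J (ndelta i)" using i(2) tau_involution[OF Q J x(1)] by simp
    then show ?thesis using cdeg_tau_neg[OF Q J i(1) tau_AP[OF Q J y]] i tau_involution[OF Q J y] by simp
  qed
  show ?thesis
  proof (cases "(x \<notin> PR J \<or> tau Q J x \<notin> PR J) \<or> (y \<notin> PR J \<or> tau Q J y \<notin> PR J)")
    case True
    then show ?thesis using A[OF x _ y] A[OF y _ x] cdeg_sym by metis
  next
    case False
    then have p: "x \<in> PR J" "y \<in> PR J" "tau Q J x \<in> PR J" "tau Q J y \<in> PR J" by auto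
    note eq = euler_srefl[OF Q J PR_D(2)[OF p(1)] PR_D(2)[OF p(2)]]
      euler_srefl[OF Q J PR_D(2)[OF p(2)] PR_D(2)[OF p(1)]]
    show ?thesis
      unfolding cdeg_pos[OF Q PR_D(3)[OF p(1)] PR_D(3)[OF p(2)]]
        cdeg_pos[OF Q PR_D(3)[OF p(3)] PR_D(3)[OF p(4)]]
      unfolding tau_PR[OF p(1)] tau_PR[OF p(2)] eq
      by (simp only: add.commute)
  qed
qed

lemma cdeg_self_simple: "i \<in> I \<Longrightarrow> cdeg (ndelta i) (delta i) = 1"
  by (simp add: cdeg_ndelta delta_def)

section \<open>The cluster complex\<close>

definition comp :: "('i \<Rightarrow> int) \<Rightarrow> ('i \<Rightarrow> int) \<Rightarrow> bool" where
  "comp x y \<longleftrightarrow> cdeg x y = 0"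

definition CS :: "'i set \<Rightarrow> ('i \<Rightarrow> int) set set" where
  "CS J = {C. C \<subseteq> AP J \<and> pairwise comp C}"

definition Cl :: "'i set \<Rightarrow> ('i \<Rightarrow> int) set set" where
  "Cl J = {C \<in> CS J. \<forall>D\<in>CS J. C \<subseteq> D \<longrightarrow> D = C}"

lemma comp_sym: "comp x y \<longleftrightarrow> comp y x"
  by (simp add: comp_def cdeg_sym)

lemma comp_tau: "side Q \<Longrightarrow> J \<subseteq> I \<Longrightarrow> x \<in> AP J \<Longrightarrow> y \<in> AP J \<Longrightarrow> comp (tau Q J x) (tau Q J y) \<longleftrightarrow> comp x y"
  by (simp add: comp_def cdeg_tau)

lemma comp_ndelta: "i \<in> I \<Longrightarrow> comp (ndelta i) y \<longleftrightarrow> y i \<le> 0"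
  by (simp add: comp_def cdeg_ndelta)

lemma CS_D: "C \<in> CS J \<Longrightarrow> C \<subseteq> AP J" "C \<in> CS J \<Longrightarrow> x \<in> C \<Longrightarrow> y \<in> C \<Longrightarrow> x \<noteq> y \<Longrightarrow> comp x y"
  by (auto simp: CS_def pairwise_def)

lemma CS_subset: "C \<in> CS J \<Longrightarrow> D \<subseteq> C \<Longrightarrow> D \<in> CS J"
  by (auto simp: CS_def pairwise_def)

lemma CS_mono: "J \<subseteq> K \<Longrightarrow> CS J \<subseteq> CS K"
  using AP_mono[of J K] by (auto simp: CS_def)

lemma CS_insert: "x \<in> AP J \<Longrightarrow> C \<in> CS J \<Longrightarrow> (\<And>y. y \<in> C \<Longrightarrow> comp x y) \<Longrightarrow> insert x C \<in> CS J"
  by (auto simp: CS_def pairwise_insert comp_sym[of _ x])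

lemma finite_CS: "J \<subseteq> I \<Longrightarrow> C \<in> CS J \<Longrightarrow> finite C"
  by (rule finite_subset[OF CS_D(1) finite_AP])

lemma finite_CS_set: "J \<subseteq> I \<Longrightarrow> finite (CS J)"
  by (rule finite_subset[of _ "Pow (AP J)"]) (auto simp: CS_def finite_AP)

lemma Cl_CS: "C \<in> Cl J \<Longrightarrow> C \<in> CS J"
  by (simp add: Cl_def)

lemma finite_Cl: "J \<subseteq> I \<Longrightarrow> finite (Cl J)"
  using finite_CS_set by (simp add: Cl_def)

lemma Cl_maximal: "C \<in> Cl J \<Longrightarrow> x \<in> AP J \<Longrightarrow> (\<And>y. y \<in> C \<Longrightarrow> y \<noteq> x \<Longrightarrow> comp x y) \<Longrightarrow> x \<in> C"
proof (rule ccontr)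
  assume a: "C \<in> Cl J" "x \<in> AP J" "\<And>y. y \<in> C \<Longrightarrow> y \<noteq> x \<Longrightarrow> comp x y" "x \<notin> C"
  then have "insert x C \<in> CS J" by (intro CS_insert Cl_CS) auto
  then show False using a by (auto simp: Cl_def)
qed

lemma ClI: "C \<in> CS J \<Longrightarrow> (\<And>x. x \<in> AP J \<Longrightarrow> (\<And>y. y \<in> C \<Longrightarrow> comp x y) \<Longrightarrow> x \<in> C) \<Longrightarrow> C \<in> Cl J"
proof -
  assume a: "C \<in> CS J" "\<And>x. x \<in> AP J \<Longrightarrow> (\<And>y. y \<in> C \<Longrightarrow> comp x y) \<Longrightarrow> x \<in> C"
  have "D = C" if "D \<in> CS J" "C \<subseteq> D" for D
  proof (rule ccontr)
    assume "D \<noteq> C"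
    then have "\<exists>x\<in>D. x \<notin> C" using that by blast
    then show False using a(2) CS_D[OF that(1)] that(2) by blast
  qed
  then show ?thesis using a(1) by (simp add: Cl_def)
qed

lemma Cl_antichain: "C \<in> Cl J \<Longrightarrow> D \<in> Cl J \<Longrightarrow> C \<subseteq> D \<Longrightarrow> C = D"
  by (auto simp: Cl_def)

lemma CS_tau:
  assumes "side Q" "J \<subseteq> I" "C \<in> CS J"
  shows "tau Q J ` C \<in> CS J"
proof -
  have "comp (tau Q J x) (tau Q J y)" if "x \<in> C" "y \<in> C" "x \<noteq> y" for x y
    using comp_tau[OF assms(1,2), of x y] CS_D[OF assms(3)] that by blast
  moreover have "tau Q J ` C \<subseteq> AP J" using CS_D(1)[OF assms(3)] tau_AP[OF assms(1,2)] by blast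
  ultimately show ?thesis by (auto simp: CS_def pairwise_def)
qed

lemma tau_image_involution: "side Q \<Longrightarrow> J \<subseteq> I \<Longrightarrow> C \<subseteq> AP J \<Longrightarrow> tau Q J ` tau Q J ` C = C"
proof -
  assume a: "side Q" "J \<subseteq> I" "C \<subseteq> AP J"
  have "tau Q J ` tau Q J ` C = (\<lambda>x. x) ` C" unfolding image_image
    by (rule image_cong) (use a tau_involution in auto)
  then show ?thesis by simp
qed

lemma Cl_tau:
  assumes Q: "side Q" "J \<subseteq> I" and C: "C \<in> Cl J"
  shows "tau Q J ` C \<in> Cl J"
proof -
  have "D = tau Q J ` C" if D: "D \<in> CS J" "tau Q J ` C \<subseteq> D" for D
  proof -
    have "tau Q J ` tau Q J ` C \<subseteq> tau Q J ` D" using D(2) by (rule image_mono)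
    then have "C \<subseteq> tau Q J ` D"
      using tau_image_involution[OF Q] CS_D(1)[OF Cl_CS[OF C]] by simp
    then have "tau Q J ` D = C" using C CS_tau[OF Q D(1)] by (simp add: Cl_def)
    then show ?thesis using tau_image_involution[OF Q CS_D(1)[OF D(1)]] by simp
  qed
  then show ?thesis using CS_tau[OF Q Cl_CS[OF C]] by (simp add: Cl_def)
qed

lemma Cl_tau_bij:
  assumes "side Q" "J \<subseteq> I" "F \<subseteq> AP J"
  shows "bij_betw ((`) (tau Q J)) {C \<in> Cl J. F \<subseteq> C} {C \<in> Cl J. tau Q J ` F \<subseteq> C}"
proof (rule bij_betw_byWitness[where f' = "(`) (tau Q J)"])
  have i: "C \<in> Cl J \<Longrightarrow> tau Q J ` tau Q J ` C = C" for C
    by (rule tau_image_involution[OF assms(1,2) CS_D(1)[OF Cl_CS]])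
  then show "\<forall>C\<in>{C \<in> Cl J. F \<subseteq> C}. tau Q J ` tau Q J ` C = C"
    "\<forall>C\<in>{C \<in> Cl J. tau Q J ` F \<subseteq> C}. tau Q J ` tau Q J ` C = C" by auto
  show "(`) (tau Q J) ` {C \<in> Cl J. F \<subseteq> C} \<subseteq> {C \<in> Cl J. tau Q J ` F \<subseteq> C}"
    using Cl_tau[OF assms(1,2)] by auto
  show "(`) (tau Q J) ` {C \<in> Cl J. tau Q J ` F \<subseteq> C} \<subseteq> {C \<in> Cl J. F \<subseteq> C}"
  proof safe
    fix C assume C: "C \<in> Cl J" "tau Q J ` F \<subseteq> C"
    show "tau Q J ` C \<in> Cl J" by (rule Cl_tau[OF assms(1,2) C(1)])
    fix x assume "x \<in> F"
    then show "x \<in> tau Q J ` C"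
      using image_mono[OF C(2), of "tau Q J"] tau_image_involution[OF assms] by blast
  qed
qed

text \<open>Compatibility of a positive root with \<open>ndelta i\<close> means that its coefficient
  at \<open>i\<close> vanishes. Hence the link of \<open>ndelta i\<close> has as vertices exactly
  the almost positive roots of \<open>J - {i}\<close>.\<close>

lemma AP_remove:
  assumes "J \<subseteq> I" "i \<in> J" "x \<in> AP J"
  shows "x \<in> AP (J - {i}) \<longleftrightarrow> x \<noteq> ndelta i \<and> comp (ndelta i) x"
  using assms(3)
proof (cases rule: AP_cases)
  case 1
  have "comp (ndelta i) x \<longleftrightarrow> x i = 0"
    using comp_ndelta[of i x] assms PR_D(4)[OF 1, of i] by auto
  moreover have "x \<in> AP (J - {i}) \<longleftrightarrow> x i = 0"
    using 1 by (auto simp: AP_def PR_def supp_in_def)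
  ultimately show ?thesis using 1 by auto
next
  case (2 j)
  have "comp (ndelta i) x" using assms comp_ndelta[of i x] 2 by (auto simp: ndelta_def)
  then show ?thesis using 2 by auto
qed

lemma CS_link:
  assumes "J \<subseteq> I" "i \<in> J" "ndelta i \<notin> F"
  shows "insert (ndelta i) F \<in> CS J \<longleftrightarrow> F \<in> CS (J - {i})"
proof
  assume a: "insert (ndelta i) F \<in> CS J"
  have "F \<subseteq> AP (J - {i})"
  proof
    fix x assume x: "x \<in> F"
    then show "x \<in> AP (J - {i})" using AP_remove[OF assms(1,2), of x] CS_D[OF a] assms(3) by blast
  qed
  then show "F \<in> CS (J - {i})" using CS_subset[OF a, of F] by (auto simp: CS_def)
next
  assume a: "F \<in> CS (J - {i})"
  have FJ: "F \<in> CS J" using a CS_mono[of "J - {i}" J] by blast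
  show "insert (ndelta i) F \<in> CS J"
  proof (rule CS_insert[OF _ FJ])
    fix y assume "y \<in> F"
    then show "comp (ndelta i) y" using AP_remove[OF assms(1,2), of y] CS_D(1)[OF a] CS_D(1)[OF FJ] by blast
  qed (use assms in simp)
qed

lemma Cl_link:
  assumes "J \<subseteq> I" "i \<in> J" "ndelta i \<notin> F"
  shows "insert (ndelta i) F \<in> Cl J \<longleftrightarrow> F \<in> Cl (J - {i})"
proof
  assume a: "insert (ndelta i) F \<in> Cl J"
  show "F \<in> Cl (J - {i})"
  proof (rule ClI)
    show "F \<in> CS (J - {i})" using Cl_CS[OF a] CS_link[OF assms] by blast
    fix x assume x: "x \<in> AP (J - {i})" "\<And>y. y \<in> F \<Longrightarrow> comp x y"
    then have "x \<in> AP J" using AP_mono[of "J - {i}" J] by blast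
    then have "x \<noteq> ndelta i" "comp (ndelta i) x" using AP_remove[OF assms(1,2)] x by auto
    then show "x \<in> F" using Cl_maximal[OF a \<open>x \<in> AP J\<close>] x(2) comp_sym by auto
  qed
next
  assume a: "F \<in> Cl (J - {i})"
  show "insert (ndelta i) F \<in> Cl J"
  proof (rule ClI)
    show "insert (ndelta i) F \<in> CS J" using Cl_CS[OF a] CS_link[OF assms] by blast
    fix x assume x: "x \<in> AP J" "\<And>y. y \<in> insert (ndelta i) F \<Longrightarrow> comp x y"
    show "x \<in> insert (ndelta i) F"
    proof (cases "x = ndelta i")
      case False
      then have "x \<in> AP (J - {i})" using AP_remove[OF assms(1,2) x(1)] x(2) comp_sym by blast
      then show ?thesis using Cl_maximal[OF a] x(2) by blast
    qed simp
  qed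
qed

lemma ndelta_notin_Cl_remove: "F \<in> CS (J - {i}) \<Longrightarrow> ndelta i \<notin> F"
  using CS_D(1) by fastforce

lemma Cl_link_bij:
  assumes "J \<subseteq> I" "i \<in> J"
  shows "bij_betw (insert (ndelta i)) (Cl (J - {i})) {C \<in> Cl J. ndelta i \<in> C}"
proof (rule bij_betw_byWitness[where f' = "\<lambda>C. C - {ndelta i}"])
  have n: "ndelta i \<notin> F" if "F \<in> Cl (J - {i})" for F
    using ndelta_notin_Cl_remove[OF Cl_CS[OF that]] .
  show "\<forall>F\<in>Cl (J - {i}). insert (ndelta i) F - {ndelta i} = F" using n by auto
  show "\<forall>C\<in>{C \<in> Cl J. ndelta i \<in> C}. insert (ndelta i) (C - {ndelta i}) = C" by auto
  show "insert (ndelta i) ` Cl (J - {i}) \<subseteq> {C \<in> Cl J. ndelta i \<in> C}"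
    using Cl_link[OF assms] n by blast
  show "(\<lambda>C. C - {ndelta i}) ` {C \<in> Cl J. ndelta i \<in> C} \<subseteq> Cl (J - {i})"
  proof safe
    fix C assume "C \<in> Cl J" "ndelta i \<in> C"
    then show "C - {ndelta i} \<in> Cl (J - {i})"
      using Cl_link[OF assms, of "C - {ndelta i}"] by (simp add: insert_absorb)
  qed
qed

end

section \<open>Purity, facets and the recurrence for the number of clusters\<close>

context simply_laced begin

lemma finite_parabolic: "J \<subseteq> I \<Longrightarrow> finite J"
  using finite_I finite_subset by auto

lemma card_link: "J \<subseteq> I \<Longrightarrow> i \<in> J \<Longrightarrow> card {C \<in> Cl J. ndelta i \<in> C} = card (Cl (J - {i}))"
  by (simp add: bij_betw_same_card[OF Cl_link_bij])

lemma card_link_tau: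
  assumes "side Q" "J \<subseteq> I" "x \<in> AP J"
  shows "card {C \<in> Cl J. tau Q J x \<in> C} = card {C \<in> Cl J. x \<in> C}"
  using bij_betw_same_card[OF Cl_tau_bij[OF assms(1,2), of "{x}"]] assms(3) by simp

lemma card_Cl_element:
  assumes "J \<subseteq> I" "C \<in> Cl J"
  shows "card C = card J"
  using assms
proof (induction "card J" arbitrary: J C rule: less_induct)
  case less
  note J = less.prems(1)
  have finJ: "finite J" using finite_parabolic[OF J] .
  show ?case
  proof (cases "J = {}")
    case True
    have "AP J = {}" using PR_neq_zero True by (auto simp: AP_def)
    then show ?thesis using True CS_D(1)[OF Cl_CS[OF less.prems(2)]] by simp
  next
    case False
    \<comment> \<open>The claim attached to \<open>x\<close> speaks of all clusters through
      \<open>x\<close>, which makes it invariant under the involutions; the inner induction runs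
      along the orbit of \<open>x\<close> and the outer one is used only in the link of a negative
      simple root.\<close>
    have *: "\<forall>C\<in>Cl J. x \<in> C \<longrightarrow> card C = card J" if "x \<in> AP J" for x
      using J that
    proof (induction rule: AP_induct)
      case (ndelta i)
      have lt: "card (J - {i}) < card J" using ndelta finJ by (simp only: card_Diff1_less)
      show ?case
      proof safe
        fix C assume C: "C \<in> Cl J" "ndelta i \<in> C"
        define F where "F = C - {ndelta i}"
        have CF: "C = insert (ndelta i) F" "ndelta i \<notin> F" using C by (auto simp: F_def)
        then have F: "F \<in> Cl (J - {i})" using Cl_link[OF J ndelta] C(1) by simp
        have "card F = card (J - {i})" using less.hyps[OF lt _ F] J by blast
        moreover have "finite F" using finite_CS[OF _ Cl_CS[OF F]] J by blast
        ultimately show "card C = card J"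
          using CF card_Suc_Diff1[OF finJ ndelta] by simp
      qed
    next
      case (tau Q x)
      show ?case
      proof safe
        fix C assume C: "C \<in> Cl J" "tau Q J x \<in> C"
        have sub: "C \<subseteq> AP J" by (rule CS_D(1)[OF Cl_CS[OF C(1)]])
        have "x \<in> tau Q J ` C"
          using imageI[OF C(2), of "tau Q J"] tau_involution[OF tau(1) J tau(2)] by simp
        then have "card (tau Q J ` C) = card J" using tau(3) Cl_tau[OF tau(1) J C(1)] by simp
        moreover have "inj_on (tau Q J) C"
          by (rule inj_on_subset[OF bij_betw_imp_inj_on[OF tau_bij_betw[OF tau(1) J]] sub])
        ultimately show "card C = card J" by (simp add: card_image)
      qed
    qed
    have "C \<noteq> {}"
    proof
      assume "C = {}"
      moreover obtain i where "i \<in> J" using False by blast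
      ultimately show False using Cl_maximal[OF less.prems(2), of "ndelta i"] by simp
    qed
    then obtain x where "x \<in> C" by blast
    then show ?thesis using * CS_D(1)[OF Cl_CS[OF less.prems(2)]] less.prems(2) by blast
  qed
qed

lemma Cl_singleton:
  assumes "i \<in> I"
  shows "Cl {i} = {{delta i}, {ndelta i}}"
proof -
  have J: "{i} \<subseteq> I" using assms by simp
  have "PR {i} = {delta i}"
    using delta_PR[OF J] mult_R PR_D(1,2) ndelta_notin_PR by (auto, metis)
  then have AP: "AP {i} = {delta i, ndelta i}" by (auto simp: AP_def)
  have nc: "\<not> comp (ndelta i) (delta i)" using cdeg_self_simple[OF assms] by (simp add: comp_def)
  have c: "{x} \<in> Cl {i}" if "x \<in> AP {i}" for x
  proof (rule ClI)
    show "{x} \<in> CS {i}" using that by (simp add: CS_def)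
    fix y assume y: "y \<in> AP {i}" "\<And>z. z \<in> {x} \<Longrightarrow> comp y z"
    show "y \<in> {x}"
    proof (rule ccontr)
      assume "y \<notin> {x}"
      then have "(x = delta i \<and> y = ndelta i) \<or> (y = delta i \<and> x = ndelta i)" using y that AP by auto
      then show False using nc y(2) comp_sym by blast
    qed
  qed
  have "C \<in> {{delta i}, {ndelta i}}" if "C \<in> Cl {i}" for C
  proof -
    have "card C = 1" "C \<subseteq> AP {i}" using card_Cl_element[OF J that] CS_D(1)[OF Cl_CS[OF that]] by auto
    then show ?thesis using AP by (auto simp: card_1_singleton_iff)
  qed
  then show ?thesis using c AP by blast
qed

text \<open>The same double induction as for the size of clusters. It bottoms out when the facet is
  empty, so that there is no root to rotate: then the rank is 1 and the two clusters are those of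
  \<open>Cl_singleton\<close>.\<close>

lemma card_Cl_containing_facet:
  assumes "J \<subseteq> I" "F \<in> CS J" "card F + 1 = card J"
  shows "card {C \<in> Cl J. F \<subseteq> C} = 2"
  using assms
proof (induction "card J" arbitrary: J F rule: less_induct)
  case less
  note J = less.prems(1)
  have finJ: "finite J" using finite_parabolic[OF J] .
  show ?case
  proof (cases "F = {}")
    case True
    then have "card J = 1" using less.prems by simp
    then obtain i where i: "J = {i}" by (auto simp: card_1_singleton_iff)
    then have "Cl J = {{delta i}, {ndelta i}}" using Cl_singleton J by blast
    moreover have "{C \<in> Cl J. F \<subseteq> C} = Cl J" using True by simp
    ultimately show ?thesis by simp
  next
    case False
    have *: "\<forall>F\<in>CS J. x \<in> F \<longrightarrow> card F + 1 = card J \<longrightarrow> card {C \<in> Cl J. F \<subseteq> C} = 2"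
      if "x \<in> AP J" for x
      using J that
    proof (induction rule: AP_induct)
      case (ndelta i)
      have JI: "J - {i} \<subseteq> I" using J by blast
      have cJ: "card (J - {i}) + 1 = card J" using ndelta finJ card_Suc_Diff1 by fastforce
      show ?case
      proof safe
        fix F assume F: "F \<in> CS J" "ndelta i \<in> F" "card F + 1 = card J"
        define G where "G = F - {ndelta i}"
        have FG: "F = insert (ndelta i) G" "ndelta i \<notin> G" using F by (auto simp: G_def)
        then have G: "G \<in> CS (J - {i})" using CS_link[OF J ndelta] F by simp
        have "finite G" using finite_CS[OF JI G] .
        then have cG: "card G + 1 = card (J - {i})" using FG cJ F(3) by simp
        have "card {C \<in> Cl (J - {i}). G \<subseteq> C} = 2"
          by (rule less.hyps[OF _ JI G cG]) (use cJ in simp)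
        moreover have "bij_betw (insert (ndelta i)) {C \<in> Cl (J - {i}). G \<subseteq> C} {C \<in> Cl J. F \<subseteq> C}"
        proof (rule bij_betw_subset[OF Cl_link_bij[OF J ndelta]])
          show "insert (ndelta i) ` {C \<in> Cl (J - {i}). G \<subseteq> C} = {C \<in> Cl J. F \<subseteq> C}" (is "?l = ?r")
          proof
            show "?l \<subseteq> ?r" using bij_betw_imp_surj_on[OF Cl_link_bij[OF J ndelta]] FG by blast
            show "?r \<subseteq> ?l"
            proof
              fix C assume "C \<in> ?r"
              then have C: "C \<in> Cl J" "F \<subseteq> C" by auto
              then have "C = insert (ndelta i) (C - {ndelta i})" using F(2) by blast
              moreover have "C - {ndelta i} \<in> Cl (J - {i})"
                using Cl_link[OF J ndelta, of "C - {ndelta i}"] C F(2) by (simp add: insert_absorb subset_iff)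
              moreover have "G \<subseteq> C - {ndelta i}" using FG C by blast
              ultimately show "C \<in> ?l" by blast
            qed
          qed
        qed auto
        ultimately show "card {C \<in> Cl J. F \<subseteq> C} = 2" using bij_betw_same_card by fastforce
      qed
    next
      case (tau Q x)
      show ?case
      proof safe
        fix F assume F: "F \<in> CS J" "tau Q J x \<in> F" "card F + 1 = card J"
        have sub: "F \<subseteq> AP J" by (rule CS_D(1)[OF F(1)])
        have "x \<in> tau Q J ` F"
          using imageI[OF F(2), of "tau Q J"] tau_involution[OF tau(1) J tau(2)] by simp
        moreover have "inj_on (tau Q J) F"
          by (rule inj_on_subset[OF bij_betw_imp_inj_on[OF tau_bij_betw[OF tau(1) J]] sub])
        then have "card (tau Q J ` F) + 1 = card J" using F(3) by (simp add: card_image)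
        ultimately have "card {C \<in> Cl J. tau Q J ` F \<subseteq> C} = 2"
          using tau(3) CS_tau[OF tau(1) J F(1)] by simp
        then show "card {C \<in> Cl J. F \<subseteq> C} = 2"
          using bij_betw_same_card[OF Cl_tau_bij[OF tau(1) J sub]] by simp
      qed
    qed
    obtain x where "x \<in> F" using False by blast
    then show ?thesis using * less.prems CS_D(1)[OF less.prems(2)] by blast
  qed
qed

text \<open>Double counting of pairs of a root and a cluster through it. Every cluster has
  \<open>card J\<close> roots, and the clusters through a negative simple root are counted in its
  link.\<close>

lemma card_mult_card_Cl:
  assumes J: "J \<subseteq> I"
  shows "card J * card (Cl J) = (\<Sum>x\<in>PR J. card {C \<in> Cl J. x \<in> C}) + (\<Sum>i\<in>J. card (Cl (J - {i})))"
proof -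
  have "(\<Sum>x\<in>AP J. card {C \<in> Cl J. x \<in> C}) = card J * card (Cl J)"
  proof (rule sum_multicount[OF finite_AP[OF J] finite_Cl[OF J]], safe)
    fix C assume C: "C \<in> Cl J"
    have "{x \<in> AP J. x \<in> C} = C" using CS_D(1)[OF Cl_CS[OF C]] by blast
    then show "card {x \<in> AP J. x \<in> C} = card J" using card_Cl_element[OF J C] by simp
  qed
  moreover have "(\<Sum>x\<in>AP J. card {C \<in> Cl J. x \<in> C})
      = (\<Sum>x\<in>PR J. card {C \<in> Cl J. x \<in> C}) + (\<Sum>x\<in>ndelta ` J. card {C \<in> Cl J. x \<in> C})"
    unfolding AP_def by (rule sum.union_disjoint) (use finite_PR finite_parabolic[OF J] in auto)
  moreover have "(\<Sum>x\<in>ndelta ` J. card {C \<in> Cl J. x \<in> C}) = (\<Sum>i\<in>J. card (Cl (J - {i})))"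
    using card_link[OF J] by (simp add: sum.reindex inj_ndelta)
  ultimately show ?thesis by simp
qed

section \<open>Alternating orbits of positive roots\<close>

definition alternate :: "'i set \<Rightarrow> nat \<Rightarrow> 'i set" where
  "alternate Q t = (if even t then Q else - Q)"

primrec alt_refl :: "'i set \<Rightarrow> 'i set \<Rightarrow> nat \<Rightarrow> ('i \<Rightarrow> int) \<Rightarrow> 'i \<Rightarrow> int" where
  "alt_refl Q J 0 x = x"
| "alt_refl Q J (Suc t) x = srefl (alternate Q t \<inter> J) (alt_refl Q J t x)"

text \<open>The piecewise linear orbit agrees with the linear \<open>alt_refl\<close> as long as it
  stays among the positive roots, so a linear fact about the longest element bounds the time at
  which it leaves them.\<close>

primrec alt_tau :: "'i set \<Rightarrow> 'i set \<Rightarrow> nat \<Rightarrow> ('i \<Rightarrow> int) \<Rightarrow> 'i \<Rightarrow> int" where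
  "alt_tau Q J 0 x = x"
| "alt_tau Q J (Suc t) x = tau (alternate Q t) J (alt_tau Q J t x)"

text \<open>The two properties of the Coxeter number \<open>h\<close> needed for the orbit count. The second one holds
  because the alternating product of \<open>h\<close> factors is the longest element.\<close>

definition coxeter_number :: "'i set \<Rightarrow> nat \<Rightarrow> bool" where
  "coxeter_number J h \<longleftrightarrow> h * card J \<le> 2 * card (PR J) \<and>
     (\<forall>Q x. side Q \<longrightarrow> x \<in> PR J \<longrightarrow> \<not> nonneg (alt_refl Q J h x))"

lemma side_alternate: "side Q \<Longrightarrow> side (alternate Q t)"
  by (auto simp: alternate_def side_compl)

lemma alt_tau_AP: "side Q \<Longrightarrow> J \<subseteq> I \<Longrightarrow> x \<in> AP J \<Longrightarrow> alt_tau Q J t x \<in> AP J"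
  by (induction t) (auto simp: tau_AP side_alternate)

lemma alt_tau_inj:
  assumes "side Q" "J \<subseteq> I" "x \<in> AP J" "y \<in> AP J" "alt_tau Q J t x = alt_tau Q J t y"
  shows "x = y"
  using assms(5)
proof (induction t)
  case (Suc t)
  then show ?case
    using alt_tau_AP[OF assms(1,2)] assms(3,4) tau_involution[OF side_alternate[OF assms(1)] assms(2)]
    by (metis alt_tau.simps(2))
qed simp

lemma card_link_alt_tau:
  assumes "side Q" "J \<subseteq> I" "x \<in> AP J"
  shows "card {C \<in> Cl J. alt_tau Q J t x \<in> C} = card {C \<in> Cl J. x \<in> C}"
proof (induction t)
  case (Suc t)
  have "card {C \<in> Cl J. alt_tau Q J (Suc t) x \<in> C} = card {C \<in> Cl J. alt_tau Q J t x \<in> C}"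
    unfolding alt_tau.simps
    by (rule card_link_tau[OF side_alternate[OF assms(1)] assms(2) alt_tau_AP[OF assms]])
  then show ?case using Suc by simp
qed simp

text \<open>An orbit positive up to time \<open>h\<close> would be the linear orbit, which is not
  positive at time \<open>h\<close>. At the first exit the involution turns a positive root into a
  non-positive one, which happens only to a simple root on the side that acts at that
  moment.\<close>

lemma alt_tau_hits:
  assumes "coxeter_number J h" "side Q" "J \<subseteq> I" "x \<in> PR J"
  shows "\<exists>k<h. \<exists>i\<in>J \<inter> alternate Q k. alt_tau Q J (Suc k) x = ndelta i"
proof -
  have "\<exists>k\<le>h. alt_tau Q J k x \<notin> PR J"
  proof (rule ccontr)
    assume "\<not> ?thesis"
    then have all: "alt_tau Q J k x \<in> PR J" if "k \<le> h" for k using that by blast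
    have "alt_tau Q J k x = alt_refl Q J k x" if "k \<le> h" for k
      using that
    proof (induction k)
      case (Suc k)
      then show ?case using tau_PR[OF all[of k]] by simp
    qed simp
    then have "nonneg (alt_refl Q J h x)" using all[of h] PR_D(3) by (metis order_refl)
    then show False using assms by (auto simp: coxeter_number_def)
  qed
  then obtain m where m: "m \<le> h" "alt_tau Q J m x \<notin> PR J" by blast
  define l where "l = (LEAST k. alt_tau Q J k x \<notin> PR J)"
  have l: "alt_tau Q J l x \<notin> PR J" "l \<le> m" unfolding l_def
    using m LeastI Least_le by metis+
  have "l \<noteq> 0" using l assms by (metis alt_tau.simps(1))
  then obtain k where k: "l = Suc k" by (cases l) auto
  have kPR: "alt_tau Q J k x \<in> PR J" using not_less_Least[of k "\<lambda>k. alt_tau Q J k x \<notin> PR J"] k l_def by auto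
  have kAP: "alt_tau Q J k x \<in> AP J" using kPR PR_subset_AP by blast
  have "\<exists>i\<in>J \<inter> alternate Q k. alt_tau Q J (Suc k) x = ndelta i"
    using side_alternate[OF assms(2)] assms(3) kAP
  proof (cases rule: tau_cases[of "alternate Q k" J "alt_tau Q J k x"])
    case (simple i)
    then show ?thesis by auto
  next
    case pos
    then show ?thesis using l k by simp
  qed (use kPR in auto)
  then show ?thesis using k l m by (intro exI[of _ k]) auto
qed

text \<open>Every pair of a positive root and a starting side is recorded by the time and the place
  at which its alternating orbit first meets a negative simple root; by counting, every
  time below \<open>h\<close> and every place occur exactly once.\<close>

lemma sum_card_link_PR:
  assumes h: "coxeter_number J h" and J: "J \<subseteq> I"
  shows "2 * (\<Sum>x\<in>PR J. card {C \<in> Cl J. x \<in> C}) = h * (\<Sum>i\<in>J. card (Cl (J - {i})))"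
proof -
  define D where "D = PR J \<times> {P, - P}"
  define g where "g x = card {C \<in> Cl J. x \<in> C}" for x
  have PP: "P \<noteq> - P" by auto
  have "\<forall>z\<in>D. \<exists>w. fst w < h \<and> snd w \<in> J \<inter> alternate (snd z) (fst w) \<and>
      alt_tau (snd z) J (Suc (fst w)) (fst z) = ndelta (snd w)"
    using alt_tau_hits[OF h _ J] side_P unfolding D_def by fastforce
  then obtain f where f: "\<And>z. z \<in> D \<Longrightarrow> fst (f z) < h \<and> snd (f z) \<in> J \<inter> alternate (snd z) (fst (f z)) \<and>
      alt_tau (snd z) J (Suc (fst (f z))) (fst z) = ndelta (snd (f z))"
    by (metis (no_types, lifting) bchoice)
  have D_side: "side (snd z)" "fst z \<in> AP J" if "z \<in> D" for z
    using that side_P PR_subset_AP[of J] by (auto simp: D_def)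
  have inj: "inj_on f D"
  proof (rule inj_onI)
    fix z w assume zw: "z \<in> D" "w \<in> D" "f z = f w"
    \<comment> \<open>The two starting sides act with complementary sets at every time, and the
      recorded node lies in the set acting at the recorded time. So time and node determine the
      starting side, after which injectivity of the involutions recovers the root.\<close>
    have s: "snd z = snd w"
    proof (rule ccontr)
      assume ne: "snd z \<noteq> snd w"
      then have "snd z = - snd w" using zw by (auto simp: D_def)
      then have "alternate (snd z) k = - alternate (snd w) k" for k by (simp add: alternate_def)
      then show False using f[OF zw(1)] f[OF zw(2)] zw(3) by auto
    qed
    have "alt_tau (snd w) J (Suc (fst (f w))) (fst z) = alt_tau (snd w) J (Suc (fst (f w))) (fst w)"
      using f[OF zw(1)] f[OF zw(2)] zw(3) s by metis
    then have "fst z = fst w" using alt_tau_inj[OF D_side(1)[OF zw(2)] J D_side(2)[OF zw(1)] D_side(2)[OF zw(2)]] by blast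
    then show "z = w" using s by (simp add: prod_eq_iff)
  qed
  have fin: "finite ({..<h} \<times> J)" using finite_parabolic[OF J] by simp
  have sub: "f ` D \<subseteq> {..<h} \<times> J" 
  proof
    fix w assume "w \<in> f ` D"
    then obtain z where "z \<in> D" "w = f z" by blast
    then show "w \<in> {..<h} \<times> J" using f[of z] by (simp add: mem_Times_iff)
  qed
  have "card (f ` D) = 2 * card (PR J)"
    using card_image[OF inj] PP by (simp add: D_def card_cartesian_product)
  \<comment> \<open>The lower bound on the number of positive roots meets the injection from the
    other direction, so every time below \<open>h\<close> and every node is hit.\<close>
  also have "\<dots> \<ge> card ({..<h} \<times> J)" using h by (simp add: coxeter_number_def card_cartesian_product)
  finally have im: "f ` D = {..<h} \<times> J" using card_seteq[OF fin sub] by simp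
  have "2 * (\<Sum>x\<in>PR J. g x) = (\<Sum>x\<in>PR J. \<Sum>Q\<in>{P, - P}. g x)"
    using PP by (simp add: sum_distrib_left mult_2)
  also have "\<dots> = (\<Sum>z\<in>D. g (fst z))"
    unfolding D_def sum.cartesian_product case_prod_unfold ..
  also have "\<dots> = (\<Sum>z\<in>D. card (Cl (J - {snd (f z)})))"
  proof (rule sum.cong)
    fix z assume z: "z \<in> D"
    have "g (fst z) = card {C \<in> Cl J. alt_tau (snd z) J (Suc (fst (f z))) (fst z) \<in> C}"
      unfolding g_def by (rule card_link_alt_tau[OF D_side(1)[OF z] J D_side(2)[OF z], symmetric])
    also have "\<dots> = card {C \<in> Cl J. ndelta (snd (f z)) \<in> C}" using f[OF z] by simp
    also have "\<dots> = card (Cl (J - {snd (f z)}))" using f[OF z] by (intro card_link[OF J]) blast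
    finally show "g (fst z) = card (Cl (J - {snd (f z)}))" .
  qed simp
  also have "\<dots> = (\<Sum>w\<in>f ` D. card (Cl (J - {snd w})))"
    by (simp add: sum.reindex[OF inj])
  also have "\<dots> = h * (\<Sum>i\<in>J. card (Cl (J - {i})))"
  proof -
    have "(\<Sum>k<h. \<Sum>i\<in>J. card (Cl (J - {i}))) = (\<Sum>w\<in>{..<h} \<times> J. card (Cl (J - {snd w})))"
      unfolding sum.cartesian_product case_prod_unfold ..
    then show ?thesis unfolding im by simp
  qed
  finally show ?thesis unfolding g_def .
qed

lemma card_Cl_recurrence:
  assumes h: "coxeter_number J h" and J: "J \<subseteq> I"
  shows "2 * card J * card (Cl J) = (h + 2) * (\<Sum>i\<in>J. card (Cl (J - {i})))"
  using card_mult_card_Cl[OF J] sum_card_link_PR[OF h J] by (simp add: algebra_simps)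

end

section \<open>Parabolic decomposition and edges between positive clusters\<close>

lemma card_ordered_pairs:
  assumes "finite r" "sym r" "irrefl r"
  shows "card r = 2 * card ((\<lambda>(a, b). {a, b}) ` r)"
proof -
  let ?E = "(\<lambda>(a, b). {a, b}) ` r"
  let ?f = "\<lambda>e. {z \<in> r. (\<lambda>(a, b). {a, b}) z = e}"
  have c: "card (?f e) = 2" if "e \<in> ?E" for e
  proof -
    obtain a b where ab: "(a, b) \<in> r" "e = {a, b}" using \<open>e \<in> ?E\<close> by auto
    then have "(b, a) \<in> r" "a \<noteq> b" using assms by (auto simp: sym_def irrefl_def)
    then have "?f e = {(a, b), (b, a)}" using ab by (auto simp: doubleton_eq_iff)
    then show ?thesis using \<open>a \<noteq> b\<close> by simp
  qed
  have "card r = card (\<Union>e\<in>?E. ?f e)" by (rule arg_cong[of _ _ card]) auto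
  also have "\<dots> = (\<Sum>e\<in>?E. card (?f e))"
    by (rule card_UN_disjoint) (use assms(1) in auto)
  also have "\<dots> = 2 * card ?E" using c by simp
  finally show ?thesis .
qed

context simply_laced begin

text \<open>Interpolates between all clusters, \<open>S = {}\<close>, and the positive ones,
  \<open>S = J\<close>, so that negative simple roots can be excluded one at a time.\<close>

definition Ncl :: "'i set \<Rightarrow> 'i set \<Rightarrow> nat" where
  "Ncl J S = card {C \<in> Cl J. \<forall>k\<in>S. ndelta k \<notin> C}"

definition PCl :: "'i set \<Rightarrow> ('i \<Rightarrow> int) set set" where
  "PCl J = {C \<in> Cl J. C \<subseteq> PR J}"

definition pos_edges :: "'i set \<Rightarrow> ('i \<Rightarrow> int) set set set" where
  "pos_edges J = {{C, D} | C D. C \<in> PCl J \<and> D \<in> PCl J \<and> C \<noteq> D \<and> card (C \<inter> D) = card J - 1}"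

lemma Ncl_empty: "Ncl J {} = card (Cl J)"
  by (simp add: Ncl_def)

lemma PCl_iff: "C \<in> PCl J \<longleftrightarrow> C \<in> Cl J \<and> (\<forall>i\<in>J. ndelta i \<notin> C)"
  using CS_D(1)[OF Cl_CS[of C J]] by (auto simp: PCl_def AP_def)

lemma PCl_D: "C \<in> PCl J \<Longrightarrow> C \<in> Cl J" "C \<in> PCl J \<Longrightarrow> i \<in> J \<Longrightarrow> ndelta i \<notin> C"
  using PCl_iff by blast+

lemma PCl_I: "C \<in> Cl J \<Longrightarrow> (\<And>i. i \<in> J \<Longrightarrow> ndelta i \<notin> C) \<Longrightarrow> C \<in> PCl J"
  using PCl_iff by blast

lemma Ncl_self: "Ncl J J = card (PCl J)"
proof -
  have "PCl J = {C \<in> Cl J. \<forall>k\<in>J. ndelta k \<notin> C}" using PCl_iff by blast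
  then show ?thesis by (simp add: Ncl_def)
qed

lemma Ncl_split:
  assumes "J \<subseteq> I" "k \<in> J" "k \<notin> S"
  shows "Ncl J S = Ncl J (insert k S) + Ncl (J - {k}) S"
proof -
  let ?A = "{C \<in> Cl J. \<forall>l\<in>insert k S. ndelta l \<notin> C}"
  let ?B = "{C \<in> Cl J. ndelta k \<in> C \<and> (\<forall>l\<in>S. ndelta l \<notin> C)}"
  let ?D = "{C \<in> Cl (J - {k}). \<forall>l\<in>S. ndelta l \<notin> C}"
  have im: "insert (ndelta k) ` ?D = ?B"
  proof
    show "insert (ndelta k) ` ?D \<subseteq> ?B"
      using bij_betw_imp_surj_on[OF Cl_link_bij[OF assms(1,2)]] assms(3) by auto
    show "?B \<subseteq> insert (ndelta k) ` ?D"
    proof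
      fix C assume C: "C \<in> ?B"
      then have "C \<in> insert (ndelta k) ` Cl (J - {k})"
        using bij_betw_imp_surj_on[OF Cl_link_bij[OF assms(1,2)]] by blast
      then obtain F where "F \<in> Cl (J - {k})" "C = insert (ndelta k) F" by blast
      then show "C \<in> insert (ndelta k) ` ?D" using C by auto
    qed
  qed
  have "inj_on (insert (ndelta k)) ?D"
    by (rule inj_on_subset[OF bij_betw_imp_inj_on[OF Cl_link_bij[OF assms(1,2)]]]) auto
  from card_image[OF this] have "card ?B = card ?D" unfolding im .
  moreover have "card {C \<in> Cl J. \<forall>l\<in>S. ndelta l \<notin> C} = card ?A + card ?B"
  proof -
    have "{C \<in> Cl J. \<forall>l\<in>S. ndelta l \<notin> C} = ?A \<union> ?B" "?A \<inter> ?B = {}" by auto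
    then show ?thesis using finite_Cl[OF assms(1)] by (simp add: card_Un_disjoint)
  qed
  ultimately show ?thesis by (simp add: Ncl_def)
qed

section \<open>Cluster complexes of separated subdiagrams\<close>

definition separated :: "'i set \<Rightarrow> 'i set \<Rightarrow> bool" where
  "separated J K \<longleftrightarrow> J \<inter> K = {} \<and> (\<forall>i\<in>J. nb i \<inter> K = {})"

lemma separated_sym: "separated J K \<Longrightarrow> separated K J"
  using nb_sym by (fastforce simp: separated_def)

lemma comp_separated:
  assumes s: "separated J K" and J: "J \<subseteq> I" "K \<subseteq> I" and x: "x \<in> AP J" and y: "y \<in> AP K"
  shows "comp x y"
proof -
  have e: "euler P a b = 0" if "separated J K" "supp_in J a" "supp_in K b" for J K a b
  proof -
    have "(\<Sum>i\<in>I. a i * b i) = 0"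
      by (rule sum.neutral) (use that in \<open>auto simp: separated_def supp_in_def\<close>)
    moreover have "(\<Sum>i\<in>I \<inter> P. a i * (\<Sum>j\<in>nb i. b j)) = 0"
    proof (rule sum.neutral, safe)
      fix i assume "i \<in> I"
      show "a i * (\<Sum>j\<in>nb i. b j) = 0"
      proof (cases "i \<in> J")
        case True
        then have "nb i \<inter> K = {}" using that(1) by (simp add: separated_def)
        then have "\<forall>j\<in>nb i. b j = 0" using that(3) by (auto simp: supp_in_def)
        then have "(\<Sum>j\<in>nb i. b j) = 0" by simp
        then show ?thesis by simp
      next
        case False
        then show ?thesis using that by (simp add: supp_in_def)
      qed
    qed
    ultimately show ?thesis by (simp add: euler_def)
  qed
  show ?thesis using x
  proof (cases rule: AP_cases)
    case xp: 1
    show ?thesis using y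
    proof (cases rule: AP_cases)
      case 1
      have "euler P x y = 0" "euler P y x = 0"
        using e[OF s supp_in_AP[OF x] supp_in_AP[OF y]]
          e[OF separated_sym[OF s] supp_in_AP[OF y] supp_in_AP[OF x]] by auto
      then show ?thesis
        using cdeg_pos[OF side_P(1) PR_D(3)[OF xp] PR_D(3)[OF 1]] by (simp add: comp_def)
    next
      case (2 i)
      then have "x i = 0" using s supp_in_AP[OF x] by (auto simp: separated_def supp_in_def)
      then show ?thesis using 2 comp_ndelta[of i x] comp_sym J by auto
    qed
  next
    case (2 i)
    then have "y i = 0" using s supp_in_AP[OF y] by (auto simp: separated_def supp_in_def)
    then show ?thesis using 2 comp_ndelta[of i y] J by auto
  qed
qed

text \<open>No root straddles two parts without edges between them: being supported in one of the
  parts holds for negative simple roots and is preserved by the involutions, because the neighbour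
  sum at a node of the other part is zero.\<close>

lemma AP_separated:
  assumes s: "separated J K" and J: "J \<subseteq> I" "K \<subseteq> I"
  shows "AP (J \<union> K) = AP J \<union> AP K" "AP J \<inter> AP K = {}"
proof -
  have JK: "J \<union> K \<subseteq> I" using J by simp
  have stable: "supp_in J (srefl (Q \<inter> (J \<union> K)) x)" if "separated J K" "supp_in J x" for Q x J K
  proof -
    have "(\<Sum>j\<in>nb i. x j) = 0" if "i \<in> K" for i
      by (rule sum.neutral)
        (use \<open>i \<in> K\<close> \<open>supp_in J x\<close> separated_sym[OF \<open>separated J K\<close>] in \<open>auto simp: separated_def supp_in_def\<close>)
    then show ?thesis using that by (auto simp: srefl_def supp_in_def separated_def)
  qed
  have "supp_in J x \<or> supp_in K x" if "x \<in> AP (J \<union> K)" for x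
    using JK that
  proof (induction rule: AP_induct)
    case (tau Q x)
    then show ?case
      using stable[OF s, of x Q] stable[OF separated_sym[OF s], of x Q] by (auto simp: tau_def Un_commute)
  qed auto
  then show "AP (J \<union> K) = AP J \<union> AP K"
    using AP_mono[of J "J \<union> K"] AP_mono[of K "J \<union> K"]
    by (auto simp: AP_def PR_def)
  show "AP J \<inter> AP K = {}"
  proof (rule ccontr)
    assume "AP J \<inter> AP K \<noteq> {}"
    then obtain x where x: "x \<in> AP J" "x \<in> AP K" by blast
    have x0: "x i = 0" for i using supp_in_AP[OF x(1)] supp_in_AP[OF x(2)] s
      by (auto simp: supp_in_def separated_def)
    from x(1) show False
    proof (cases rule: AP_cases)
      case 1
      then show ?thesis using PR_neq_zero x0 by fastforce
    next
      case (2 i)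
      then show ?thesis using x0[of i] by (simp add: ndelta_def)
    qed
  qed
qed

text \<open>The complex of a separated union is the join of the two complexes, as every root of one
  part is compatible with every root of the other.\<close>

lemma Cl_separated:
  assumes s: "separated J K" and J: "J \<subseteq> I" "K \<subseteq> I" and C: "C \<subseteq> AP J" and D: "D \<subseteq> AP K"
  shows "C \<union> D \<in> Cl (J \<union> K) \<longleftrightarrow> C \<in> Cl J \<and> D \<in> Cl K"
proof -
  note AP = AP_separated[OF s J]
  have half: "E \<in> Cl J'" if "separated J' K'" "J' \<subseteq> I" "K' \<subseteq> I" "E \<subseteq> AP J'" "E' \<subseteq> AP K'" "E \<union> E' \<in> Cl (J' \<union> K')" for E J' E' K'
  proof (rule ClI)
    show "E \<in> CS J'" using Cl_CS[OF that(6)] that(4) by (auto simp: CS_def pairwise_def)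
    fix x assume x: "x \<in> AP J'" "\<And>y. y \<in> E \<Longrightarrow> comp x y"
    have "x \<in> E \<union> E'"
    proof (rule Cl_maximal[OF that(6)])
      show "x \<in> AP (J' \<union> K')" using x AP_mono[of J' "J' \<union> K'"] by blast
      fix y assume "y \<in> E \<union> E'"
      then show "comp x y" using x comp_separated[OF that(1-3) x(1)] that(5) by blast
    qed
    then show "x \<in> E" using AP_separated(2)[OF that(1-3)] x that(5) by blast
  qed
  show ?thesis
  proof
    assume a: "C \<union> D \<in> Cl (J \<union> K)"
    then have "D \<union> C \<in> Cl (K \<union> J)" by (simp add: Un_commute)
    then show "C \<in> Cl J \<and> D \<in> Cl K"
      using half[OF s J C D a] half[OF separated_sym[OF s] J(2,1) D C] by blast
  next
    assume a: "C \<in> Cl J \<and> D \<in> Cl K"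
    show "C \<union> D \<in> Cl (J \<union> K)"
    proof (rule ClI)
      have "comp x y" if "x \<in> C \<union> D" "y \<in> C \<union> D" "x \<noteq> y" for x y
      proof -
        have "comp x y \<or> comp y x"
          using that comp_separated[OF s J] C D CS_D(2)[OF Cl_CS, of C J x y] CS_D(2)[OF Cl_CS, of D K x y] a
          by blast
        then show ?thesis using comp_sym by blast
      qed
      then show "C \<union> D \<in> CS (J \<union> K)" using C D AP by (auto simp: CS_def pairwise_def)
      fix x assume x: "x \<in> AP (J \<union> K)" "\<And>y. y \<in> C \<union> D \<Longrightarrow> comp x y"
      then show "x \<in> C \<union> D" using AP(1) Cl_maximal[of C J x] Cl_maximal[of D K x] a by blast
    qed
  qed
qed

lemma Ncl_separated:
  assumes s: "separated J K" and J: "J \<subseteq> I" "K \<subseteq> I"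
  shows "Ncl (J \<union> K) S = Ncl J S * Ncl K S"
proof -
  note AP = AP_separated[OF s J]
  let ?A = "\<lambda>J. {C \<in> Cl J. \<forall>k\<in>S. ndelta k \<notin> C}"
  have sub: "C \<subseteq> AP J" if "C \<in> ?A J" for C J using that CS_D(1)[OF Cl_CS] by blast
  have "bij_betw (\<lambda>(C, D). C \<union> D) (?A J \<times> ?A K) (?A (J \<union> K))"
  proof (rule bij_betw_byWitness[where f' = "\<lambda>C. (C \<inter> AP J, C \<inter> AP K)"])
    show "\<forall>z\<in>?A J \<times> ?A K. (\<lambda>C. (C \<inter> AP J, C \<inter> AP K)) ((\<lambda>(C, D). C \<union> D) z) = z"
    proof
      fix z assume "z \<in> ?A J \<times> ?A K"
      then obtain C D where z: "z = (C, D)" "C \<in> ?A J" "D \<in> ?A K" by blast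
      then have "(C \<union> D) \<inter> AP J = C" "(C \<union> D) \<inter> AP K = D" using sub[OF z(2)] sub[OF z(3)] AP(2) by blast+
      then show "(\<lambda>C. (C \<inter> AP J, C \<inter> AP K)) ((\<lambda>(C, D). C \<union> D) z) = z" using z(1) by simp
    qed
    show "\<forall>C\<in>?A (J \<union> K). (\<lambda>(C, D). C \<union> D) (C \<inter> AP J, C \<inter> AP K) = C"
      using sub[of _ "J \<union> K"] AP(1) by fastforce
    show "(\<lambda>(C, D). C \<union> D) ` (?A J \<times> ?A K) \<subseteq> ?A (J \<union> K)"
    proof (rule image_subsetI)
      fix z assume "z \<in> ?A J \<times> ?A K"
      then obtain C D where z: "z = (C, D)" "C \<in> ?A J" "D \<in> ?A K" by blast
      then have "C \<union> D \<in> Cl (J \<union> K)" using Cl_separated[OF s J sub[OF z(2)] sub[OF z(3)]] by blast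
      then show "(\<lambda>(C, D). C \<union> D) z \<in> ?A (J \<union> K)" using z by auto
    qed
    show "(\<lambda>C. (C \<inter> AP J, C \<inter> AP K)) ` ?A (J \<union> K) \<subseteq> ?A J \<times> ?A K"
    proof (rule image_subsetI)
      fix C assume C': "C \<in> ?A (J \<union> K)"
      then have C: "C \<in> Cl (J \<union> K)" by blast
      then have "C = (C \<inter> AP J) \<union> (C \<inter> AP K)" using CS_D(1)[OF Cl_CS[OF C]] AP(1) by blast
      then have "C \<inter> AP J \<in> Cl J \<and> C \<inter> AP K \<in> Cl K"
        using Cl_separated[OF s J, of "C \<inter> AP J" "C \<inter> AP K"] C by simp
      then show "(C \<inter> AP J, C \<inter> AP K) \<in> ?A J \<times> ?A K" using C' by auto
    qed
  qed
  then show ?thesis unfolding Ncl_def by (simp add: bij_betw_same_card[symmetric] card_cartesian_product)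
qed

lemma Ncl_restrict: "J \<subseteq> I \<Longrightarrow> Ncl J S = Ncl J (S \<inter> J)"
proof -
  assume "J \<subseteq> I"
  have "{C \<in> Cl J. \<forall>k\<in>S. ndelta k \<notin> C} = {C \<in> Cl J. \<forall>k\<in>S \<inter> J. ndelta k \<notin> C}"
    using CS_D(1)[OF Cl_CS] ndelta_AP by blast
  then show ?thesis by (simp add: Ncl_def)
qed

text \<open>Each of the \<open>card J\<close> facets \<open>C - {a}\<close> lies in exactly one
  further cluster. Different \<open>a\<close> give different neighbours, since a cluster containing
  two facets of \<open>C\<close> contains \<open>C\<close>.\<close>

lemma Cl_neighbours:
  assumes J: "J \<subseteq> I" "J \<noteq> {}" and C: "C \<in> Cl J"
  shows "card {D \<in> Cl J. C \<noteq> D \<and> card (C \<inter> D) = card J - 1} = card J"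
proof -
  let ?B = "\<lambda>a. {D \<in> Cl J. C \<noteq> D \<and> C - {a} \<subseteq> D}"
  have finC: "finite C" using finite_CS[OF J(1) Cl_CS[OF C]] .
  have cC: "card C = card J" using card_Cl_element[OF J(1) C] .
  have J0: "card J > 0" using J finite_parabolic by (simp add: card_gt_0_iff)
  have anti: "\<not> C \<subseteq> D" if "D \<in> Cl J" "C \<noteq> D" for D using Cl_antichain[OF C that(1)] that(2) by blast
  have eq: "{D \<in> Cl J. C \<noteq> D \<and> card (C \<inter> D) = card J - 1} = (\<Union>a\<in>C. ?B a)"
  proof (intro equalityI subsetI)
    fix D assume "D \<in> {D \<in> Cl J. C \<noteq> D \<and> card (C \<inter> D) = card J - 1}"
    then have D: "D \<in> Cl J" "C \<noteq> D" "card (C \<inter> D) = card J - 1" by auto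
    have "card (C - D) = 1" using card_Diff_subset_Int[of C D] finC D(3) cC J0 by simp
    then obtain a where a: "C - D = {a}" by (auto simp: card_1_singleton_iff)
    then show "D \<in> (\<Union>a\<in>C. ?B a)" using D by blast
  next
    fix D assume "D \<in> (\<Union>a\<in>C. ?B a)"
    then obtain a where D: "a \<in> C" "D \<in> Cl J" "C \<noteq> D" "C - {a} \<subseteq> D" by blast
    then have "C \<inter> D = C - {a}" using anti[OF D(2,3)] by blast
    then show "D \<in> {D \<in> Cl J. C \<noteq> D \<and> card (C \<inter> D) = card J - 1}" using D finC cC by simp
  qed
  have one: "card (?B a) = 1" if a: "a \<in> C" for a
  proof -
    have "card {D \<in> Cl J. C - {a} \<subseteq> D} = 2"
      by (rule card_Cl_containing_facet[OF J(1) CS_subset[OF Cl_CS[OF C]]]) (use a finC cC J0 in auto)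
    moreover have "{D \<in> Cl J. C - {a} \<subseteq> D} = insert C (?B a)" "C \<notin> ?B a" using C by auto
    ultimately show ?thesis using finite_Cl[OF J(1)] by simp
  qed
  have "card (\<Union>a\<in>C. ?B a) = (\<Sum>a\<in>C. card (?B a))"
  proof (rule card_UN_disjoint[OF finC])
    show "\<forall>a\<in>C. finite (?B a)" using finite_Cl[OF J(1)] by simp
    show "\<forall>a\<in>C. \<forall>b\<in>C. a \<noteq> b \<longrightarrow> ?B a \<inter> ?B b = {}"
    proof (intro ballI impI)
      fix a b assume "a \<in> C" "b \<in> C" "a \<noteq> b"
      then show "?B a \<inter> ?B b = {}" using anti by blast
    qed
  qed
  then show ?thesis unfolding eq using one cC by simp
qed

text \<open>Ordered pairs of a positive cluster \<open>C\<close> and a neighbour \<open>D\<close>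
  are counted. Pairs with \<open>D\<close> positive count every edge twice. If \<open>D\<close>
  contains \<open>ndelta i\<close>, then \<open>C \<inter> D\<close> is all of \<open>D\<close> but
  this root, so the rest of \<open>D\<close> is a positive cluster of \<open>J - {i}\<close>; the
  pairs of this kind correspond to such \<open>i\<close> and positive clusters of
  \<open>J - {i}\<close>.\<close>

lemma card_pos_edges:
  assumes J: "J \<subseteq> I" "J \<noteq> {}"
  shows "card J * card (PCl J) = 2 * card (pos_edges J) + (\<Sum>i\<in>J. card (PCl (J - {i})))"
proof -
  let ?adj = "\<lambda>C D. C \<noteq> D \<and> card (C \<inter> D) = card J - 1"
  define A where "A = (SIGMA C:PCl J. {D \<in> Cl J. ?adj C D})"
  define A1 where "A1 = {z \<in> A. snd z \<in> PCl J}"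
  define A2 where "A2 = {z \<in> A. snd z \<notin> PCl J}"
  have finJ: "finite J" using finite_parabolic[OF J(1)] .
  have J0: "card J > 0" using J finJ by (simp add: card_gt_0_iff)
  have PClCl: "PCl J \<subseteq> Cl J" for J by (auto simp: PCl_def)
  have finP: "finite (PCl J)" using finite_subset[OF PClCl finite_Cl[OF J(1)]] .
  have finA: "finite A" unfolding A_def using finP finite_Cl[OF J(1)] by simp
  have "card A = (\<Sum>C\<in>PCl J. card {D \<in> Cl J. ?adj C D})"
    unfolding A_def by (rule card_SigmaI) (use finP finite_Cl[OF J(1)] in auto)
  also have "\<dots> = card J * card (PCl J)"
    using Cl_neighbours[OF J] PClCl by (simp add: subset_iff)
  finally have cA: "card A = card J * card (PCl J)" .
  have "A = A1 \<union> A2" "A1 \<inter> A2 = {}" by (auto simp: A1_def A2_def)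
  then have cA12: "card A = card A1 + card A2"
    using finA card_Un_disjoint[of A1 A2] by (simp add: A1_def A2_def)
  have "(\<lambda>(C, D). {C, D}) ` A1 = pos_edges J"
  proof (intro equalityI subsetI)
    fix e assume "e \<in> (\<lambda>(C, D). {C, D}) ` A1"
    then obtain C D where "e = {C, D}" "(C, D) \<in> A1" by auto
    then show "e \<in> pos_edges J" unfolding pos_edges_def A1_def A_def by auto
  next
    fix e assume "e \<in> pos_edges J"
    then obtain C D where e: "e = {C, D}" "C \<in> PCl J" "D \<in> PCl J" "?adj C D"
      unfolding pos_edges_def by blast
    then have "(C, D) \<in> A1" using PClCl[of J] by (auto simp: A1_def A_def)
    then show "e \<in> (\<lambda>(C, D). {C, D}) ` A1" using e(1) by (intro image_eqI[of _ _ "(C, D)"]) auto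
  qed
  moreover have "sym A1" "irrefl A1"
    unfolding A1_def A_def sym_def irrefl_def using PClCl[of J] by (auto simp: Int_commute)
  moreover have "finite A1" using finA by (simp add: A1_def)
  ultimately have cA1: "card A1 = 2 * card (pos_edges J)" using card_ordered_pairs[of A1] by simp
  let ?N = "\<lambda>i. insert (ndelta i) ` PCl (J - {i})"
  have A2D: "\<exists>i\<in>J. D \<in> ?N i \<and> C \<inter> D = D - {ndelta i} \<and> ndelta i \<in> D" if "(C, D) \<in> A2" for C D
  proof -
    have CD: "C \<in> PCl J" "D \<in> Cl J" "D \<notin> PCl J" "card (C \<inter> D) = card J - 1"
      using that by (auto simp: A2_def A_def)
    obtain i where i: "i \<in> J" "ndelta i \<in> D" using CD(2,3) PCl_I[of D J] by blast
    have finD: "finite D" using finite_CS[OF J(1) Cl_CS[OF CD(2)]] .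
    have "C \<inter> D \<subseteq> D - {ndelta i}" using PCl_D(2)[OF CD(1) i(1)] by blast
    moreover have "card (D - {ndelta i}) = card J - 1"
      using i card_Cl_element[OF J(1) CD(2)] by simp
    ultimately have e: "C \<inter> D = D - {ndelta i}"
      using CD(4) finD by (intro card_subset_eq) auto
    have "D - {ndelta i} \<in> Cl (J - {i})"
      using Cl_link[OF J(1) i(1), of "D - {ndelta i}"] CD(2) i(2) by (simp add: insert_absorb)
    moreover have "ndelta k \<notin> D - {ndelta i}" if "k \<in> J - {i}" for k
      using e PCl_D(2)[OF CD(1), of k] that by blast
    ultimately have "D - {ndelta i} \<in> PCl (J - {i})" by (rule PCl_I)
    then have "D \<in> ?N i" using i(2) by (intro image_eqI[of _ _ "D - {ndelta i}"]) auto
    then show ?thesis using i e by blast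
  qed
  \<comment> \<open>\<open>D\<close> determines \<open>C\<close>: its only negative simple root
    singles out the common facet, and that facet lies in just two clusters, one of which is
    \<open>D\<close>.\<close>
  have inj: "inj_on snd A2"
  proof (rule inj_onI)
    fix z w assume zw: "z \<in> A2" "w \<in> A2" "snd z = snd w"
    obtain C C' D where eq: "z = (C, D)" "w = (C', D)" using zw(3) by (cases z, cases w) auto
    have CD: "C \<in> Cl J" "C' \<in> Cl J" "D \<in> Cl J" "C \<noteq> D" "C' \<noteq> D"
      using zw(1,2) PClCl[of J] unfolding eq by (auto simp: A2_def A_def)
    obtain i where i: "i \<in> J" "ndelta i \<in> D" "C \<inter> D = D - {ndelta i}"
      using A2D[OF zw(1)[unfolded eq]] by blast
    obtain i' where i': "i' \<in> J" "ndelta i' \<in> D" "C' \<inter> D = D - {ndelta i'}"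
      using A2D[OF zw(2)[unfolded eq]] by blast
    have "i' = i"
    proof (rule ccontr)
      assume "i' \<noteq> i"
      then have "ndelta i' \<in> D - {ndelta i}" using i'(2) by simp
      then have "ndelta i' \<in> C" unfolding i(3)[symmetric] by simp
      moreover have "C \<in> PCl J" using zw(1) eq by (auto simp: A2_def A_def)
      ultimately show False using PCl_D(2) i'(1) by blast
    qed
    define F where "F = D - {ndelta i}"
    have F: "F \<subseteq> C" "F \<subseteq> C'" "F \<subseteq> D" using i i' \<open>i' = i\<close> by (auto simp: F_def)
    have "card {E \<in> Cl J. F \<subseteq> E} = 2"
      by (rule card_Cl_containing_facet[OF J(1) CS_subset[OF Cl_CS[OF CD(3)] F(3)]])
        (use i card_Cl_element[OF J(1) CD(3)] J0 in \<open>simp add: F_def\<close>)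
    then obtain X Y where XY: "{E \<in> Cl J. F \<subseteq> E} = {X, Y}" by (metis card_2_iff)
    have "C \<in> {X, Y}" "C' \<in> {X, Y}" "D \<in> {X, Y}" using CD F unfolding XY[symmetric] by auto
    then have "C = C'" using CD by auto
    then show "z = w" using eq by simp
  qed
  have im: "snd ` A2 = (\<Union>i\<in>J. ?N i)"
  proof
    show "snd ` A2 \<subseteq> (\<Union>i\<in>J. ?N i)" using A2D by fastforce
    show "(\<Union>i\<in>J. ?N i) \<subseteq> snd ` A2"
    proof
      fix D assume "D \<in> (\<Union>i\<in>J. ?N i)"
      then obtain i F where i: "i \<in> J" and F: "F \<in> PCl (J - {i})" and D: "D = insert (ndelta i) F" by blast
      have FCl: "F \<in> Cl (J - {i})" using F PClCl by blast
      have nF: "ndelta i \<notin> F" using ndelta_notin_Cl_remove[OF Cl_CS[OF FCl]] .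
      have DCl: "D \<in> Cl J" using Cl_link[OF J(1) i nF] FCl D by simp
      have FCS: "F \<in> CS J" using CS_subset[OF Cl_CS[OF DCl]] D by blast
      have finF: "finite F" using finite_CS[OF J(1) FCS] .
      have cF: "card F + 1 = card J" using card_Cl_element[OF J(1) DCl] nF finF D by simp
      define T where "T = {E \<in> Cl J. F \<subseteq> E}"
      have "card T = 2" unfolding T_def by (rule card_Cl_containing_facet[OF J(1) FCS cF])
      moreover have "D \<in> T" using DCl D by (auto simp: T_def)
      ultimately have "card (T - {D}) = 1" by simp
      then have "T - {D} \<noteq> {}" by (metis card.empty zero_neq_one)
      then obtain C where C: "C \<in> Cl J" "F \<subseteq> C" "C \<noteq> D" by (auto simp: T_def)
      have niC: "ndelta i \<notin> C"
      proof
        assume "ndelta i \<in> C"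
        then have "D \<subseteq> C" using C D by blast
        then show False using Cl_antichain[OF DCl C(1)] C(3) by blast
      qed
      have "ndelta j \<notin> C" if j: "j \<in> J" for j
      proof
        assume jC: "ndelta j \<in> C"
        then have ji: "j \<noteq> i" using niC by blast
        \<comment> \<open>A second negative simple root in \<open>C\<close> would be compatible with
          all of \<open>F\<close> and hence belong to it, because \<open>F\<close> is a maximal
          compatible set for \<open>J - {i}\<close>. But \<open>F\<close> is positive.\<close>
        have "ndelta j \<in> F"
        proof (rule Cl_maximal[OF FCl])
          show "ndelta j \<in> AP (J - {i})" using j ji by simp
          fix y assume "y \<in> F" "y \<noteq> ndelta j"
          then show "comp (ndelta j) y" using jC C(2) CS_D(2)[OF Cl_CS[OF C(1)]] by blast
        qed
        then show False using PCl_D(2)[OF F, of j] j ji by blast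
      qed
      then have CP: "C \<in> PCl J" by (rule PCl_I[OF C(1)])
      have "C \<inter> D = F" using niC C(2) D by blast
      then have "(C, D) \<in> A" using CP DCl C(3) cF by (auto simp: A_def)
      moreover have "D \<notin> PCl J" using D PCl_D(2)[OF _ i, of D] by blast
      ultimately have "(C, D) \<in> A2" by (simp add: A2_def)
      then show "D \<in> snd ` A2" by force
    qed
  qed
  have disj: "?N i \<inter> ?N j = {}" if "i \<in> J" "j \<in> J" "i \<noteq> j" for i j
  proof (rule ccontr)
    assume "?N i \<inter> ?N j \<noteq> {}"
    then obtain F G where "F \<in> PCl (J - {i})" "G \<in> PCl (J - {j})" "insert (ndelta i) F = insert (ndelta j) G"
      by blast
    moreover from this have "ndelta j \<in> F" using that(3) by (metis insertE insertI1 ndelta_eq_iff)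
    ultimately show False using that PCl_D(2)[of F "J - {i}" j] by blast
  qed
  have "card A2 = card (\<Union>i\<in>J. ?N i)" using card_image[OF inj] im by simp
  also have "\<dots> = (\<Sum>i\<in>J. card (?N i))"
  proof (rule card_UN_disjoint[OF finJ])
    have "finite (PCl (J - {i}))" for i
      by (rule finite_subset[OF PClCl finite_Cl]) (use J in blast)
    then show "\<forall>i\<in>J. finite (?N i)" by blast
    show "\<forall>i\<in>J. \<forall>j\<in>J. i \<noteq> j \<longrightarrow> ?N i \<inter> ?N j = {}" using disj by blast
  qed
  also have "\<dots> = (\<Sum>i\<in>J. card (PCl (J - {i})))"
  proof (rule sum.cong)
    fix i assume i: "i \<in> J"
    show "card (?N i) = card (PCl (J - {i}))"
      by (rule card_image, rule inj_on_subset[OF bij_betw_imp_inj_on[OF Cl_link_bij[OF J(1) i]] PClCl])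
  qed simp
  finally show ?thesis using cA cA12 cA1 by simp
qed

end

section \<open>Coxeter numbers of types A and D\<close>

definition path_adj :: "nat \<Rightarrow> nat \<Rightarrow> bool" where
  "path_adj i j \<longleftrightarrow> j = Suc i \<or> i = Suc j"

text \<open>The diagram of type \<open>D\<close> with the two end nodes \<open>0\<close>, \<open>1\<close> of the fork attached to \<open>2\<close>, so
  that the nodes below \<open>n\<close> form the diagram of type \<open>D\<^sub>n\<close> for all \<open>n\<close>.\<close>

definition fork_adj :: "nat \<Rightarrow> nat \<Rightarrow> bool" where
  "fork_adj i j \<longleftrightarrow> (i = 0 \<and> j = 2) \<or> (i = 2 \<and> j = 0) \<or> (1 \<le> i \<and> j = Suc i) \<or> (1 \<le> j \<and> i = Suc j)"

lemma path_nb_sum: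
  fixes f :: "nat \<Rightarrow> int"
  assumes "k < n"
  shows "(\<Sum>j | j < n \<and> path_adj k j. f j) = (if 0 < k then f (k - 1) else 0) + (if Suc k < n then f (Suc k) else 0)"
proof -
  have "{j. j < n \<and> path_adj k j} = (if 0 < k then {k - 1} else {}) \<union> (if Suc k < n then {Suc k} else {})"
    using assms by (auto simp: path_adj_def)
  then show ?thesis by auto
qed

lemma fork_nb_sum:
  fixes f :: "nat \<Rightarrow> int"
  assumes "k < n" "3 \<le> n"
  shows "(\<Sum>j | j < n \<and> fork_adj k j. f j) =
     (if k \<le> 1 then f 2 else (if k = 2 then f 0 else 0) + f (k - 1) + (if Suc k < n then f (Suc k) else 0))"
proof -
  have "{j. j < n \<and> fork_adj k j} = (if k \<le> 1 then {2} else
      (if k = 2 then {0} else {}) \<union> {k - 1} \<union> (if Suc k < n then {Suc k} else {}))"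
    using assms by (auto simp: fork_adj_def)
  then show ?thesis by auto
qed

context simply_laced begin

section \<open>Vectors along a numbering of the nodes\<close>

definition numbering :: "(nat \<Rightarrow> nat \<Rightarrow> bool) \<Rightarrow> (nat \<Rightarrow> 'i) \<Rightarrow> nat \<Rightarrow> 'i set \<Rightarrow> bool" where
  "numbering adj g n J \<longleftrightarrow> inj_on g {..<n} \<and> J = g ` {..<n} \<and> J \<subseteq> I \<and>
     (\<forall>i<n. \<forall>j<n. g j \<in> nb (g i) \<longleftrightarrow> adj i j)"

lemma numberingD:
  assumes "numbering adj g n J"
  shows "inj_on g {..<n}" "J = g ` {..<n}" "J \<subseteq> I" "i < n \<Longrightarrow> g i \<in> J" "i < n \<Longrightarrow> g i \<in> I"
    "i < n \<Longrightarrow> j < n \<Longrightarrow> g j \<in> nb (g i) \<longleftrightarrow> adj i j" "i < n \<Longrightarrow> j < n \<Longrightarrow> g i = g j \<longleftrightarrow> i = j" "card J = n"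
  using assms by (auto simp: numbering_def inj_on_eq_iff card_image)

lemma numbering_nb_sum:
  assumes "numbering adj g n J" "supp_in J x" "k < n"
  shows "(\<Sum>j\<in>nb (g k). x j) = (\<Sum>j | j < n \<and> adj k j. x (g j))"
proof -
  note N = numberingD[OF assms(1)]
  have "(\<Sum>j\<in>nb (g k). x j) = (\<Sum>j\<in>nb (g k) \<inter> J. x j)"
    by (rule sum.mono_neutral_right) (use assms(2) finite_nb in \<open>auto simp: supp_in_def\<close>)
  also have "nb (g k) \<inter> J = g ` {j. j < n \<and> adj k j}"
    using N(2) N(6)[OF assms(3)] by auto
  also have "(\<Sum>j\<in>\<dots>. x j) = (\<Sum>j | j < n \<and> adj k j. x (g j))"
    by (subst sum.reindex) (auto intro: inj_on_subset[OF N(1)])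
  finally show ?thesis .
qed

definition vec :: "(nat \<Rightarrow> 'i) \<Rightarrow> nat \<Rightarrow> (nat \<Rightarrow> int) \<Rightarrow> 'i \<Rightarrow> int" where
  "vec g n f = (\<lambda>i. if i \<in> g ` {..<n} then f (inv_into {..<n} g i) else 0)"

lemma vec_apply: "numbering adj g n J \<Longrightarrow> k < n \<Longrightarrow> vec g n f (g k) = f k"
  by (simp add: vec_def numberingD(1))

lemma supp_in_vec: "numbering adj g n J \<Longrightarrow> supp_in J (vec g n f)"
  by (auto simp: vec_def supp_in_def dest: numberingD(2))

lemma vec_eqI:
  assumes "numbering adj g n J" "supp_in J x" "\<And>k. k < n \<Longrightarrow> x (g k) = f k"
  shows "x = vec g n f"
proof
  fix i
  show "x i = vec g n f i"
    using assms(2,3) vec_apply[OF assms(1)] numberingD(2)[OF assms(1)] supp_in_vec[OF assms(1), of f]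
    by (cases "i \<in> J") (auto simp: supp_in_def)
qed

lemma nonneg_vec: "(\<And>k. k < n \<Longrightarrow> 0 \<le> f k) \<Longrightarrow> nonneg (vec g n f)"
  unfolding nonneg_def vec_def using inv_into_into[of _ g "{..<n}"] by auto

lemma vec_eqD: "numbering adj g n J \<Longrightarrow> vec g n f = vec g n f' \<Longrightarrow> k < n \<Longrightarrow> f k = f' k"
  by (metis vec_apply)

lemma delta_vec:
  assumes N: "numbering adj g n J" and k: "k < n"
  shows "delta (g k) = vec g n (\<lambda>j. if j = k then 1 else 0)"
proof (rule vec_eqI[OF N])
  show "supp_in J (delta (g k))" using numberingD(4)[OF N k] by simp
  fix j assume "j < n"
  then show "delta (g k) (g j) = (if j = k then 1 else 0)"
    using numberingD(7)[OF N _ k] by (simp add: delta_def)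
qed

lemma vec_reflection_R:
  assumes N: "numbering adj g n J" and f: "vec g n f \<in> R" and k: "k < n"
    and eq: "\<And>j. j < n \<Longrightarrow> j \<noteq> k \<Longrightarrow> f' j = f j"
    and fk: "f' k = (\<Sum>j | j < n \<and> adj k j. f j) - f k"
  shows "vec g n f' \<in> R"
proof -
  let ?x = "vec g n f"
  have s: "(\<Sum>j | j < n \<and> adj k j. ?x (g j)) = (\<Sum>j | j < n \<and> adj k j. f j)"
    by (rule sum.cong) (auto simp: vec_apply[OF N])
  have "?x(g k := (\<Sum>j\<in>nb (g k). ?x j) - ?x (g k)) = vec g n f'"
  proof (rule vec_eqI[OF N])
    show "supp_in J (?x(g k := (\<Sum>j\<in>nb (g k). ?x j) - ?x (g k)))"
      using supp_in_vec[OF N, of f] numberingD(4)[OF N k] by (auto simp: supp_in_def)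
    fix j assume j: "j < n"
    show "(?x(g k := (\<Sum>j\<in>nb (g k). ?x j) - ?x (g k))) (g j) = f' j"
      using eq[OF j] fk numberingD(7)[OF N j k] numbering_nb_sum[OF N supp_in_vec[OF N, of f] k] s
        vec_apply[OF N j, of f] vec_apply[OF N k, of f] by auto
  qed
  then show ?thesis using refl_R1[OF numberingD(5)[OF N k] f] by simp
qed

lemma vec_PR: "numbering adj g n J \<Longrightarrow> vec g n f \<in> R \<Longrightarrow> (\<And>k. k < n \<Longrightarrow> 0 \<le> f k) \<Longrightarrow> vec g n f \<in> PR J"
  using supp_in_vec nonneg_vec by (auto simp: PR_def)

lemma alt_refl_supp: "supp_in J x \<Longrightarrow> supp_in J (alt_refl Q J t x)"
  by (induction t) (auto intro: supp_in_refl)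

lemma alt_refl_step:
  assumes N: "numbering adj g n J" and x: "supp_in J x" and k: "k < n"
  shows "alt_refl Q J (Suc t) x (g k) =
    (if g k \<in> alternate Q t then (\<Sum>j | j < n \<and> adj k j. alt_refl Q J t x (g j)) - alt_refl Q J t x (g k)
     else alt_refl Q J t x (g k))"
  using numbering_nb_sum[OF N alt_refl_supp[OF x] k, of Q t] numberingD(4)[OF N k]
  by (simp add: srefl_def)

section \<open>The longest element and the roots of a path\<close>

lemma path_side:
  assumes N: "numbering path_adj g n J" and Q: "side Q" and k: "k < n"
  shows "g k \<in> Q \<longleftrightarrow> (even k \<longleftrightarrow> g 0 \<in> Q)"
  using k
proof (induction k)
  case (Suc k)
  then have "g (Suc k) \<in> nb (g k)" using numberingD(6)[OF N, of k "Suc k"] by (simp add: path_adj_def)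
  then show ?case using Suc side_nb[OF Q] by auto
qed simp

lemma path_alternate:
  assumes N: "numbering path_adj g n J" and Q: "side Q" and k: "k < n"
  shows "g k \<in> alternate Q t \<longleftrightarrow> even (int k + int t + (if g 0 \<in> Q then 0 else 1))"
  using path_side[OF N Q k] by (auto simp: alternate_def)

text \<open>Padding the coefficients with a zero at each end turns the neighbour sum into
  \<open>X (z - 1) + X (z + 1)\<close> everywhere, so the motion of the differences applies. The
  result is minus the reversal of the path, which is the longest element in type A.\<close>

lemma path_longest_element:
  assumes N: "numbering path_adj g n J" and Q: "side Q" and x: "supp_in J x" and k: "k < n"
  shows "alt_refl Q J (Suc n) x (g k) = - x (g (n - 1 - k))"
proof -
  define X where "X t z = (if 0 \<le> z \<and> z < int n then alt_refl Q J t x (g (nat z)) else 0)" for t z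
  have "X (Suc n) (int k) = - X 0 (int n - 1 - int k)"
  proof (rule alternating_path_reflections)
    fix t and z :: int assume z: "0 \<le> z" "z < int n"
    define m where "m = nat z"
    have m: "z = int m" "m < n" using z by (auto simp: m_def)
    have Xm: "X t (int j) = alt_refl Q J t x (g j)" if "j < n" for t j using that by (simp add: X_def)
    have "(\<Sum>j | j < n \<and> path_adj m j. alt_refl Q J t x (g j)) = X t (z - 1) + X t (z + 1)"
      unfolding path_nb_sum[OF m(2)] using m by (auto simp: X_def nat_diff_distrib nat_add_distrib)
    then show "X (Suc t) z = (if even (z + int t + (if g 0 \<in> Q then 0 else 1))
        then X t (z - 1) + X t (z + 1) - X t z else X t z)"
      using alt_refl_step[OF N x m(2), of Q t] path_alternate[OF N Q m(2), of t] Xm[OF m(2)] m(1)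
      by simp
  qed (use k in \<open>auto simp: X_def\<close>)
  moreover have "nat (int n - 1 - int k) = n - 1 - k" using k by simp
  ultimately show ?thesis using k by (simp add: X_def del: alt_refl.simps(2))
qed

lemma path_root:
  assumes N: "numbering path_adj g n J" and "a \<le> b" "b < n"
  shows "vec g n (\<lambda>j. if a \<le> j \<and> j \<le> b then 1 else 0) \<in> PR J"
proof (rule vec_PR[OF N])
  show "vec g n (\<lambda>j. if a \<le> j \<and> j \<le> b then 1 else 0) \<in> R"
    using assms(2,3)
  proof (induction b rule: dec_induct)
    case base
    have "(\<lambda>j. if a \<le> j \<and> j \<le> a then 1 else (0::int)) = (\<lambda>j. if j = a then 1 else 0)" by auto
    then show ?case using delta_vec[OF N, of a] simple_R[OF numberingD(5)[OF N, of a]] base by simp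
  next
    case (step b)
    show ?case
    proof (rule vec_reflection_R[OF N step.IH step.prems])
      show "(if a \<le> Suc b \<and> Suc b \<le> Suc b then 1 else 0) =
        (\<Sum>j | j < n \<and> path_adj (Suc b) j. if a \<le> j \<and> j \<le> b then 1 else 0) - (if a \<le> Suc b \<and> Suc b \<le> b then 1 else (0::int))"
        unfolding path_nb_sum[OF step.prems] using step by simp
    qed (use step in auto)
  qed
qed auto

lemma sum_Suc_gauss: "2 * (\<Sum>b<n. Suc b) = Suc n * n"
  by (induction n) auto

text \<open>The intervals of the path give \<open>n * (n + 1) / 2\<close> distinct positive roots.
  For the second property, a positive coefficient reappears negated at the mirror node.\<close>

lemma path_coxeter_number:
  assumes N: "numbering path_adj g n J"
  shows "coxeter_number J (Suc n)"
  unfolding coxeter_number_def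
proof safe
  let ?S = "SIGMA b:{..<n}. {..b}"
  let ?f = "\<lambda>(b, a). vec g n (\<lambda>j. if a \<le> j \<and> j \<le> b then 1 else 0)"
  have "inj_on ?f ?S"
  proof (rule inj_onI)
    fix z w assume zw: "z \<in> ?S" "w \<in> ?S" "?f z = ?f w"
    obtain b a d c where eq: "z = (b, a)" "w = (d, c)" by (cases z, cases w) auto
    have *: "b \<in> {..<n}" "a \<in> {..b}" "d \<in> {..<n}" "c \<in> {..d}"
      "vec g n (\<lambda>j. if a \<le> j \<and> j \<le> b then 1 else 0) = vec g n (\<lambda>j. if c \<le> j \<and> j \<le> d then 1 else 0)"
      using zw by (auto simp: eq)
    have e: "(a \<le> j \<and> j \<le> b) = (c \<le> j \<and> j \<le> d)" if "j < n" for j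
      using vec_eqD[OF N *(5) that] by (auto split: if_splits)
    show "z = w" unfolding eq using e[of a] e[of b] e[of c] e[of d] *(1-4) by auto
  qed
  then have "card ?S = card (?f ` ?S)" by (simp add: card_image)
  also have "\<dots> \<le> card (PR J)"
    by (rule card_mono[OF finite_PR]) (use path_root[OF N] in auto)
  finally have "(\<Sum>b<n. Suc b) \<le> card (PR J)" by simp
  then have "2 * (\<Sum>b<n. Suc b) \<le> 2 * card (PR J)" by (rule mult_le_mono2)
  then show "Suc n * card J \<le> 2 * card (PR J)" unfolding sum_Suc_gauss numberingD(8)[OF N] .
next
  fix Q x assume Q: "side Q" and x: "x \<in> PR J" and nn: "nonneg (alt_refl Q J (Suc n) x)"
  obtain m where m: "m < n" "x (g m) > 0" using PR_neq_zero[OF x] numberingD(2)[OF N] by auto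
  have "alt_refl Q J (Suc n) x (g (n - 1 - m)) = - x (g m)"
    using path_longest_element[OF N Q PR_D(2)[OF x], of "n - 1 - m"] m by simp
  moreover have "0 \<le> alt_refl Q J (Suc n) x (g (n - 1 - m))" using nn unfolding nonneg_def by blast
  ultimately show False using m by simp
qed

section \<open>The longest element and the roots of a fork\<close>

lemma fork_side:
  assumes N: "numbering fork_adj g n J" and Q: "side Q" and n: "3 \<le> n"
  shows "g 0 \<in> Q \<longleftrightarrow> g 1 \<in> Q" "1 \<le> k \<Longrightarrow> k < n \<Longrightarrow> g k \<in> Q \<longleftrightarrow> (odd k \<longleftrightarrow> g 1 \<in> Q)"
proof -
  have "g 2 \<in> nb (g 0)" "g 2 \<in> nb (g 1)"
    using numberingD(6)[OF N, of 0 2] numberingD(6)[OF N, of 1 2] n by (auto simp: fork_adj_def)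
  then show "g 0 \<in> Q \<longleftrightarrow> g 1 \<in> Q" using side_nb[OF Q] by blast
  show "g k \<in> Q \<longleftrightarrow> (odd k \<longleftrightarrow> g 1 \<in> Q)" if "1 \<le> k" "k < n"
    using that
  proof (induction k rule: dec_induct)
    case (step k)
    then have "g (Suc k) \<in> nb (g k)" using numberingD(6)[OF N, of k "Suc k"] by (simp add: fork_adj_def)
    then show ?case using step side_nb[OF Q] by auto
  qed simp
qed

text \<open>Type \<open>D\<^sub>n\<close> is folded from the path with \<open>2 n - 3\<close> nodes: the middle node carries the sum of
  the coefficients at the two end nodes of the fork.\<close>

lemma fork_longest_element:
  assumes N: "numbering fork_adj g n J" and Q: "side Q" and n: "3 \<le> n" and x: "supp_in J x"
  defines "y \<equiv> alt_refl Q J (2 * (n - 1)) x"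
  shows "y (g 0) + y (g 1) = - (x (g 0) + x (g 1))" "2 \<le> k \<Longrightarrow> k < n \<Longrightarrow> y (g k) = - x (g k)"
proof -
  \<comment> \<open>A node \<open>k \<ge> 2\<close> is placed at both positions at distance
    \<open>k - 1\<close> from the centre \<open>n - 2\<close>. With the sum of the fork ends at the
    centre, the reflection there becomes \<open>2 * x2 - (x0 + x1)\<close>, writing
    \<open>x0\<close>, \<open>x1\<close>, \<open>x2\<close> for the coefficients at the nodes 0, 1,
    2; this is the rule of the path.\<close>
  define X where "X t z = (if 0 \<le> z \<and> z < int (2 * n - 3) then
      (if z = int (n - 2) then alt_refl Q J t x (g 0) + alt_refl Q J t x (g 1)
       else alt_refl Q J t x (g (1 + nat \<bar>z - int (n - 2)\<bar>))) else 0)" for t z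
  \<comment> \<open>Chosen so that the centre, where the fork ends sit, is reflected at even times
    exactly if these ends lie in \<open>Q\<close>.\<close>
  define p where "p = (if g 1 \<in> Q then int n else int n + 1)"
  have alt: "g k \<in> alternate Q t \<longleftrightarrow> even (int (n - 2) + int (k - 1) + int t + p)" if "1 \<le> k" "k < n" for k t
    using fork_side(2)[OF N Q n that] that n by (auto simp: alternate_def p_def)
  have alt0: "g 0 \<in> alternate Q t \<longleftrightarrow> even (int (n - 2) + int t + p)" for t
    using fork_side(1)[OF N Q n] n by (auto simp: alternate_def p_def)
  have main: "X (Suc (2 * n - 3)) z = - X 0 (int (2 * n - 3) - 1 - z)" if "0 \<le> z" "z < int (2 * n - 3)" for z
  proof (rule alternating_path_reflections[OF _ _ _ that])
    fix t and z :: int assume z: "0 \<le> z" "z < int (2 * n - 3)"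
    let ?y = "alt_refl Q J t x"
    show "X (Suc t) z = (if even (z + int t + p) then X t (z - 1) + X t (z + 1) - X t z else X t z)"
    proof (cases "z = int (n - 2)")
      case True
      have "X t (z - 1) = ?y (g 2)" "X t (z + 1) = ?y (g 2)"
        using n True by (auto simp: X_def numeral_2_eq_2)
      moreover have "X (Suc t) z = alt_refl Q J (Suc t) x (g 0) + alt_refl Q J (Suc t) x (g 1)"
        using z True by (simp add: X_def del: alt_refl.simps(2))
      ultimately show ?thesis
        using alt_refl_step[OF N x, of 0 Q t] alt_refl_step[OF N x, of 1 Q t] n
          alt0[of t] alt[of 1 t] fork_nb_sum[of 0 n "\<lambda>j. ?y (g j)"] fork_nb_sum[of 1 n "\<lambda>j. ?y (g j)"] True z
        by (simp add: X_def del: alt_refl.simps(2))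
    next
      case False
      define m where "m = 1 + nat \<bar>z - int (n - 2)\<bar>"
      have m: "2 \<le> m" "m < n" using z False n by (auto simp: m_def)
      have Xz: "X t z = alt_refl Q J t x (g m)" for t using z False by (simp add: X_def m_def)
      have par: "even (int (n - 2) + int (m - 1) + int t + p) \<longleftrightarrow> even (z + int t + p)"
        by (cases "z \<ge> int (n - 2)") (auto simp: m_def)
      \<comment> \<open>The sign \<open>s\<close> selects the half of the path. The node
        \<open>m\<close> is at distance \<open>m - 1\<close> from the centre, its inner and outer
        neighbours at distances \<open>m - 2\<close> and \<open>m\<close>.\<close>
      have lo: "X t (int (n - 2) + s * (int m - 2)) = (if m = 2 then ?y (g 0) else 0) + ?y (g (m - 1))"
        if "s = 1 \<or> s = - 1" for s :: int
      proof -
        have "Suc (m - 2) = m - Suc 0" using m by simp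
        then show ?thesis using that m n by (auto simp: X_def nat_diff_distrib)
      qed
      have hi: "X t (int (n - 2) + s * int m) = (if Suc m < n then ?y (g (Suc m)) else 0)"
        if "s = 1 \<or> s = - 1" for s :: int
        using that m n by (auto simp: X_def)
      have "X t (z - 1) + X t (z + 1) = (if m = 2 then ?y (g 0) else 0) + ?y (g (m - 1)) + (if Suc m < n then ?y (g (Suc m)) else 0)"
      proof (cases "z \<ge> int (n - 2)")
        case True
        then have "z - 1 = int (n - 2) + 1 * (int m - 2)" "z + 1 = int (n - 2) + 1 * int m" by (auto simp: m_def)
        then show ?thesis using lo[of 1] hi[of 1] by (simp only: simp_thms)
      next
        case False
        then have "z + 1 = int (n - 2) + (- 1) * (int m - 2)" "z - 1 = int (n - 2) + (- 1) * int m" by (auto simp: m_def)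
        then show ?thesis using lo[of "- 1"] hi[of "- 1"] by (simp only: simp_thms add.commute)
      qed
      then show ?thesis
        using alt_refl_step[OF N x m(2), of Q t] alt[of m t] par m n fork_nb_sum[of m n "\<lambda>j. ?y (g j)"] Xz
        by (simp del: alt_refl.simps(2))
    qed
  qed (auto simp: X_def)
  \<comment> \<open>The folded path has \<open>2 * n - 3\<close> nodes, so its number of factors is
    the Coxeter number of type D.\<close>
  have S: "Suc (2 * n - 3) = 2 * (n - 1)" using n by simp
  show "y (g 0) + y (g 1) = - (x (g 0) + x (g 1))"
    using main[of "int (n - 2)"] n unfolding S by (simp add: X_def y_def)
  show "y (g k) = - x (g k)" if "2 \<le> k" "k < n"
  proof -
    have "Suc (nat (int k - 1)) = k" using that by simp
    then show ?thesis
      using main[of "int (n - 2) + int (k - 1)"] n that unfolding S by (auto simp: X_def y_def)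
  qed
qed

text \<open>In the realisation \<open>\<alpha>\<^sub>0 = e\<^sub>0 + e\<^sub>1\<close>, \<open>\<alpha>\<^sub>i = e\<^sub>i - e\<^bsub>i-1\<^esub>\<close> these are the positive roots
  \<open>e\<^sub>b - e\<^sub>a\<close> and \<open>e\<^sub>b + e\<^sub>a\<close> for \<open>a < b\<close>.\<close>

definition fork_minus :: "nat \<Rightarrow> nat \<Rightarrow> nat \<Rightarrow> int" where
  "fork_minus a b j = (if a < j \<and> j \<le> b then 1 else 0)"

definition fork_plus :: "nat \<Rightarrow> nat \<Rightarrow> nat \<Rightarrow> int" where
  "fork_plus a b j = (if j = 0 then 1 else if j = 1 then (if a = 0 then 0 else 1)
     else (if j \<le> b then 1 else 0) + (if j \<le> a then 1 else 0))"

text \<open>Starting from the simple root with \<open>a = b - 1\<close>, the reflection at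
  \<open>Suc a\<close> exchanges the coordinates \<open>a\<close> and \<open>Suc a\<close>, which
  lowers the index of the subtracted unit vector by one.\<close>

lemma fork_minus_PR:
  assumes N: "numbering fork_adj g n J" and n: "3 \<le> n" and ab: "a < b" "b < n"
  shows "vec g n (fork_minus a b) \<in> PR J"
proof (rule vec_PR[OF N])
  have "a \<le> b - 1" using ab by simp
  then show "vec g n (fork_minus a b) \<in> R"
  proof (induction a rule: inc_induct)
    case base
    have "fork_minus (b - 1) b = (\<lambda>j. if j = b then 1 else 0)"
      using ab by (auto simp: fork_minus_def fun_eq_iff)
    then show ?case using delta_vec[OF N ab(2)] simple_R[OF numberingD(5)[OF N ab(2)]] by simp
  next
    case (step a)
    have k: "Suc a < n" using step ab by simp
    show ?case
    proof (rule vec_reflection_R[OF N step.IH k])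
      show "fork_minus a b (Suc a) = (\<Sum>j | j < n \<and> fork_adj (Suc a) j. fork_minus (Suc a) b j) - fork_minus (Suc a) b (Suc a)"
        unfolding fork_nb_sum[OF k n] using step ab by (auto simp: fork_minus_def)
    qed (use step in \<open>auto simp: fork_minus_def\<close>)
  qed
qed (simp add: fork_minus_def)

text \<open>The sign changes at node 0, whose reflection sends the unit vector 1 to minus the unit
  vector 0: the difference of the unit vectors \<open>b\<close> and 1 becomes the sum of those with
  indices \<open>b\<close> and 0. From there the reflections at \<open>Suc a\<close> raise the
  smaller index.\<close>

lemma fork_plus_PR:
  assumes N: "numbering fork_adj g n J" and n: "3 \<le> n" and ab: "a < b" "b < n"
  shows "vec g n (fork_plus a b) \<in> PR J"
proof (rule vec_PR[OF N])
  have zero: "vec g n (fork_plus 0 b) \<in> R" if b: "1 \<le> b" "b < n" for b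
  proof (cases "b = 1")
    case True
    have "fork_plus 0 1 = (\<lambda>j. if j = 0 then 1 else 0)" by (auto simp: fork_plus_def fun_eq_iff)
    then show ?thesis using delta_vec[OF N, of 0] simple_R[OF numberingD(5)[OF N, of 0]] True n by simp
  next
    case False
    have "vec g n (fork_minus 1 b) \<in> R" using fork_minus_PR[OF N n, of 1 b] b False PR_D(1) by auto
    then show ?thesis
    proof (rule vec_reflection_R[OF N])
      show "0 < n" using n by simp
      show "fork_plus 0 b 0 = (\<Sum>j | j < n \<and> fork_adj 0 j. fork_minus 1 b j) - fork_minus 1 b 0"
        using fork_nb_sum[of 0 n "fork_minus 1 b"] n b False by (simp add: fork_plus_def fork_minus_def)
    qed (auto simp: fork_plus_def fork_minus_def)
  qed
  show "vec g n (fork_plus a b) \<in> R" using ab(1)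
  proof (induction a)
    case 0
    then show ?case using zero[of b] ab by simp
  next
    case (Suc a)
    have k: "Suc a < n" using Suc ab by simp
    have "vec g n (fork_plus a b) \<in> R" using Suc by simp
    then show ?case
    proof (rule vec_reflection_R[OF N _ k])
      show "fork_plus (Suc a) b (Suc a) = (\<Sum>j | j < n \<and> fork_adj (Suc a) j. fork_plus a b j) - fork_plus a b (Suc a)"
        unfolding fork_nb_sum[OF k n] using Suc.prems ab by (auto simp: fork_plus_def)
    qed (auto simp: fork_plus_def)
  qed
qed (simp add: fork_plus_def)

lemma fork_plus_inject:
  assumes "a < b" "b < n" "c < d" "d < n" "3 \<le> n" "\<And>j. j < n \<Longrightarrow> fork_plus a b j = fork_plus c d j"
  shows "a = c \<and> b = d"
proof -
  have 1: "\<not> b < d" if "a < b" "b < n" "c < d" "d < n" "\<And>j. j < n \<Longrightarrow> fork_plus a b j = fork_plus c d j" for a b c d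
  proof
    assume "b < d"
    then show False using that(5)[of d] that(1-4) by (auto simp: fork_plus_def split: if_splits)
  qed
  have 2: "\<not> a < c" if "a < b" "c < b" "b < n" "\<And>j. j < n \<Longrightarrow> fork_plus a b j = fork_plus c b j" for a b c
  proof
    assume "a < c"
    then show False using that(4)[of c] that(1-3) by (auto simp: fork_plus_def split: if_splits)
  qed
  have "b = d" using 1[OF assms(1-4,6)] 1[OF assms(3,4,1,2) assms(6)[symmetric]] by simp
  then show ?thesis using 2[of a b c] 2[of c b a] assms by (metis linorder_neqE_nat)
qed

lemma fork_minus_inject:
  assumes "a < b" "b < n" "c < d" "d < n" "\<And>j. j < n \<Longrightarrow> fork_minus a b j = fork_minus c d j"
  shows "a = c \<and> b = d"
  using assms(1-4) assms(5)[of b] assms(5)[of d] assms(5)[of "Suc a"] assms(5)[of "Suc c"]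
  by (auto simp: fork_minus_def split: if_splits)

text \<open>The two families give \<open>n * (n - 1)\<close> positive roots. Depending on the parity
  of \<open>n\<close> the longest element may exchange the fork ends, so only the sum of their
  coefficients is followed; for nonnegative coefficients a positive sum that turns negative is
  contradiction enough.\<close>

lemma fork_coxeter_number:
  assumes N: "numbering fork_adj g n J" and n: "3 \<le> n"
  shows "coxeter_number J (2 * (n - 1))"
  unfolding coxeter_number_def
proof safe
  let ?S = "SIGMA b:{..<n}. {..<b}"
  let ?p = "\<lambda>(b, a). vec g n (fork_plus a b)"
  let ?m = "\<lambda>(b, a). vec g n (fork_minus a b)"
  have "inj_on ?p ?S"
    by (rule inj_onI, clarify) (use fork_plus_inject n vec_eqD[OF N] in \<open>metis (no_types, lifting) lessThan_iff\<close>)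
  then have p: "card (?p ` ?S) = card ?S" by (rule card_image)
  have "inj_on ?m ?S"
    by (rule inj_onI, clarify) (use fork_minus_inject vec_eqD[OF N] in \<open>metis (no_types, lifting) lessThan_iff\<close>)
  then have m: "card (?m ` ?S) = card ?S" by (rule card_image)
  have disj: "?p ` ?S \<inter> ?m ` ?S = {}"
  proof -
    have "vec g n (fork_plus a b) \<noteq> vec g n (fork_minus c d)" for a b c d
    proof
      assume "vec g n (fork_plus a b) = vec g n (fork_minus c d)"
      from vec_eqD[OF N this, of 0] show False using n by (simp add: fork_plus_def fork_minus_def)
    qed
    then show ?thesis by auto
  qed
  have "?p ` ?S \<union> ?m ` ?S \<subseteq> PR J" using fork_plus_PR[OF N n] fork_minus_PR[OF N n] by auto
  then have "card (?p ` ?S \<union> ?m ` ?S) \<le> card (PR J)" by (rule card_mono[OF finite_PR])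
  moreover have "card (?p ` ?S \<union> ?m ` ?S) = 2 * card ?S"
    using card_Un_disjoint[OF _ _ disj] p m by simp
  moreover have "2 * card ?S = (n - 1) * n"
  proof -
    have "2 * (\<Sum>b<n. b) = (n - 1) * n" by (induction n) (auto simp: algebra_simps)
    then show ?thesis by simp
  qed
  ultimately have "(n - 1) * n \<le> card (PR J)" by simp
  then show "2 * (n - 1) * card J \<le> 2 * card (PR J)" unfolding numberingD(8)[OF N] by simp
next
  fix Q x assume Q: "side Q" and x: "x \<in> PR J" and nn: "nonneg (alt_refl Q J (2 * (n - 1)) x)"
  let ?y = "alt_refl Q J (2 * (n - 1)) x"
  have y: "0 \<le> ?y i" for i using nn unfolding nonneg_def by blast
  note l = fork_longest_element[OF N Q n PR_D(2)[OF x]]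
  have x0: "0 \<le> x i" for i using PR_D(4)[OF x] .
  obtain m where m: "m < n" "x (g m) > 0" using PR_neq_zero[OF x] numberingD(2)[OF N] by auto
  show False
  proof (cases "2 \<le> m")
    case True
    then show False using l(2)[OF True m(1)] m y[of "g m"] by simp
  next
    case False
    then have "m = 0 \<or> m = 1" by auto
    then have "x (g 0) + x (g 1) > 0" using m x0[of "g 0"] x0[of "g 1"] by auto
    then show False using l(1) y[of "g 0"] y[of "g 1"] by simp
  qed
qed

end

section \<open>Counting in types A and D\<close>

context simply_laced begin

lemma Cl_none: "Cl {} = {{}}"
proof -
  have "AP {} = {}" using PR_neq_zero by (auto simp: AP_def)
  then show ?thesis by (auto simp: Cl_def CS_def)
qed

section \<open>Deleting a node from a path or a fork\<close>

lemma numbering_tail: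
  assumes "numbering adj g n J" "i < n"
    and adj: "\<And>k l. adj (k + Suc i) (l + Suc i) \<longleftrightarrow> path_adj k l"
  shows "numbering path_adj (\<lambda>k. g (k + Suc i)) (n - Suc i) (g ` {Suc i..<n})"
proof -
  note N = numberingD[OF assms(1)]
  have "inj_on (\<lambda>k. g (k + Suc i)) {..<n - Suc i}"
    by (rule inj_onI) (use N(7) assms(2) in \<open>auto dest!: iffD1[OF N(7), rotated 2]\<close>)
  moreover have "(\<lambda>k. g (k + Suc i)) ` {..<n - Suc i} = g ` {Suc i..<n}"
  proof -
    have "(\<lambda>k. k + Suc i) ` {..<n - Suc i} = {Suc i..<n}"
      using image_add_atLeastLessThan'[of "Suc i" 0 "n - Suc i"] assms(2) by (simp add: lessThan_atLeast0)
    then show ?thesis by (metis image_image)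
  qed
  moreover have "g ` {Suc i..<n} \<subseteq> I" using N(5) by auto
  ultimately show ?thesis using N(6) adj by (auto simp: numbering_def)
qed

lemma numbering_initial:
  assumes "numbering adj g n J" "i \<le> n"
  shows "numbering adj g i (g ` {..<i})"
  using numberingD[OF assms(1)] assms(2) by (auto simp: numbering_def intro: inj_on_subset)

lemma numbering_remove:
  assumes "numbering adj g n J" "i < n"
  shows "J - {g i} = g ` {..<i} \<union> g ` {Suc i..<n}"
proof -
  have "{..<n} = insert i ({..<i} \<union> {Suc i..<n})" using assms(2) by auto
  moreover have "g i \<notin> g ` ({..<i} \<union> {Suc i..<n})"
  proof
    assume "g i \<in> g ` ({..<i} \<union> {Suc i..<n})"
    then obtain k where "g i = g k" "k \<in> {..<i} \<union> {Suc i..<n}" by blast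
    then show False using numberingD(7)[OF assms(1) assms(2), of k] assms(2) by auto
  qed
  ultimately have "J = insert (g i) (g ` ({..<i} \<union> {Suc i..<n}))" "g i \<notin> g ` ({..<i} \<union> {Suc i..<n})"
    using numberingD(2)[OF assms(1)] by auto
  then have "J - {g i} = g ` ({..<i} \<union> {Suc i..<n})" by simp
  then show ?thesis by (simp only: image_Un)
qed

lemma numbering_separated:
  assumes N: "numbering adj g n J" and i: "i < n"
    and adj: "\<And>k l. k < i \<Longrightarrow> i < l \<Longrightarrow> l < n \<Longrightarrow> \<not> adj k l"
  shows "separated (g ` {..<i}) (g ` {Suc i..<n})"
  using numberingD(6,7)[OF N] i adj by (auto simp: separated_def)

lemma path_tail:
  assumes "numbering path_adj g n J" "i < n"
  shows "numbering path_adj (\<lambda>k. g (k + Suc i)) (n - Suc i) (g ` {Suc i..<n})"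
  by (rule numbering_tail[OF assms]) (auto simp: path_adj_def)

lemma path_separated:
  assumes "numbering path_adj g n J" "i < n"
  shows "separated (g ` {..<i}) (g ` {Suc i..<n})"
  by (rule numbering_separated[OF assms]) (auto simp: path_adj_def)

lemma fork_separated:
  assumes "numbering fork_adj g n J" "i < n" "2 \<le> i"
  shows "separated (g ` {..<i}) (g ` {Suc i..<n})"
  by (rule numbering_separated[OF assms(1,2)]) (use assms in \<open>auto simp: fork_adj_def\<close>)

lemma fork_tail:
  assumes "numbering fork_adj g n J" "i < n"
  shows "numbering path_adj (\<lambda>k. g (k + Suc i)) (n - Suc i) (g ` {Suc i..<n})"
  by (rule numbering_tail[OF assms]) (auto simp: path_adj_def fork_adj_def)

text \<open>Deleting a fork end leaves a path. Without node 0 the remaining numbers are consecutive;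
  without node 1 the node 0 becomes the first of the path and the later ones move down to close the
  gap.\<close>

lemma fork_remove_1:
  assumes "numbering fork_adj g n J" "2 \<le> n"
  shows "numbering path_adj (\<lambda>k. if k = 0 then g 0 else g (Suc k)) (n - 1) (J - {g 1})"
proof -
  note N = numberingD[OF assms(1)]
  let ?s = "\<lambda>k. if k = 0 then 0 else Suc k"
  let ?h = "\<lambda>k. g (?s k)"
  have s: "?s k < n" if "k < n - 1" for k using that by auto
  have "inj_on ?h {..<n - 1}"
    by (rule inj_onI) (use N(7)[OF s s] in \<open>auto split: if_splits\<close>)
  moreover have "?h ` {..<n - 1} = J - {g 1}"
  proof -
    have "?s ` {..<n - 1} = {..<n} - {1}"
    proof (intro equalityI subsetI)
      fix k assume k: "k \<in> {..<n} - {1}"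
      show "k \<in> ?s ` {..<n - 1}"
        using k assms(2) by (intro image_eqI[of _ _ "if k = 0 then 0 else k - 1"]) auto
    qed (auto split: if_splits)
    then have "?h ` {..<n - 1} = g ` ({..<n} - {1})" by (metis image_image)
    also have "\<dots> = J - {g 1}"
      unfolding N(2) by (subst inj_on_image_set_diff[OF N(1)]) (use assms(2) in auto)
    finally show ?thesis .
  qed
  moreover have "?h j \<in> nb (?h i) \<longleftrightarrow> path_adj i j" if "i < n - 1" "j < n - 1" for i j
    using N(6)[OF s[OF that(1)] s[OF that(2)]] by (auto simp: path_adj_def fork_adj_def split: if_splits)
  ultimately have "numbering path_adj ?h (n - 1) (J - {g 1})" using N(3) by (auto simp: numbering_def)
  moreover have "?h = (\<lambda>k. if k = 0 then g 0 else g (Suc k))" by auto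
  ultimately show ?thesis by simp
qed

text \<open>The three mixtures serve the orbit recurrence, the splitting at the last negative simple
  root, and the count of non-positive neighbours.\<close>

lemma Ncl_remove:
  assumes N: "numbering adj g n J" and i: "i < n" and sep: "separated (g ` {..<i}) (g ` {Suc i..<n})"
  shows "Ncl (J - {g i}) {} = card (Cl (g ` {..<i})) * card (Cl (g ` {Suc i..<n}))"
    "Ncl (J - {g i}) (g ` {Suc i..<n}) = card (Cl (g ` {..<i})) * card (PCl (g ` {Suc i..<n}))"
    "Ncl (J - {g i}) (J - {g i}) = card (PCl (g ` {..<i})) * card (PCl (g ` {Suc i..<n}))"
proof -
  let ?A = "g ` {..<i}" and ?B = "g ` {Suc i..<n}"
  have AB: "?A \<subseteq> I" "?B \<subseteq> I" using numberingD(5)[OF N] i by auto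
  have e: "J - {g i} = ?A \<union> ?B" by (rule numbering_remove[OF N i])
  have d: "?B \<inter> ?A = {}" "(?A \<union> ?B) \<inter> ?A = ?A" "(?A \<union> ?B) \<inter> ?B = ?B"
    using sep by (auto simp: separated_def)
  show "Ncl (J - {g i}) {} = card (Cl ?A) * card (Cl ?B)"
    unfolding e Ncl_separated[OF sep AB] by (simp add: Ncl_empty)
  show "Ncl (J - {g i}) ?B = card (Cl ?A) * card (PCl ?B)"
    unfolding e Ncl_separated[OF sep AB] using Ncl_restrict[OF AB(1), of ?B] d by (simp add: Ncl_empty Ncl_self)
  show "Ncl (J - {g i}) (J - {g i}) = card (PCl ?A) * card (PCl ?B)"
    unfolding e Ncl_separated[OF sep AB]
    using Ncl_restrict[OF AB(1), of "?A \<union> ?B"] Ncl_restrict[OF AB(2), of "?A \<union> ?B"] d by (simp add: Ncl_self)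
qed

text \<open>Splitting according to the last negative simple root in the given numbering.\<close>

lemma card_Cl_last_negative:
  assumes N: "numbering adj g n J" and m: "m \<le> n"
    and sep: "\<And>i. m \<le> i \<Longrightarrow> i < n \<Longrightarrow> separated (g ` {..<i}) (g ` {Suc i..<n})"
  shows "card (Cl J) = Ncl J (g ` {m..<n}) +
    (\<Sum>i = m..<n. card (Cl (g ` {..<i})) * card (PCl (g ` {Suc i..<n})))"
  using m sep
proof (induction m rule: inc_induct)
  case base
  then show ?case by (simp add: Ncl_empty)
next
  case (step m)
  have nin: "g m \<notin> g ` {Suc m..<n}" using numberingD(7)[OF N] step by auto
  have "{m..<n} = insert m {Suc m..<n}" using step(2) by auto
  then have "insert (g m) (g ` {Suc m..<n}) = g ` {m..<n}" by simp
  then have "Ncl J (g ` {Suc m..<n}) = Ncl J (g ` {m..<n}) + Ncl (J - {g m}) (g ` {Suc m..<n})"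
    using Ncl_split[OF numberingD(3)[OF N] numberingD(4)[OF N step(2)] nin] by simp
  then show ?case
    using step Ncl_remove(2)[OF N step(2)] by (simp add: sum.atLeast_Suc_lessThan)
qed

lemma sum_numbering:
  "numbering adj g n J \<Longrightarrow> (\<Sum>i\<in>J. f i) = (\<Sum>k<n. f (g k))"
  using sum.reindex[of g "{..<n}" f] by (simp add: numbering_def)

text \<open>The orbit recurrence gives the number of all clusters. Splitting at the last negative
  simple root then reproduces the Catalan convolution term by term, and the positive clusters take
  the place of its first term.\<close>

lemma path_card_Cl:
  assumes "numbering path_adj g n J"
  shows "real (card (Cl J)) = catalan (Suc n) \<and> real (card (PCl J)) = catalan n"
  using assms
proof (induction n arbitrary: g J rule: less_induct)
  case (less n)
  note N = less.prems
  have J: "J \<subseteq> I" using numberingD(3)[OF N] .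
  show ?case
  proof (cases "n = 0")
    case True
    then have "J = {}" using numberingD(2)[OF N] by simp
    moreover have "PCl {} = {{}}" using Cl_none by (auto simp: PCl_def)
    moreover have "catalan (Suc 0) = 1" using catalan_Suc[of 0] by simp
    ultimately show ?thesis using True Cl_none by simp
  next
    case False
    have A: "real (card (Cl (g ` {..<i}))) = catalan (Suc i)" if "i < n" for i
      using less.IH[OF that numbering_initial[OF N]] that by simp
    have B: "real (card (Cl (g ` {Suc i..<n}))) = catalan (n - i)"
      "real (card (PCl (g ` {Suc i..<n}))) = catalan (n - Suc i)" if "i < n" for i
      using less.IH[OF _ path_tail[OF N that]] that by (auto simp: Suc_diff_Suc)
    have rem: "real (card (Cl (J - {g i}))) = catalan (Suc i) * catalan (n - i)" if "i < n" for i
      using Ncl_remove(1)[OF N that path_separated[OF N that]] A[OF that] B(1)[OF that] by (simp add: Ncl_empty)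
    \<comment> \<open>The parabolics obtained by deleting a node run through the convolution of
      index \<open>n + 1\<close> except for its two extreme terms, each equal to
      \<open>catalan (Suc n)\<close>.\<close>
    have conv: "(\<Sum>i<n. catalan (Suc i) * catalan (n - i)) = catalan (Suc (Suc n)) - 2 * catalan (Suc n)"
    proof -
      have "catalan (Suc (Suc n)) = (\<Sum>i\<le>Suc n. catalan i * catalan (Suc n - i))" using catalan_convolution by simp
      also have "\<dots> = catalan (Suc n) + (\<Sum>i\<le>n. catalan (Suc i) * catalan (n - i))"
        by (subst sum.atMost_Suc_shift) simp
      also have "(\<Sum>i\<le>n. catalan (Suc i) * catalan (n - i)) = (\<Sum>i<n. catalan (Suc i) * catalan (n - i)) + catalan (Suc n)"
        by (simp add: lessThan_Suc_atMost[symmetric])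
      finally show ?thesis by simp
    qed
    have "2 * n * card (Cl J) = (Suc n + 2) * (\<Sum>k<n. card (Cl (J - {g k})))"
      using card_Cl_recurrence[OF path_coxeter_number[OF N] J] unfolding numberingD(8)[OF N]
        sum_numbering[OF N, of "\<lambda>i. card (Cl (J - {i}))"] .
    then have "real (2 * n * card (Cl J)) = real ((Suc n + 2) * (\<Sum>k<n. card (Cl (J - {g k}))))" by simp
    then have "2 * real n * real (card (Cl J)) = (real n + 3) * (\<Sum>k<n. real (card (Cl (J - {g k}))))"
      by (simp add: algebra_simps)
    also have "(\<Sum>k<n. real (card (Cl (J - {g k})))) = catalan (Suc (Suc n)) - 2 * catalan (Suc n)"
      unfolding conv[symmetric] by (rule sum.cong) (auto simp: rem)
    also have "(real n + 3) * (catalan (Suc (Suc n)) - 2 * catalan (Suc n)) = 2 * real n * catalan (Suc n)"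
      using catalan_Suc[of "Suc n"] by (simp add: algebra_simps)
    finally have Cl: "real (card (Cl J)) = catalan (Suc n)" using False by simp
    have "g ` {0..<n} = J" using numberingD(2)[OF N] by (simp add: lessThan_atLeast0)
    then have "card (Cl J) = card (PCl J) + (\<Sum>i = 0..<n. card (Cl (g ` {..<i})) * card (PCl (g ` {Suc i..<n})))"
      using card_Cl_last_negative[OF N, of 0] path_separated[OF N] by (simp add: Ncl_self)
    then have "catalan (Suc n) = real (card (PCl J)) + (\<Sum>i<n. catalan (Suc i) * catalan (n - Suc i))"
      using Cl A B(2) by (simp add: lessThan_atLeast0)
    moreover have "catalan (Suc n) = catalan n + (\<Sum>i<n. catalan (Suc i) * catalan (n - Suc i))"
    proof -
      have "catalan (Suc n) = (\<Sum>i<Suc n. catalan i * catalan (n - i))"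
        using catalan_convolution[of n] by (simp only: lessThan_Suc_atMost)
      then show ?thesis by (subst (asm) sum.lessThan_Suc_shift) simp
    qed
    ultimately show ?thesis using Cl by simp
  qed
qed

text \<open>In type D the counts are a linear function of the rank times a Catalan number. The
  linear weight averages to its value at \<open>n / 2\<close>; the subtracted term is the one for
  \<open>i = 1\<close>, since forks start at rank 2.\<close>

lemma catalan_convolution_linear:
  assumes "2 \<le> n"
  shows "(\<Sum>i = 2..<n. (a * real i + b) * catalan (i - 1) * catalan (n - Suc i)) =
    (a * real n / 2 + b) * catalan (n - 1) - (a + b) * catalan (n - 2)"
proof -
  obtain m where n: "n = m + 2" using assms by (metis add.commute le_Suc_ex)
  let ?t = "\<lambda>j. (a * (real j + 1) + b) * catalan j * catalan (m - j)"
  have "(\<Sum>j\<le>m. ?t j)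
      = a * (\<Sum>j\<le>m. real j * catalan j * catalan (m - j)) + (a + b) * (\<Sum>j\<le>m. catalan j * catalan (m - j))"
    by (simp add: sum_distrib_left sum.distrib[symmetric] algebra_simps)
  also have "\<dots> = (a * real n / 2 + b) * catalan (n - 1)"
    unfolding sum_weighted_convolution catalan_convolution by (simp add: n field_simps)
  finally have 1: "(\<Sum>j\<le>m. ?t j) = (a * real n / 2 + b) * catalan (n - 1)" .
  have "(\<Sum>j\<le>m. ?t j) = (a + b) * catalan m + (\<Sum>j<m. ?t (Suc j))"
    unfolding lessThan_Suc_atMost[symmetric] by (subst sum.lessThan_Suc_shift) simp
  also have "(\<Sum>j<m. ?t (Suc j)) = (\<Sum>i = 2..<n. (a * real i + b) * catalan (i - 1) * catalan (n - Suc i))"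
    by (rule sum.reindex_bij_witness[of _ "\<lambda>i. i - 2" "\<lambda>j. j + 2"])
      (auto simp: n numeral_2_eq_2 Suc_diff_Suc)
  finally show ?thesis using 1 n by simp
qed

lemma path_singleton: "i \<in> I \<Longrightarrow> numbering path_adj (\<lambda>_. i) 1 {i}"
  using nb_refl by (auto simp: numbering_def path_adj_def inj_on_def)

text \<open>Deleting a node beyond the fork leaves a smaller fork and a path, and the fork may
  shrink to two isolated nodes, so the formulas are proved from rank 2 on. For the positive count
  only the nodes from 2 on are treated by the last-negative splitting; the two fork ends are
  separated by hand.\<close>

lemma fork_card_Cl:
  assumes "numbering fork_adj g n J" "2 \<le> n"
  shows "real (card (Cl J)) = (3 * real n - 2) * catalan (n - 1) \<and>
    2 * real (card (PCl J)) = (3 * real n - 4) * catalan (n - 1)"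
  using assms
proof (induction n arbitrary: g J rule: less_induct)
  case (less n)
  note N = less.prems(1) and n = less.prems(2)
  have J: "J \<subseteq> I" using numberingD(3)[OF N] .
  have A: "real (card (Cl (g ` {..<i}))) = (3 * real i - 2) * catalan (i - 1)" if "2 \<le> i" "i < n" for i
    using less.IH[OF that(2) numbering_initial[OF N]] that by simp
  have B: "real (card (Cl (g ` {Suc i..<n}))) = catalan (n - i)"
    "real (card (PCl (g ` {Suc i..<n}))) = catalan (n - Suc i)" if "i < n" for i
    using path_card_Cl[OF fork_tail[OF N that]] that by (auto simp: Suc_diff_Suc)
  have J0: "J - {g 0} = g ` {Suc 0..<n}" using numbering_remove[OF N, of 0] n by simp
  have rem0: "real (card (Cl (J - {g 0}))) = catalan n" using B(1)[of 0] n J0 by simp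
  have rem1: "real (card (Cl (J - {g 1}))) = catalan n" "real (card (PCl (J - {g 1}))) = catalan (n - 1)"
    using path_card_Cl[OF fork_remove_1[OF N n]] n by auto
  have rem: "real (card (Cl (J - {g i}))) = (3 * real i - 2) * catalan (i - 1) * catalan (n - i)" if "2 \<le> i" "i < n" for i
    using Ncl_remove(1)[OF N that(2) fork_separated[OF N that(2,1)]] A[OF that] B(1)[OF that(2)] by (simp add: Ncl_empty)
  have Cl: "real (card (Cl J)) = (3 * real n - 2) * catalan (n - 1)"
  \<comment> \<open>Two isolated nodes form a product of two rank 1 systems with four clusters. From
    rank 3 on the Coxeter number \<open>2 * (n - 1)\<close> reduces the orbit recurrence to the
    plain sum over deleted nodes.\<close>
  proof (cases "n = 2")
    case True
    have "\<not> fork_adj 0 1" by (simp add: fork_adj_def)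
    then have sep: "separated {g 0} {g 1}"
      using numberingD(6,7)[OF N, of 0 1] True by (auto simp: separated_def)
    have I01: "{g 0} \<subseteq> I" "{g 1} \<subseteq> I" using numberingD(5)[OF N] True by auto
    have "{..<2::nat} = {0, 1}" by auto
    then have "J = {g 0} \<union> {g 1}" using numberingD(2)[OF N] True by auto
    then have "card (Cl J) = card (Cl {g 0}) * card (Cl {g 1})"
      using Ncl_separated[OF sep I01, of "{}"] by (simp add: Ncl_empty)
    moreover have "catalan (Suc 1) = 2" "catalan 1 = 1" using catalan_Suc[of 1] catalan_Suc[of 0] by auto
    ultimately show ?thesis
      using path_card_Cl[OF path_singleton, of "g 0"] path_card_Cl[OF path_singleton, of "g 1"] I01 True by simp
  next
    case False
    then have n3: "3 \<le> n" using n by simp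
    have "2 * n * card (Cl J) = (2 * (n - 1) + 2) * (\<Sum>k<n. card (Cl (J - {g k})))"
      using card_Cl_recurrence[OF fork_coxeter_number[OF N n3] J] unfolding numberingD(8)[OF N]
        sum_numbering[OF N, of "\<lambda>i. card (Cl (J - {i}))"] .
    moreover have "2 * (n - 1) + 2 = 2 * n" using n by simp
    ultimately have "2 * n * card (Cl J) = 2 * n * (\<Sum>k<n. card (Cl (J - {g k})))"
      by (simp only:)
    then have "card (Cl J) = (\<Sum>k<n. card (Cl (J - {g k})))" using n by simp
    also have "{..<n} = {0, 1} \<union> {2..<n}" using n by auto
    also have "(\<Sum>k\<in>{0, 1} \<union> {2..<n}. card (Cl (J - {g k})))
        = card (Cl (J - {g 0})) + card (Cl (J - {g 1})) + (\<Sum>k = 2..<n. card (Cl (J - {g k})))"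
      by (subst sum.union_disjoint) auto
    finally have "real (card (Cl J)) = 2 * catalan n + (\<Sum>k = 2..<n. (3 * real k - 2) * catalan (k - 1) * catalan (n - k))"
      using rem0 rem1 rem by simp
    \<comment> \<open>Read as the linear convolution of index \<open>Suc n\<close> without its last
      term \<open>k = n\<close>.\<close>
    also have "(\<Sum>k = 2..<n. (3 * real k - 2) * catalan (k - 1) * catalan (n - k))
        = (\<Sum>k = 2..<Suc n. (3 * real k + - 2) * catalan (k - 1) * catalan (Suc n - Suc k)) - (3 * real n - 2) * catalan (n - 1)"
      using n by simp
    also have "\<dots> = (3 * (real n + 1) / 2 - 2) * catalan n - catalan (n - 1) - (3 * real n - 2) * catalan (n - 1)"
      using catalan_convolution_linear[of "Suc n" 3 "-2"] n by simp
    finally have "real (card (Cl J)) = 3 / 2 * ((real n + 1) * catalan n) - (3 * real n - 1) * catalan (n - 1)"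
      by (simp add: algebra_simps add_divide_distrib)
    also have "(real n + 1) * catalan n = (4 * real n - 2) * catalan (n - 1)"
      using catalan_Suc[of "n - 1"] n by (simp add: of_nat_diff algebra_simps)
    finally show ?thesis by (simp add: algebra_simps)
  qed
  define T where "T = g ` {2..<n}"
  have g01: "g 0 \<in> J" "g 1 \<in> J" "g 0 \<noteq> g 1" "g 0 \<notin> T" "g 1 \<notin> T"
    using numberingD(4,7)[OF N] n by (auto simp: T_def)
  have T1: "insert (g 1) T = g ` {Suc 0..<n}"
  proof -
    have "{Suc 0..<n} = insert 1 {2..<n}" using n by auto
    then show ?thesis by (simp add: T_def)
  qed
  have J01: "insert (g 0) (insert (g 1) T) = J" using T1 J0 g01 by auto
  \<comment> \<open>Clusters without negative simple roots beyond the fork are sorted by which of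
    the two fork ends occur negatively: none, one of them, or both. What remains is a positive
    cluster of the fork, of a path with \<open>n - 1\<close> nodes, or of one with
    \<open>n - 2\<close> nodes.\<close>
  have "Ncl J T = Ncl J (insert (g 1) T) + Ncl (J - {g 1}) T"
    by (rule Ncl_split[OF J g01(2,5)])
  also have "Ncl J (insert (g 1) T) = Ncl J J + Ncl (J - {g 0}) (insert (g 1) T)"
    using Ncl_split[OF J g01(1), of "insert (g 1) T"] g01 J01 by simp
  also have "Ncl (J - {g 0}) (insert (g 1) T) = card (PCl (g ` {Suc 0..<n}))"
    unfolding J0 T1 by (rule Ncl_self)
  also have "Ncl (J - {g 1}) T = Ncl (J - {g 1}) (insert (g 0) T) + Ncl (J - {g 1} - {g 0}) T"
    by (rule Ncl_split) (use J g01 in auto)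
  also have "insert (g 0) T = J - {g 1}" using J01 g01 by auto
  also have "J - {g 1} - {g 0} = T" using J01 g01 by auto
  finally have "Ncl J T = card (PCl J) + card (PCl (g ` {Suc 0..<n})) + (card (PCl (J - {g 1})) + card (PCl T))"
    by (simp add: Ncl_self)
  then have NT: "real (Ncl J T) = real (card (PCl J)) + 2 * catalan (n - 1) + catalan (n - 2)"
    using B(2)[of 0] B(2)[of 1] rem1 n by (simp add: T_def numeral_2_eq_2)
  have "card (Cl J) = Ncl J T + (\<Sum>i = 2..<n. card (Cl (g ` {..<i})) * card (PCl (g ` {Suc i..<n})))"
    unfolding T_def by (rule card_Cl_last_negative[OF N n fork_separated[OF N]])
  then have "real (card (Cl J)) = real (Ncl J T) + (\<Sum>i = 2..<n. (3 * real i + - 2) * catalan (i - 1) * catalan (n - Suc i))"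
    using A B(2) by simp
  also have "\<dots> = real (card (PCl J)) + 2 * catalan (n - 1) + (3 * real n / 2 - 2) * catalan (n - 1)"
    unfolding catalan_convolution_linear[OF n] NT by simp
  finally show ?case using Cl by (simp add: field_simps)
qed

text \<open>The correction sum over deleted nodes is itself the Catalan convolution and equals the
  number of positive clusters.\<close>

lemma path_card_pos_edges:
  assumes N: "numbering path_adj g n J" and n: "1 \<le> n"
  shows "2 * real (card (pos_edges J)) = (real n - 1) * catalan n"
proof -
  have J: "J \<subseteq> I" "J \<noteq> {}" using numberingD(3)[OF N] numberingD(4)[OF N, of 0] n by auto
  have "n * card (PCl J) = 2 * card (pos_edges J) + (\<Sum>k<n. card (PCl (J - {g k})))"
    using card_pos_edges[OF J] unfolding numberingD(8)[OF N] sum_numbering[OF N, of "\<lambda>i. card (PCl (J - {i}))"] .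
  then have "real (n * card (PCl J)) = real (2 * card (pos_edges J) + (\<Sum>k<n. card (PCl (J - {g k}))))" by simp
  moreover have "real (card (PCl (J - {g k}))) = catalan k * catalan (n - 1 - k)" if "k < n" for k
    using Ncl_remove(3)[OF N that path_separated[OF N that]] path_card_Cl[OF numbering_initial[OF N, of k]]
      path_card_Cl[OF path_tail[OF N that]] that by (simp add: Ncl_self)
  ultimately have "real n * catalan n = 2 * real (card (pos_edges J)) + (\<Sum>k<n. catalan k * catalan (n - 1 - k))"
    using path_card_Cl[OF N] by simp
  moreover have "{..<n} = {..n - 1}" using n by auto
  ultimately have "real n * catalan n = 2 * real (card (pos_edges J)) + catalan n"
    using catalan_convolution[of "n - 1"] n by simp
  then show ?thesis by (simp add: algebra_simps)
qed

text \<open>The factor 4 clears the half in the positive count and the two orientations of an edge.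
  In \<open>- 11 / 2\<close> the part \<open>- 4\<close> comes from the positive clusters and
  \<open>- 3 / 2\<close> from averaging the weight; \<open>catalan (n - 2)\<close> is the boundary
  term of the linear convolution. The contributions of the two fork ends cancel the constant
  weight.\<close>

lemma fork_card_pos_edges:
  assumes N: "numbering fork_adj g n J" and n: "2 \<le> n"
  shows "4 * real (card (pos_edges J)) =
    (3 * real n - 11 / 2) * real n * catalan (n - 1) - catalan (n - 2)"
proof -
  have J: "J \<subseteq> I" "J \<noteq> {}" using numberingD(3)[OF N] numberingD(4)[OF N, of 0] n by auto
  have "n * card (PCl J) = 2 * card (pos_edges J) + (\<Sum>k<n. card (PCl (J - {g k})))"
    using card_pos_edges[OF J] unfolding numberingD(8)[OF N] sum_numbering[OF N, of "\<lambda>i. card (PCl (J - {i}))"] .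
  also have "{..<n} = {0, 1} \<union> {2..<n}" using n by auto
  also have "(\<Sum>k\<in>{0, 1} \<union> {2..<n}. card (PCl (J - {g k})))
      = card (PCl (J - {g 0})) + card (PCl (J - {g 1})) + (\<Sum>k = 2..<n. card (PCl (J - {g k})))"
    by (subst sum.union_disjoint) auto
  finally have e: "n * card (PCl J) = 2 * card (pos_edges J) +
    (card (PCl (J - {g 0})) + card (PCl (J - {g 1})) + (\<Sum>k = 2..<n. card (PCl (J - {g k}))))" .
  have "real (n * card (PCl J)) = 2 * real (card (pos_edges J)) +
    (real (card (PCl (J - {g 0}))) + real (card (PCl (J - {g 1}))) + (\<Sum>k = 2..<n. real (card (PCl (J - {g k})))))"
    unfolding e by simp
  moreover have "2 * real (card (PCl (J - {g k}))) = (3 * real k + - 4) * catalan (k - 1) * catalan (n - Suc k)"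
    if "2 \<le> k" "k < n" for k
    using Ncl_remove(3)[OF N that(2) fork_separated[OF N that(2,1)]] fork_card_Cl[OF numbering_initial[OF N, of k]]
      path_card_Cl[OF fork_tail[OF N that(2)]] that by (simp add: Ncl_self)
  then have "2 * (\<Sum>k = 2..<n. real (card (PCl (J - {g k})))) = (\<Sum>k = 2..<n. (3 * real k + - 4) * catalan (k - 1) * catalan (n - Suc k))"
    unfolding sum_distrib_left by (intro sum.cong) auto
  moreover have "real (card (PCl (J - {g 0}))) = catalan (n - 1)"
    using path_card_Cl[OF fork_tail[OF N, of 0]] numbering_remove[OF N, of 0] n by simp
  moreover have "real (card (PCl (J - {g 1}))) = catalan (n - 1)"
    using path_card_Cl[OF fork_remove_1[OF N n]] by simp
  moreover have "real n * ((3 * real n - 4) * catalan (n - 1)) = 2 * real (n * card (PCl J))"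
  proof -
    have "(3 * real n - 4) * catalan (n - 1) = 2 * real (card (PCl J))"
      using fork_card_Cl[OF N n] by simp
    then show ?thesis by (simp only: of_nat_mult mult_ac)
  qed
  ultimately have "real n * ((3 * real n - 4) * catalan (n - 1)) = 4 * real (card (pos_edges J)) +
      (4 * catalan (n - 1) + ((3 * real n / 2 + - 4) * catalan (n - 1) - (3 + - 4) * catalan (n - 2)))"
    unfolding catalan_convolution_linear[OF n] by simp
  then show ?thesis by (simp add: algebra_simps)
qed

end

section \<open>Closed forms in binomial coefficients\<close>

lemma Suc_times_choose_Suc: "Suc k * (n choose Suc k) = (n - k) * (n choose k)"
  by (simp only: binomial_absorption binomial_absorb_comp)

lemma path_edges_closed_form:
  assumes "1 \<le> n" "2 * real e = (real n - 1) * catalan n"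
  shows "e = (2 * n - 1) choose (n + 1)"
proof -
  have "(2 * n) choose n = 2 * ((2 * n - 1) choose n)"
  proof -
    obtain m where m: "n = Suc m" using assms(1) by (cases n) auto
    have "(2 * m + 1) choose m = (2 * m + 1) choose Suc m" using binomial_symmetric[of m "2 * m + 1"] by simp
    then show ?thesis using m by simp
  qed
  then have "2 * (real n + 1) * real e = 2 * ((real n - 1) * real ((2 * n - 1) choose n))"
    using assms(2) by (simp add: catalan_def field_simps)
  also have "(real n - 1) * real ((2 * n - 1) choose n) = real (Suc n * ((2 * n - 1) choose Suc n))"
    unfolding Suc_times_choose_Suc using assms(1) by (simp add: of_nat_diff)
  finally have "(2 * (real n + 1)) * real e = (2 * (real n + 1)) * real ((2 * n - 1) choose Suc n)"
    by (simp add: algebra_simps)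
  then have "real e = real ((2 * n - 1) choose Suc n)" by (subst (asm) mult_left_cancel) auto
  then show ?thesis by simp
qed

lemma fork_edges_closed_form:
  assumes "4 \<le> n" "4 * real e = (3 * real n - 11 / 2) * real n * catalan (n - 1) - catalan (n - 2)"
  shows "e = (3 * n - 4) * ((2 * (n - 2)) choose (n - 3))"
proof -
  obtain m where m: "n = m + 2" "2 \<le> m" 
    by (rule that[of "n - 2"]) (use assms(1) in auto)
  let ?B = "(2 * m) choose m"
  have c2: "(real m + 1) * catalan m = real ?B" by (simp add: catalan_def)
  have c1: "(real m + 2) * catalan (Suc m) = (4 * real m + 2) * catalan m" by (rule catalan_Suc)
  have "4 * real e = (3 * real m + 1 / 2) * ((real m + 2) * catalan (Suc m)) - catalan m"
    using assms(2) m by (simp add: algebra_simps)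
  \<comment> \<open>The boundary term cancels the constant:
    \<open>(3 * m + 1 / 2) * (4 * m + 2) - 1\<close> is \<open>4 * m * (3 * m + 2)\<close>.\<close>
  also have "\<dots> = 4 * real m * (3 * real m + 2) * catalan m" unfolding c1 by (simp add: algebra_simps)
  finally have "real e = real m * (3 * real m + 2) * catalan m" by simp
  then have "(real m + 1) * real e = real m * (3 * real m + 2) * ((real m + 1) * catalan m)" by (simp only: mult_ac)
  then have 1: "(real m + 1) * real e = (3 * real m + 2) * (real m * real ?B)" unfolding c2 by simp
  have "Suc (m - 1) * (2 * m choose Suc (m - 1)) = (2 * m - (m - 1)) * (2 * m choose (m - 1))"
    by (rule Suc_times_choose_Suc)
  moreover have "Suc (m - 1) = m" "2 * m - (m - 1) = m + 1" using m(2) by auto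
  ultimately have "m * ?B = (m + 1) * ((2 * m) choose (m - 1))" by simp
  then have 2: "real m * real ?B = (real m + 1) * real ((2 * m) choose (m - 1))"
    by (metis of_nat_1 of_nat_add of_nat_mult)
  have "(real m + 1) * real e = (real m + 1) * ((3 * real m + 2) * real ((2 * m) choose (m - 1)))"
    using 1 unfolding 2 by (simp only: mult_ac)
  then have "real e = (3 * real m + 2) * real ((2 * m) choose (m - 1))" by simp
  also have "\<dots> = real ((3 * m + 2) * ((2 * m) choose (m - 1)))" by (simp add: algebra_simps)
  finally have "e = (3 * m + 2) * ((2 * m) choose (m - 1))" by (simp only: of_nat_eq_iff)
  then show ?thesis using m by simp
qed

section \<open>Transfer to abstract root systems\<close>

lemma reflection_commute:
  assumes "a = b \<or> a \<bullet> b = 0"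
  shows "reflection b (reflection a x) = reflection a (reflection b x)"
proof (cases "a = b")
  case False
  then have "a \<bullet> b = 0" "b \<bullet> a = 0" using assms by (auto simp: inner_commute)
  then show ?thesis by (simp add: reflection_def cartan_def inner_diff_left algebra_simps)
qed simp

text \<open>Reflections commute only for equal or orthogonal vectors, so the fold has to be unfolded
  relative to a pairwise orthogonal set.\<close>

lemma fold_reflection_insert:
  assumes "finite J" "\<And>a b. a \<in> J \<Longrightarrow> b \<in> J \<Longrightarrow> a \<noteq> b \<Longrightarrow> a \<bullet> b = 0" "insert k K \<subseteq> J" "k \<notin> K"
  shows "Finite_Set.fold reflection x (insert k K) = reflection k (Finite_Set.fold reflection x K)"
proof -
  interpret comp_fun_commute_on J reflection
  proof
    fix a b assume "a \<in> J" "b \<in> J"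
    then have "a = b \<or> a \<bullet> b = 0" using assms(2) by blast
    then show "reflection b \<circ> reflection a = reflection a \<circ> reflection b"
      using reflection_commute by (intro ext) simp
  qed
  have "finite K" using finite_subset[of K J] assms(1,3) by simp
  then show ?thesis by (rule fold_insert[OF assms(3) _ assms(4)])
qed

locale laced_root_system =
  fixes \<Phi> \<Delta> P M :: "'a::real_inner set"
  assumes root_system: "root_system \<Phi>"
    and simple_roots: "simple_roots \<Phi> \<Delta>"
    and bipartition: "diagram_bipartition \<Delta> P M"
    and laced: "\<And>a b. a \<in> \<Delta> \<Longrightarrow> b \<in> \<Delta> \<Longrightarrow> a \<noteq> b \<Longrightarrow> cartan a b = - 1 \<or> cartan a b = 0"
begin

section \<open>Coefficient vectors of an abstract root system\<close>

definition nbr :: "'a \<Rightarrow> 'a set" where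
  "nbr a = {b. a \<in> \<Delta> \<and> b \<in> \<Delta> \<and> b \<noteq> a \<and> b \<bullet> a \<noteq> 0}"

definition lin :: "('a \<Rightarrow> int) \<Rightarrow> 'a" where
  "lin x = (\<Sum>a\<in>\<Delta>. of_int (x a) *\<^sub>R a)"

definition coord_roots :: "('a \<Rightarrow> int) set" where
  "coord_roots = {x. supp_in \<Delta> x \<and> lin x \<in> \<Phi>}"

lemma finite_\<Phi>: "finite \<Phi>" and zero_\<Phi>: "0 \<notin> \<Phi>"
  and refl_\<Phi>: "a \<in> \<Phi> \<Longrightarrow> b \<in> \<Phi> \<Longrightarrow> reflection a b \<in> \<Phi>"
  and reduced_\<Phi>: "a \<in> \<Phi> \<Longrightarrow> r *\<^sub>R a \<in> \<Phi> \<Longrightarrow> r = 1 \<or> r = - 1"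
  using root_system by (auto simp: root_system_def)

lemma \<Delta>_subset: "\<Delta> \<subseteq> \<Phi>" and independent_\<Delta>: "independent \<Delta>"
  using simple_roots by (auto simp: simple_roots_def)

lemma finite_\<Delta>: "finite \<Delta>"
  using finite_subset[OF \<Delta>_subset finite_\<Phi>] .

lemma \<Delta>_nonzero: "a \<in> \<Delta> \<Longrightarrow> a \<noteq> 0"
  using \<Delta>_subset zero_\<Phi> by auto

lemma bipartitionD:
  "P \<union> M = \<Delta>" "P \<inter> M = {}"
  "a \<in> P \<Longrightarrow> b \<in> P \<Longrightarrow> a \<noteq> b \<Longrightarrow> a \<bullet> b = 0"
  "a \<in> M \<Longrightarrow> b \<in> M \<Longrightarrow> a \<noteq> b \<Longrightarrow> a \<bullet> b = 0"
  using bipartition by (auto simp: diagram_bipartition_def)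

lemma root_coeff_lin: "a \<in> \<Delta> \<Longrightarrow> root_coeff \<Delta> (lin x) a = of_int (x a)"
proof -
  assume a: "a \<in> \<Delta>"
  have sp: "b \<in> \<Delta> \<Longrightarrow> of_int (x b) *\<^sub>R b \<in> span \<Delta>" for b by (simp add: span_base span_scale)
  have "representation \<Delta> (lin x) a = (\<Sum>b\<in>\<Delta>. representation \<Delta> (of_int (x b) *\<^sub>R b) a)"
    unfolding lin_def by (subst real_vector.representation_sum[OF independent_\<Delta> sp]) auto
  also have "\<dots> = (\<Sum>b\<in>\<Delta>. if a = b then of_int (x b) else 0)"
  proof (rule sum.cong)
    fix b assume "b \<in> \<Delta>"
    then show "representation \<Delta> (of_int (x b) *\<^sub>R b) a = (if a = b then of_int (x b) else 0)"
      using real_vector.representation_scale[OF independent_\<Delta> span_base, of b]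
        real_vector.representation_basis[OF independent_\<Delta>, of b] by simp
  qed simp
  also have "\<dots> = of_int (x a)" using a finite_\<Delta> by simp
  finally show ?thesis by (simp add: root_coeff_def)
qed

lemma lin_inject: "supp_in \<Delta> x \<Longrightarrow> supp_in \<Delta> y \<Longrightarrow> lin x = lin y \<Longrightarrow> x = y"
proof
  fix a assume *: "supp_in \<Delta> x" "supp_in \<Delta> y" "lin x = lin y"
  show "x a = y a"
    using * root_coeff_lin[of a x] root_coeff_lin[of a y] by (cases "a \<in> \<Delta>") (auto simp: supp_in_def)
qed

lemma lin_delta: "a \<in> \<Delta> \<Longrightarrow> lin (delta a) = a" "a \<in> \<Delta> \<Longrightarrow> lin (ndelta a) = - a"
proof -
  assume a: "a \<in> \<Delta>"
  have "lin (delta a) = (\<Sum>b\<in>\<Delta>. if b = a then b else 0)" unfolding lin_def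
    by (rule sum.cong) (auto simp: delta_def)
  then show "lin (delta a) = a" using a finite_\<Delta> by simp
  have "lin (ndelta a) = (\<Sum>b\<in>\<Delta>. if b = a then - b else 0)" unfolding lin_def
    by (rule sum.cong) (auto simp: ndelta_def)
  then show "lin (ndelta a) = - a" using a finite_\<Delta> by simp
qed

lemma coord_roots_surj:
  assumes "b \<in> \<Phi>"
  obtains x where "x \<in> coord_roots" "lin x = b" "nonneg x \<or> nonneg (- x)"
proof -
  obtain k :: "'a \<Rightarrow> int" where k: "b = (\<Sum>a\<in>\<Delta>. of_int (k a) *\<^sub>R a)"
    "(\<forall>a\<in>\<Delta>. 0 \<le> k a) \<or> (\<forall>a\<in>\<Delta>. k a \<le> 0)"
    using simple_roots assms unfolding simple_roots_def by blast
  define x where "x a = (if a \<in> \<Delta> then k a else 0)" for a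
  have "lin x = b" unfolding lin_def k(1) by (rule sum.cong) (auto simp: x_def)
  moreover have "supp_in \<Delta> x" by (simp add: supp_in_def x_def)
  moreover have "nonneg x \<or> nonneg (- x)" using k(2) by (auto simp: nonneg_def x_def)
  ultimately show ?thesis using that assms by (simp add: coord_roots_def)
qed

lemma cartan_lin:
  assumes "a \<in> \<Delta>"
  shows "cartan (lin x) a = of_int (2 * x a - (\<Sum>b\<in>nbr a. x b))"
proof -
  have c: "cartan b a = (if b = a then 2 else 0) - (if b \<in> nbr a then 1 else 0)" if "b \<in> \<Delta>" for b
    using laced[OF that assms] \<Delta>_nonzero[OF assms] that assms
    by (auto simp: nbr_def cartan_def)
  have sub: "nbr a \<subseteq> \<Delta>" by (auto simp: nbr_def)
  have "cartan (lin x) a = (\<Sum>b\<in>\<Delta>. of_int (x b) * cartan b a)"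
    unfolding cartan_def lin_def by (simp add: inner_sum_left sum_distrib_left sum_divide_distrib mult_ac)
  also have "\<dots> = (\<Sum>b\<in>\<Delta>. (if b = a then 2 * of_int (x b) else 0) - (if b \<in> nbr a then of_int (x b) else 0))"
    by (rule sum.cong) (auto simp: c algebra_simps)
  also have "\<dots> = 2 * of_int (x a) - (\<Sum>b\<in>\<Delta>. if b \<in> nbr a then of_int (x b) else 0)"
    using assms finite_\<Delta> by (simp add: sum_subtractf)
  also have "(\<Sum>b\<in>\<Delta>. if b \<in> nbr a then of_int (x b) else 0) = (\<Sum>b\<in>nbr a. of_int (x b) :: real)"
    using sub finite_\<Delta> by (simp add: sum.If_cases Int_absorb1)
  finally show ?thesis by simp
qed

lemma reflection_lin:
  assumes "a \<in> \<Delta>"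
  shows "reflection a (lin x) = lin (x(a := (\<Sum>b\<in>nbr a. x b) - x a))"
proof -
  let ?y = "x(a := (\<Sum>b\<in>nbr a. x b) - x a)"
  have "lin ?y - lin x = (\<Sum>b\<in>\<Delta>. of_int (?y b - x b) *\<^sub>R b)"
    unfolding lin_def by (simp add: sum_subtractf[symmetric] scaleR_diff_left del: fun_upd_apply)
  also have "\<dots> = (\<Sum>b\<in>\<Delta>. if b = a then - (cartan (lin x) a *\<^sub>R a) else 0)"
  proof (rule sum.cong)
    fix b
    have "real_of_int (?y a - x a) = - cartan (lin x) a" by (simp add: cartan_lin[OF assms])
    then show "of_int (?y b - x b) *\<^sub>R b = (if b = a then - (cartan (lin x) a *\<^sub>R a) else 0)"
      by (cases "b = a") (simp_all del: of_int_diff)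
  qed simp
  also have "\<dots> = - (cartan (lin x) a *\<^sub>R a)" using assms finite_\<Delta> by simp
  finally show ?thesis by (simp add: reflection_def algebra_simps)
qed

lemma lin_zero: "lin (\<lambda>_. 0) = 0"
  by (simp add: lin_def)

lemma coord_roots_multiple:
  assumes "x \<in> coord_roots" "supp_in {a} x"
  shows "x = delta a \<or> x = ndelta a"
proof -
  have sx: "supp_in \<Delta> x" and lx: "lin x \<in> \<Phi>" using assms(1) by (auto simp: coord_roots_def)
  have xa: "x = (\<lambda>b. if b = a then x a else 0)" using assms(2) by (auto simp: supp_in_def)
  have a: "a \<in> \<Delta>"
  proof (rule ccontr)
    assume "a \<notin> \<Delta>"
    then have "x a = 0" using sx by (simp add: supp_in_def)
    then have "x = (\<lambda>_. 0)" by (subst xa) auto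
    then show False using lx lin_zero zero_\<Phi> by simp
  qed
  have "lin x = (\<Sum>b\<in>\<Delta>. if b = a then of_int (x a) *\<^sub>R a else 0)"
    unfolding lin_def by (subst xa, rule sum.cong) auto
  then have "lin x = of_int (x a) *\<^sub>R a" using a finite_\<Delta> by simp
  then have "real_of_int (x a) = 1 \<or> real_of_int (x a) = - 1"
    using reduced_\<Phi>[of a] \<Delta>_subset a lx by auto
  then have "x a = 1 \<or> x a = - 1" by linarith
  then show ?thesis by (subst (1 2) xa) (auto simp: delta_def ndelta_def)
qed

text \<open>The equations say that \<open>lin v\<close> is orthogonal to every simple root in
  \<open>J\<close>. Being a combination of these, it is orthogonal to itself, so positive
  definiteness makes it zero.\<close>

lemma lin_kernel:
  assumes J: "J \<subseteq> \<Delta>" and v: "supp_in J v" and k: "\<And>a. a \<in> J \<Longrightarrow> 2 * v a = (\<Sum>b\<in>nbr a. v b)"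
  shows "v = (\<lambda>_. 0)"
proof -
  have "lin v \<bullet> a = 0" if "a \<in> J" for a
    using cartan_lin[of a v] k[OF that] \<Delta>_nonzero[of a] that J by (auto simp: cartan_def)
  then have "of_int (v a) * (lin v \<bullet> a) = 0" for a
    using v by (cases "a \<in> J") (auto simp: supp_in_def)
  then have "lin v \<bullet> lin v = 0"
    by (subst (2) lin_def) (auto simp: inner_sum_right intro!: sum.neutral)
  then have "lin v = lin (\<lambda>_. 0)" by (simp add: lin_zero)
  then show ?thesis using lin_inject[of v "\<lambda>_. 0"] supp_in_mono[OF v J] by (simp add: supp_in_def)
qed

sublocale simply_laced \<Delta> nbr P coord_roots
proof
  show "finite \<Delta>" by (rule finite_\<Delta>)
  show "finite coord_roots"
  proof (rule finite_imageD)
    show "finite (lin ` coord_roots)" by (rule finite_subset[OF _ finite_\<Phi>]) (auto simp: coord_roots_def)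
    show "inj_on lin coord_roots" using lin_inject by (auto simp: inj_on_def coord_roots_def)
  qed
  show "nbr a \<subseteq> \<Delta>" for a by (auto simp: nbr_def)
  show "b \<in> nbr a \<Longrightarrow> a \<in> nbr b" for a b by (auto simp: nbr_def inner_commute)
  show "b \<in> nbr a \<Longrightarrow> a \<in> P \<longleftrightarrow> b \<notin> P" for a b
    using bipartitionD unfolding nbr_def by (auto simp: inner_commute)
  show "x \<in> coord_roots \<Longrightarrow> supp_in \<Delta> x" for x by (simp add: coord_roots_def)
  show "(\<lambda>_. 0) \<notin> coord_roots" using zero_\<Phi> by (simp add: coord_roots_def lin_zero)
  show "a \<in> \<Delta> \<Longrightarrow> delta a \<in> coord_roots" for a
    using \<Delta>_subset by (auto simp: coord_roots_def lin_delta)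
  show "x(a := (\<Sum>b\<in>nbr a. x b) - x a) \<in> coord_roots" if "a \<in> \<Delta>" "x \<in> coord_roots" for a x
  proof -
    have "reflection a (lin x) \<in> \<Phi>" using that refl_\<Phi> \<Delta>_subset by (auto simp: coord_roots_def)
    then show ?thesis using that unfolding reflection_lin[OF that(1)] by (auto simp: coord_roots_def supp_in_def)
  qed
  show "nonneg x \<or> nonneg (- x)" if x: "x \<in> coord_roots" for x
  proof -
    obtain y where y: "y \<in> coord_roots" "lin y = lin x" "nonneg y \<or> nonneg (- y)"
      using coord_roots_surj[of "lin x"] x by (auto simp: coord_roots_def)
    then have "y = x" using lin_inject[of y x] x by (simp add: coord_roots_def)
    then show ?thesis using y by simp
  qed
  show "x \<in> coord_roots \<Longrightarrow> supp_in {a} x \<Longrightarrow> x = delta a \<or> x = ndelta a" for x a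
    by (rule coord_roots_multiple)
  show "J \<subseteq> \<Delta> \<Longrightarrow> supp_in J v \<Longrightarrow> (\<And>a. a \<in> J \<Longrightarrow> 2 * v a = (\<Sum>b\<in>nbr a. v b)) \<Longrightarrow> v = (\<lambda>_. 0)" for J v
    by (rule lin_kernel)
qed

section \<open>Transfer of roots, involutions and the compatibility degree\<close>

lemma lin_inj_AP: "inj_on lin (AP \<Delta>)"
  using lin_inject supp_in_AP by (auto simp: inj_on_def)

lemma positive_roots_eq: "positive_roots \<Phi> \<Delta> = lin ` PR \<Delta>"
proof (intro equalityI subsetI)
  fix b assume b: "b \<in> positive_roots \<Phi> \<Delta>"
  then obtain x where x: "x \<in> coord_roots" "lin x = b"
    using coord_roots_surj[of b] by (auto simp: positive_roots_def)
  have sx: "supp_in \<Delta> x" using x by (simp add: coord_roots_def)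
  have "0 \<le> x a" for a
    using b root_coeff_lin[of a x] x(2) sx by (cases "a \<in> \<Delta>") (auto simp: positive_roots_def supp_in_def)
  then have "x \<in> PR \<Delta>" using x sx by (simp add: PR_def nonneg_def)
  then show "b \<in> lin ` PR \<Delta>" using x by blast
next
  fix b assume "b \<in> lin ` PR \<Delta>"
  then obtain x where x: "x \<in> PR \<Delta>" "b = lin x" by blast
  then show "b \<in> positive_roots \<Phi> \<Delta>"
    using PR_D(1,4)[OF x(1)] by (auto simp: positive_roots_def root_coeff_lin coord_roots_def)
qed

lemma almost_positive_roots_eq: "almost_positive_roots \<Phi> \<Delta> = lin ` AP \<Delta>"
proof -
  have "uminus ` \<Delta> = lin ` ndelta ` \<Delta>"
    unfolding image_image by (rule image_cong) (auto simp: lin_delta)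
  then show ?thesis unfolding almost_positive_roots_def positive_roots_eq AP_def by (simp add: image_Un)
qed

lemma fold_reflection_lin:
  assumes "side Q" "K \<subseteq> Q" "K \<subseteq> \<Delta>"
  shows "Finite_Set.fold reflection (lin x) K = lin (srefl K x)"
proof -
  have orth: "a \<bullet> b = 0" if "a \<in> K" "b \<in> K" "a \<noteq> b" for a b
    using side_nb[OF assms(1), of b a] that assms(2,3) by (auto simp: nbr_def inner_commute)
  have "finite K" using finite_subset[OF assms(3) finite_\<Delta>] .
  have "L \<subseteq> K \<Longrightarrow> Finite_Set.fold reflection (lin x) L = lin (srefl L x)" if "finite L" for L
    using that
  proof (induction L rule: finite_induct)
    case (insert k L)
    have "Finite_Set.fold reflection (lin x) (insert k L) = reflection k (lin (srefl L x))"
      using fold_reflection_insert[OF \<open>finite K\<close> orth insert.prems insert.hyps(2)] insert by simp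
    also have "\<dots> = lin (srefl (insert k L) x)"
    proof -
      have "k \<in> \<Delta>" "insert k L \<subseteq> Q" using insert.prems assms by auto
      then show ?thesis using reflection_lin[of k "srefl L x"] refl_insert[OF assms(1) _ insert.hyps(2), of x]
        by (simp only:)
    qed
    finally show ?case .
  qed simp
  then show ?thesis using \<open>finite K\<close> by blast
qed

lemma tau_lin:
  assumes Q: "side Q" and x: "x \<in> AP \<Delta>"
  shows "Defs.tau (Q \<inter> \<Delta>) (\<Delta> - Q) (lin x) = lin (tau Q \<Delta> x)"
proof -
  have "lin x \<in> uminus ` (\<Delta> - Q) \<longleftrightarrow> x \<in> ndelta ` (\<Delta> - Q)"
  proof
    assume "lin x \<in> uminus ` (\<Delta> - Q)"
    then obtain a where "a \<in> \<Delta> - Q" "lin x = lin (ndelta a)" by (auto simp: lin_delta)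
    then show "x \<in> ndelta ` (\<Delta> - Q)" using lin_inject[OF supp_in_AP[OF x], of "ndelta a"] by auto
  qed (auto simp: lin_delta)
  then show ?thesis using fold_reflection_lin[OF Q, of "Q \<inter> \<Delta>" x]
    by (simp add: Defs.tau_def tau_def)
qed

lemma tau_lin_PM:
  assumes "x \<in> AP \<Delta>"
  shows "Defs.tau P M (lin x) = lin (tau P \<Delta> x)" "Defs.tau M P (lin x) = lin (tau (- P) \<Delta> x)"
proof -
  have "P \<inter> \<Delta> = P" "\<Delta> - P = M" "- P \<inter> \<Delta> = M" "\<Delta> - - P = P" using bipartitionD(1,2) by auto
  then show "Defs.tau P M (lin x) = lin (tau P \<Delta> x)" "Defs.tau M P (lin x) = lin (tau (- P) \<Delta> x)"
    using tau_lin[OF side_P(1) assms] tau_lin[OF side_P(2) assms] by auto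
qed

text \<open>The defining values fix the degree when the first argument is a negative simple root,
  and invariance carries agreement along the orbit. Since the involution moves both arguments, the
  claim must range over all second arguments.\<close>

lemma compat_degree_unique:
  assumes c: "is_compat_degree \<Phi> \<Delta> P M c" and x: "x \<in> AP \<Delta>" and y: "y \<in> AP \<Delta>"
  shows "c (lin x) (lin y) = cdeg x y"
proof -
  have "\<forall>y\<in>AP \<Delta>. c (lin x) (lin y) = cdeg x y"
    using order_refl x
  proof (induction rule: AP_induct)
    case (ndelta a)
    show ?case
    proof
      fix y assume y: "y \<in> AP \<Delta>"
      then have "real (c (- a) (lin y)) = max (root_coeff \<Delta> (lin y) a) 0"
        using c ndelta unfolding is_compat_degree_def almost_positive_roots_eq by blast
      then show "c (lin (ndelta a)) (lin y) = cdeg (ndelta a) y"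
        using ndelta by (simp add: lin_delta root_coeff_lin cdeg_ndelta)
    qed
  next
    case (tau Q x)
    show ?case
    proof
      fix y assume y: "y \<in> AP \<Delta>"
      define z where "z = tau Q \<Delta> y"
      have z: "z \<in> AP \<Delta>" "y = tau Q \<Delta> z"
        using tau_AP[OF tau(1) order_refl y] tau_involution[OF tau(1) order_refl y] by (auto simp: z_def)
      have mem: "lin x \<in> almost_positive_roots \<Phi> \<Delta>" "lin z \<in> almost_positive_roots \<Phi> \<Delta>"
        unfolding almost_positive_roots_eq using tau(2) z(1) by auto
      have "c (Defs.tau P M (lin x)) (Defs.tau P M (lin z)) = c (lin x) (lin z)"
        "c (Defs.tau M P (lin x)) (Defs.tau M P (lin z)) = c (lin x) (lin z)"
        using c mem unfolding is_compat_degree_def by blast+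
      then have "c (lin (tau Q \<Delta> x)) (lin y) = c (lin x) (lin z)"
        using tau(1) tau_lin_PM[OF tau(2)] tau_lin_PM[OF z(1)] z(2) by (auto simp: side_def)
      also have "\<dots> = cdeg x z" using tau(3) z(1) by blast
      also have "\<dots> = cdeg (tau Q \<Delta> x) y"
        unfolding z(2) by (rule cdeg_tau[OF tau(1) order_refl tau(2) z(1), symmetric])
      finally show "c (lin (tau Q \<Delta> x)) (lin y) = cdeg (tau Q \<Delta> x) y" .
    qed
  qed
  then show ?thesis using y by blast
qed

definition coord :: "'a \<Rightarrow> 'a \<Rightarrow> int" where
  "coord = inv_into (AP \<Delta>) lin"

lemma coord_lin [simp]: "x \<in> AP \<Delta> \<Longrightarrow> coord (lin x) = x"
  unfolding coord_def by (rule inv_into_f_f[OF lin_inj_AP])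

lemma compat_degree_lin:
  assumes "x \<in> AP \<Delta>" "y \<in> AP \<Delta>"
  shows "compat_degree \<Phi> \<Delta> P M (lin x) (lin y) = cdeg x y"
proof -
  let ?R = "almost_positive_roots \<Phi> \<Delta>"
  \<comment> \<open>The witness for existence: the Euler-form degree carried over by
    \<open>lin\<close> and extended by zero, as the definite description demands.\<close>
  define d where "d a b = (if a \<in> ?R \<and> b \<in> ?R then cdeg (coord a) (coord b) else 0)" for a b
  have dl: "d (lin x) (lin y) = cdeg x y" if "x \<in> AP \<Delta>" "y \<in> AP \<Delta>" for x y
    using that by (simp add: d_def almost_positive_roots_eq)
  have d1: "is_compat_degree \<Phi> \<Delta> P M d"
    unfolding is_compat_degree_def almost_positive_roots_eq
  proof (intro conjI ballI)
    fix a b assume "a \<in> \<Delta>" "b \<in> lin ` AP \<Delta>"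
    then obtain y where y: "y \<in> AP \<Delta>" "b = lin y" by blast
    have "d (- a) b = cdeg (ndelta a) y" using dl[of "ndelta a" y] y \<open>a \<in> \<Delta>\<close> by (simp add: lin_delta)
    then show "real (d (- a) b) = max (root_coeff \<Delta> b a) 0"
      using \<open>a \<in> \<Delta>\<close> y by (simp add: root_coeff_lin cdeg_ndelta)
  next
    fix a b assume "a \<in> lin ` AP \<Delta>" "b \<in> lin ` AP \<Delta>"
    then obtain x y where xy: "x \<in> AP \<Delta>" "a = lin x" "y \<in> AP \<Delta>" "b = lin y" by blast
    show "d (Defs.tau P M a) (Defs.tau P M b) = d a b" "d (Defs.tau M P a) (Defs.tau M P b) = d a b"
      using xy tau_lin_PM cdeg_tau[OF side_P(1) order_refl] cdeg_tau[OF side_P(2) order_refl]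
        tau_AP[OF side_P(1) order_refl] tau_AP[OF side_P(2) order_refl] by (simp_all add: dl)
  qed
  have "compat_degree \<Phi> \<Delta> P M = d"
    unfolding compat_degree_def
  proof (rule the_equality)
    show "is_compat_degree \<Phi> \<Delta> P M d \<and> (\<forall>a b. a \<notin> ?R \<or> b \<notin> ?R \<longrightarrow> d a b = 0)"
      using d1 by (simp add: d_def)
    fix c assume c: "is_compat_degree \<Phi> \<Delta> P M c \<and> (\<forall>a b. a \<notin> ?R \<or> b \<notin> ?R \<longrightarrow> c a b = 0)"
    show "c = d"
    proof (intro ext)
      fix a b
      show "c a b = d a b"
      proof (cases "a \<in> ?R \<and> b \<in> ?R")
        case True
        then obtain x y where "x \<in> AP \<Delta>" "a = lin x" "y \<in> AP \<Delta>" "b = lin y"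
          unfolding almost_positive_roots_eq by blast
        then show ?thesis using c compat_degree_unique[of c x y] dl by simp
      next
        case False
        then show ?thesis using c by (auto simp: d_def)
      qed
    qed
  qed
  then show ?thesis using dl[OF assms] by simp
qed

section \<open>Transfer of clusters and edges\<close>

lemma compatible_set_image:
  assumes "C \<subseteq> AP \<Delta>"
  shows "compatible_set \<Phi> \<Delta> P M (lin ` C) \<longleftrightarrow> C \<in> CS \<Delta>"
proof -
  have "pairwise (compatible \<Phi> \<Delta> P M) (lin ` C) \<longleftrightarrow> pairwise comp C"
  proof -
    have "compatible \<Phi> \<Delta> P M (lin x) (lin y) \<longleftrightarrow> comp x y" if "x \<in> C" "y \<in> C" for x y
      using compat_degree_lin[OF subsetD[OF assms that(1)] subsetD[OF assms that(2)]]
      by (simp add: compatible_def comp_def)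
    moreover have "lin x = lin y \<longleftrightarrow> x = y" if "x \<in> C" "y \<in> C" for x y
      using lin_inj_AP assms that by (meson inj_on_eq_iff subsetD)
    ultimately show ?thesis by (auto simp: pairwise_def)
  qed
  then show ?thesis using assms by (auto simp: compatible_set_def CS_def almost_positive_roots_eq)
qed

lemma compatible_set_iff: "compatible_set \<Phi> \<Delta> P M D \<longleftrightarrow> (\<exists>C\<in>CS \<Delta>. D = lin ` C)"
proof
  assume D: "compatible_set \<Phi> \<Delta> P M D"
  then have "D \<subseteq> lin ` AP \<Delta>" by (simp add: compatible_set_def almost_positive_roots_eq)
  then obtain C where "C \<subseteq> AP \<Delta>" "D = lin ` C" by (auto simp: subset_image_iff)
  then show "\<exists>C\<in>CS \<Delta>. D = lin ` C" using compatible_set_image D by blast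
next
  assume "\<exists>C\<in>CS \<Delta>. D = lin ` C"
  then show "compatible_set \<Phi> \<Delta> P M D" using compatible_set_image CS_D(1) by blast
qed

lemma lin_image_subset_iff: "C \<subseteq> AP \<Delta> \<Longrightarrow> D \<subseteq> AP \<Delta> \<Longrightarrow> lin ` C \<subseteq> lin ` D \<longleftrightarrow> C \<subseteq> D"
  by (rule inj_on_image_subset_iff[OF lin_inj_AP])

lemma clusters_eq: "clusters \<Phi> \<Delta> P M = (`) lin ` Cl \<Delta>"
proof (intro equalityI subsetI)
  fix D assume D: "D \<in> clusters \<Phi> \<Delta> P M"
  then obtain C where C: "C \<in> CS \<Delta>" "D = lin ` C" by (auto simp: clusters_def compatible_set_iff)
  have "E = C" if E: "E \<in> CS \<Delta>" "C \<subseteq> E" for E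
  proof -
    have "compatible_set \<Phi> \<Delta> P M (lin ` E)" using E compatible_set_iff by blast
    moreover have "D \<subseteq> lin ` E" using C E by blast
    ultimately have "lin ` E \<subseteq> lin ` C" using D C(2) unfolding clusters_def by blast
    then show ?thesis using lin_image_subset_iff[OF CS_D(1)[OF E(1)] CS_D(1)[OF C(1)]] E(2) by blast
  qed
  then have "C \<in> Cl \<Delta>" using C by (auto simp: Cl_def)
  then show "D \<in> (`) lin ` Cl \<Delta>" using C by blast
next
  fix D assume "D \<in> (`) lin ` Cl \<Delta>"
  then obtain C where C: "C \<in> Cl \<Delta>" "D = lin ` C" by blast
  note CCS = Cl_CS[OF C(1)]
  have "F = D" if F: "compatible_set \<Phi> \<Delta> P M F" "D \<subseteq> F" for F
  proof -
    obtain E where E: "E \<in> CS \<Delta>" "F = lin ` E" using F compatible_set_iff by blast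
    then have "C \<subseteq> E" using F(2) C(2) lin_image_subset_iff[OF CS_D(1)[OF CCS] CS_D(1)[OF E(1)]] by simp
    then have "E = C" using C(1) E(1) by (auto simp: Cl_def)
    then show ?thesis using C E by simp
  qed
  then show "D \<in> clusters \<Phi> \<Delta> P M" using CCS C(2) by (auto simp: clusters_def compatible_set_iff)
qed

lemma positive_clusters_eq: "positive_clusters \<Phi> \<Delta> P M = (`) lin ` PCl \<Delta>"
proof -
  have "lin ` C \<subseteq> lin ` PR \<Delta> \<longleftrightarrow> C \<subseteq> PR \<Delta>" if "C \<in> Cl \<Delta>" for C
    by (rule lin_image_subset_iff[OF CS_D(1)[OF Cl_CS[OF that]] PR_subset_AP])
  then show ?thesis unfolding positive_clusters_def clusters_eq positive_roots_eq PCl_def by auto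
qed

lemma card_positive_exchange_edges:
  "card (positive_exchange_edges \<Phi> \<Delta> P M) = card (pos_edges \<Delta>)"
proof -
  have sub: "C \<subseteq> AP \<Delta>" if "C \<in> PCl \<Delta>" for C using CS_D(1)[OF Cl_CS[OF PCl_D(1)[OF that]]] .
  have inj: "inj_on ((`) lin) (PCl \<Delta>)"
    by (rule inj_onI) (simp add: inj_on_image_eq_iff[OF lin_inj_AP sub sub])
  have eqv: "lin ` C = lin ` D \<longleftrightarrow> C = D" "card (lin ` C \<inter> lin ` D) = card (C \<inter> D)"
    if "C \<in> PCl \<Delta>" "D \<in> PCl \<Delta>" for C D
  proof -
    show "lin ` C = lin ` D \<longleftrightarrow> C = D" using inj that by (auto simp: inj_on_def)
    have "lin ` C \<inter> lin ` D = lin ` (C \<inter> D)"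
      by (rule inj_on_image_Int[OF lin_inj_AP sub[OF that(1)] sub[OF that(2)], symmetric])
    moreover have "inj_on lin (C \<inter> D)" by (rule inj_on_subset[OF lin_inj_AP]) (use sub that in auto)
    ultimately show "card (lin ` C \<inter> lin ` D) = card (C \<inter> D)" by (simp add: card_image)
  qed
  have pc: "positive_clusters \<Phi> \<Delta> P M \<subseteq> clusters \<Phi> \<Delta> P M" by (auto simp: positive_clusters_def)
  have "positive_exchange_edges \<Phi> \<Delta> P M = (`) ((`) lin) ` pos_edges \<Delta>"
  proof (intro equalityI subsetI)
    fix e assume "e \<in> positive_exchange_edges \<Phi> \<Delta> P M"
    then have "e \<in> exchange_edges \<Phi> \<Delta> P M" and sub: "e \<subseteq> positive_clusters \<Phi> \<Delta> P M"
      unfolding positive_exchange_edges_def by blast+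
    then obtain X Y where XY: "e = {X, Y}" "X \<noteq> Y" "card (X \<inter> Y) = card \<Delta> - 1"
      unfolding exchange_edges_def by blast
    with sub have e: "e = {X, Y}" "X \<in> positive_clusters \<Phi> \<Delta> P M" "Y \<in> positive_clusters \<Phi> \<Delta> P M"
      "X \<noteq> Y" "card (X \<inter> Y) = card \<Delta> - 1"
      by simp_all
    then obtain C D where CD: "C \<in> PCl \<Delta>" "D \<in> PCl \<Delta>" "X = lin ` C" "Y = lin ` D"
      unfolding positive_clusters_eq by blast
    have "C \<noteq> D" "card (C \<inter> D) = card \<Delta> - 1"
      using e(4,5) unfolding CD(3,4) by (simp_all add: eqv[OF CD(1,2)])
    then have "{C, D} \<in> pos_edges \<Delta>" using CD(1,2) unfolding pos_edges_def by blast
    moreover have "e = (`) lin ` {C, D}" using e(1) CD by simp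
    ultimately show "e \<in> (`) ((`) lin) ` pos_edges \<Delta>" by blast
  next
    fix e assume "e \<in> (`) ((`) lin) ` pos_edges \<Delta>"
    then obtain e' where e': "e' \<in> pos_edges \<Delta>" "e = (`) lin ` e'" by blast
    then obtain C D where CD': "e' = {C, D}" and "C \<in> PCl \<Delta>" "D \<in> PCl \<Delta>" "C \<noteq> D"
      "card (C \<inter> D) = card \<Delta> - 1"
      unfolding pos_edges_def by blast
    with e'(2) have CD: "e = {lin ` C, lin ` D}" "C \<in> PCl \<Delta>" "D \<in> PCl \<Delta>" "C \<noteq> D"
      "card (C \<inter> D) = card \<Delta> - 1"
      by simp_all
    have "lin ` C \<in> positive_clusters \<Phi> \<Delta> P M" "lin ` D \<in> positive_clusters \<Phi> \<Delta> P M"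
      unfolding positive_clusters_eq using CD by auto
    moreover from this pc have "lin ` C \<in> clusters \<Phi> \<Delta> P M" "lin ` D \<in> clusters \<Phi> \<Delta> P M" by auto
    moreover have "lin ` C \<noteq> lin ` D" "card (lin ` C \<inter> lin ` D) = card \<Delta> - 1"
      using CD(4,5) by (simp_all add: eqv[OF CD(2,3)])
    ultimately show "e \<in> positive_exchange_edges \<Phi> \<Delta> P M"
      unfolding positive_exchange_edges_def exchange_edges_def CD(1) by blast
  qed
  moreover have "inj_on ((`) ((`) lin)) (pos_edges \<Delta>)"
  proof (rule inj_onI)
    fix e f assume *: "e \<in> pos_edges \<Delta>" "f \<in> pos_edges \<Delta>" "(`) lin ` e = (`) lin ` f"
    have "e \<subseteq> PCl \<Delta>" "f \<subseteq> PCl \<Delta>" using * by (auto simp: pos_edges_def)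
    then show "e = f" using inj_on_image_eq_iff[OF inj, of e f] *(3) by simp
  qed
  ultimately show ?thesis by (simp add: card_image)
qed

text \<open>Adjacency shows only in the off-diagonal Cartan entries, whence the
  \<open>i \<noteq> j\<close>; the order of the arguments of \<open>A\<close> follows the inner
  product tested by \<open>nbr\<close>. The bijection \<open>s\<close> allows a diagram to be
  renumbered.\<close>

lemma numbering_of_diagram:
  assumes f: "bij_betw f {1..n} \<Delta>"
    and cart: "\<forall>i\<in>{1..n}. \<forall>j\<in>{1..n}. cartan (f i) (f j) = (if i = j then 2 else if A i j then - 1 else 0)"
    and s: "bij_betw s {..<n} {1..n}"
    and adj: "\<And>i j. i < n \<Longrightarrow> j < n \<Longrightarrow> i \<noteq> j \<and> A (s j) (s i) \<longleftrightarrow> adj i j"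
  shows "numbering adj (\<lambda>k. f (s k)) n \<Delta>"
proof -
  have fs: "bij_betw (\<lambda>k. f (s k)) {..<n} \<Delta>"
    using bij_betw_trans[OF s f] by (simp add: o_def)
  have sm: "s k \<in> {1..n}" if "k < n" for k using bij_betwE[OF s] that by auto
  have sinj: "s i = s j \<longleftrightarrow> i = j" if "i < n" "j < n" for i j
    using bij_betw_imp_inj_on[OF s] that by (auto simp: inj_on_eq_iff)
  have "f (s j) \<in> nbr (f (s i)) \<longleftrightarrow> adj i j" if ij: "i < n" "j < n" for i j
  proof -
    have mem: "f (s i) \<in> \<Delta>" "f (s j) \<in> \<Delta>" using bij_betwE[OF fs] ij by auto
    have ne: "f (s j) = f (s i) \<longleftrightarrow> i = j"
      using inj_onD[OF bij_betw_imp_inj_on[OF fs], of j i] ij by auto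
    have "f (s j) \<bullet> f (s i) \<noteq> 0 \<longleftrightarrow> cartan (f (s j)) (f (s i)) \<noteq> 0"
      using \<Delta>_nonzero[OF mem(1)] by (simp add: cartan_def)
    also have "cartan (f (s j)) (f (s i)) = (if i = j then 2 else if A (s j) (s i) then - 1 else 0)"
      using cart sm[OF ij(1)] sm[OF ij(2)] sinj[OF ij(2,1)] by auto
    finally show ?thesis using mem ne adj[OF ij] by (auto simp: nbr_def)
  qed
  then show ?thesis using bij_betw_imp_inj_on[OF fs] bij_betw_imp_surj_on[OF fs] by (auto simp: numbering_def)
qed

end

lemma laced_root_systemI:
  assumes "root_system \<Phi>" "simple_roots \<Phi> \<Delta>" "diagram_bipartition \<Delta> P M" "simply_laced_diagram n A \<Delta>"
  shows "laced_root_system \<Phi> \<Delta> P M"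
proof
  fix a b assume ab: "a \<in> \<Delta>" "b \<in> \<Delta>" "a \<noteq> b"
  obtain f where f: "bij_betw f {1..n} \<Delta>"
    "\<forall>i\<in>{1..n}. \<forall>j\<in>{1..n}. cartan (f i) (f j) = (if i = j then 2 else if A i j then - 1 else 0)"
    using assms(4) unfolding simply_laced_diagram_def by blast
  obtain i j where "i \<in> {1..n}" "a = f i" "j \<in> {1..n}" "b = f j"
    using ab bij_betw_imp_surj_on[OF f(1)] by blast
  then show "cartan a b = - 1 \<or> cartan a b = 0" using f(2) ab(3) by auto
qed (use assms in auto)

theorem theorem0p2:
  fixes \<Phi> \<Delta> P M :: "'a::real_inner set" and n :: nat
  assumes "root_system \<Phi>"
    and "simple_roots \<Phi> \<Delta>"
    and "diagram_bipartition \<Delta> P M"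
  shows "(type_A n \<Delta> \<longrightarrow>
            card (positive_exchange_edges \<Phi> \<Delta> P M) = (2 * n - 1) choose (n + 1)) \<and>
         (type_D n \<Delta> \<longrightarrow>
            card (positive_exchange_edges \<Phi> \<Delta> P M) = (3 * n - 4) * ((2 * (n - 2)) choose (n - 3)))"
proof (intro conjI impI)
  assume "type_A n \<Delta>"
  then have n: "1 \<le> n" and d: "simply_laced_diagram n adj_A \<Delta>" by (auto simp: type_A_def)
  interpret laced_root_system \<Phi> \<Delta> P M by (rule laced_root_systemI[OF assms d])
  obtain f where f: "bij_betw f {1..n} \<Delta>"
    "\<forall>i\<in>{1..n}. \<forall>j\<in>{1..n}. cartan (f i) (f j) = (if i = j then 2 else if adj_A i j then - 1 else 0)"
    using d unfolding simply_laced_diagram_def by blast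
  have "bij_betw Suc {..<n} {1..n}"
    by (rule bij_betw_byWitness[where f' = "\<lambda>k. k - 1"]) auto
  then have N: "numbering path_adj (\<lambda>k. f (Suc k)) n \<Delta>"
    by (rule numbering_of_diagram[OF f]) (auto simp: adj_A_def path_adj_def)
  show "card (positive_exchange_edges \<Phi> \<Delta> P M) = (2 * n - 1) choose (n + 1)"
    unfolding card_positive_exchange_edges
    by (rule path_edges_closed_form[OF n path_card_pos_edges[OF N n]])
next
  assume "type_D n \<Delta>"
  then have n: "4 \<le> n" and d: "simply_laced_diagram n (adj_D n) \<Delta>" by (auto simp: type_D_def)
  interpret laced_root_system \<Phi> \<Delta> P M by (rule laced_root_systemI[OF assms d])
  obtain f where f: "bij_betw f {1..n} \<Delta>"
    "\<forall>i\<in>{1..n}. \<forall>j\<in>{1..n}. cartan (f i) (f j) = (if i = j then 2 else if adj_D n i j then - 1 else 0)"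
    using d unfolding simply_laced_diagram_def by blast
  \<comment> \<open>Numbering from the opposite end puts the fork first: \<open>n\<close> and
    \<open>n - 1\<close> become 0 and 1, and the branch node \<open>n - 2\<close> becomes 2.\<close>
  have "bij_betw (\<lambda>k. n - k) {..<n} {1..n}"
    by (rule bij_betw_byWitness[where f' = "\<lambda>k. n - k"]) auto
  then have N: "numbering fork_adj (\<lambda>k. f (n - k)) n \<Delta>"
    by (rule numbering_of_diagram[OF f]) (use n in \<open>auto simp: adj_D_def adj_A_def fork_adj_def\<close>)
  show "card (positive_exchange_edges \<Phi> \<Delta> P M) = (3 * n - 4) * ((2 * (n - 2)) choose (n - 3))"
    unfolding card_positive_exchange_edges
    by (rule fork_edges_closed_form[OF n fork_card_pos_edges[OF N]]) (use n in simp)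
qed

end
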